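(* For every graph class $\mathcal G$ with clique-bounded odd cycle transversal number, there exists a polynomial-time algorithm for the Maximum Weight Independent Set problem restricted to graphs in $\mathcal G$.
   Context: All graphs are finite, simple and undirected; $\omega$ denotes the clique number. A graph class is a set of graphs closed under isomorphism. An odd cycle transversal of $G$ is a set $S\subseteq V(G)$ meeting every odd cycle of $G$; $\mathrm{oct}(G)$ is the minimum size of such a set. $\mathcal G$ has clique-bounded $\mathrm{oct}$ if there is a nondecreasing $f$ with $\mathrm{oct}(G')\le f(\omega(G'))$ for every induced subgraph $G'$ of every $G\in\mathcal G$. The Maximum Weight Independent Set problem: given a graph $G$ and a weight function on $V(G)$, find an independent set of $G$ of maximum total weight. *)

theory Defs
  imports Complex_Main "HOL-Library.Log_Nat" "HOL-Computational_Algebra.Polynomial"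
begin

section \<open>Finite simple graphs\<close>

text \<open>
  Every finite graph is isomorphic to one whose vertices are natural numbers, so a graph class
  (closed under isomorphism) is determined by its members of type \<open>ugraph\<close>.
\<close>

type_synonym ugraph = "nat set \<times> nat set set"

abbreviation verts :: "ugraph \<Rightarrow> nat set" where "verts \<equiv> fst"
abbreviation edges :: "ugraph \<Rightarrow> nat set set" where "edges \<equiv> snd"

definition simple_graph :: "ugraph \<Rightarrow> bool" where
  "simple_graph G \<longleftrightarrow> finite (verts G) \<and> (\<forall>e\<in>edges G. e \<subseteq> verts G \<and> card e = 2)"

definition graph_iso :: "ugraph \<Rightarrow> ugraph \<Rightarrow> bool" where
  "graph_iso G H \<longleftrightarrow> (\<exists>h. bij_betw h (verts G) (verts H) \<and>
     (\<forall>u\<in>verts G. \<forall>v\<in>verts G. {u, v} \<in> edges G \<longleftrightarrow> {h u, h v} \<in> edges H))"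

definition graph_class :: "ugraph set \<Rightarrow> bool" where
  "graph_class \<G> \<longleftrightarrow> (\<forall>G\<in>\<G>. simple_graph G) \<and>
     (\<forall>G\<in>\<G>. \<forall>H. simple_graph H \<and> graph_iso G H \<longrightarrow> H \<in> \<G>)"

definition induced_subgraph :: "ugraph \<Rightarrow> ugraph \<Rightarrow> bool" where
  "induced_subgraph H G \<longleftrightarrow>
     verts H \<subseteq> verts G \<and> edges H = {e \<in> edges G. e \<subseteq> verts H}"

definition clique :: "ugraph \<Rightarrow> nat set \<Rightarrow> bool" where
  "clique G K \<longleftrightarrow> K \<subseteq> verts G \<and> (\<forall>u\<in>K. \<forall>v\<in>K. u \<noteq> v \<longrightarrow> {u, v} \<in> edges G)"

definition clique_number :: "ugraph \<Rightarrow> nat" where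
  "clique_number G = Max (card ` {K. clique G K})"

text \<open>A cycle is given by the list of its vertices in cyclic order.\<close>

definition graph_cycle :: "ugraph \<Rightarrow> nat list \<Rightarrow> bool" where
  "graph_cycle G xs \<longleftrightarrow> 3 \<le> length xs \<and> distinct xs \<and> set xs \<subseteq> verts G \<and>
     (\<forall>i<length xs. {xs ! i, xs ! (Suc i mod length xs)} \<in> edges G)"

definition odd_cycle_transversal :: "ugraph \<Rightarrow> nat set \<Rightarrow> bool" where
  "odd_cycle_transversal G S \<longleftrightarrow> S \<subseteq> verts G \<and>
     (\<forall>xs. graph_cycle G xs \<and> odd (length xs) \<longrightarrow> S \<inter> set xs \<noteq> {})"

definition oct :: "ugraph \<Rightarrow> nat" where
  "oct G = (LEAST k. \<exists>S. odd_cycle_transversal G S \<and> card S = k)"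

definition clique_bounded :: "(ugraph \<Rightarrow> nat) \<Rightarrow> ugraph set \<Rightarrow> bool" where
  "clique_bounded \<rho> \<G> \<longleftrightarrow> (\<exists>f :: nat \<Rightarrow> nat. mono f \<and>
     (\<forall>G\<in>\<G>. \<forall>H. induced_subgraph H G \<longrightarrow> \<rho> H \<le> f (clique_number H)))"


section \<open>Maximum weight independent sets\<close>

definition indep_set :: "ugraph \<Rightarrow> nat set \<Rightarrow> bool" where
  "indep_set G I \<longleftrightarrow> I \<subseteq> verts G \<and> (\<forall>u\<in>I. \<forall>v\<in>I. {u, v} \<notin> edges G)"

definition max_weight_indep_set :: "ugraph \<Rightarrow> (nat \<Rightarrow> rat) \<Rightarrow> nat set \<Rightarrow> bool" where
  "max_weight_indep_set G w I \<longleftrightarrow>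
     indep_set G I \<and> (\<forall>J. indep_set G J \<longrightarrow> sum w J \<le> sum w I)"


section \<open>Programs and their running time\<close>

text \<open>
  Algorithms are while programs whose variables hold binary trees with integer leaves.  The cost
  measure is logarithmic: evaluating an expression costs the total size of the values of all its
  subexpressions, where an integer counts with its number of binary digits.  Every primitive
  operation is computable in time polynomial in the sizes charged for it, and no value can
  grow beyond what has been paid for, so polynomial time in this model coincides with polynomial
  time on Turing machines.
\<close>

datatype val = Atom int | Node val val

fun vsize :: "val \<Rightarrow> nat" where
  "vsize (Atom i) = 1 + floorlog 2 (nat \<bar>i\<bar>)"
| "vsize (Node a b) = 1 + vsize a + vsize b"

datatype expr =
    Const int
  | Var nat
  | MkNode expr expr
  | Left expr
  | Right expr
  | IsNode expr
  | Add expr expr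
  | Sub expr expr
  | Mul expr expr
  | Less expr expr

type_synonym state = "nat \<Rightarrow> val"

text \<open>Operations applied to a value of the wrong kind treat it as, or return, the integer 0.\<close>

fun to_int :: "val \<Rightarrow> int" where
  "to_int (Atom i) = i"
| "to_int (Node a b) = 0"

fun left :: "val \<Rightarrow> val" where
  "left (Atom i) = Atom 0"
| "left (Node a b) = a"

fun right :: "val \<Rightarrow> val" where
  "right (Atom i) = Atom 0"
| "right (Node a b) = b"

fun is_node :: "val \<Rightarrow> bool" where
  "is_node (Atom i) = False"
| "is_node (Node a b) = True"

fun eval_expr :: "expr \<Rightarrow> state \<Rightarrow> val" where
  "eval_expr (Const i) s = Atom i"
| "eval_expr (Var x) s = s x"
| "eval_expr (MkNode a b) s = Node (eval_expr a s) (eval_expr b s)"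
| "eval_expr (Left a) s = left (eval_expr a s)"
| "eval_expr (Right a) s = right (eval_expr a s)"
| "eval_expr (IsNode a) s = Atom (of_bool (is_node (eval_expr a s)))"
| "eval_expr (Add a b) s = Atom (to_int (eval_expr a s) + to_int (eval_expr b s))"
| "eval_expr (Sub a b) s = Atom (to_int (eval_expr a s) - to_int (eval_expr b s))"
| "eval_expr (Mul a b) s = Atom (to_int (eval_expr a s) * to_int (eval_expr b s))"
| "eval_expr (Less a b) s = Atom (of_bool (to_int (eval_expr a s) < to_int (eval_expr b s)))"

fun expr_cost :: "expr \<Rightarrow> state \<Rightarrow> nat" where
  "expr_cost (Const i) s = vsize (eval_expr (Const i) s)"
| "expr_cost (Var x) s = vsize (eval_expr (Var x) s)"
| "expr_cost (MkNode a b) s = expr_cost a s + expr_cost b s + vsize (eval_expr (MkNode a b) s)"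
| "expr_cost (Left a) s = expr_cost a s + vsize (eval_expr (Left a) s)"
| "expr_cost (Right a) s = expr_cost a s + vsize (eval_expr (Right a) s)"
| "expr_cost (IsNode a) s = expr_cost a s + vsize (eval_expr (IsNode a) s)"
| "expr_cost (Add a b) s = expr_cost a s + expr_cost b s + vsize (eval_expr (Add a b) s)"
| "expr_cost (Sub a b) s = expr_cost a s + expr_cost b s + vsize (eval_expr (Sub a b) s)"
| "expr_cost (Mul a b) s = expr_cost a s + expr_cost b s + vsize (eval_expr (Mul a b) s)"
| "expr_cost (Less a b) s = expr_cost a s + expr_cost b s + vsize (eval_expr (Less a b) s)"

datatype com =
    Skip
  | Assign nat expr
  | Seq com com
  | If expr com com
  | While expr com

text \<open>A test succeeds unless its value is the integer 0.\<close>

abbreviation test :: "expr \<Rightarrow> state \<Rightarrow> bool" where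
  "test e s \<equiv> eval_expr e s \<noteq> Atom 0"

text \<open>\<open>exec c s t s'\<close>: started in \<open>s\<close>, the program \<open>c\<close> halts in \<open>s'\<close> after time \<open>t\<close>.\<close>

inductive exec :: "com \<Rightarrow> state \<Rightarrow> nat \<Rightarrow> state \<Rightarrow> bool" where
  Skip: "exec Skip s 1 s"
| Assign: "exec (Assign x e) s (1 + expr_cost e s) (s(x := eval_expr e s))"
| Seq: "exec c1 s t1 s1 \<Longrightarrow> exec c2 s1 t2 s2 \<Longrightarrow> exec (Seq c1 c2) s (t1 + t2) s2"
| IfTrue: "test e s \<Longrightarrow> exec c1 s t s1 \<Longrightarrow> exec (If e c1 c2) s (1 + expr_cost e s + t) s1"
| IfFalse: "\<not> test e s \<Longrightarrow> exec c2 s t s1 \<Longrightarrow> exec (If e c1 c2) s (1 + expr_cost e s + t) s1"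
| WhileFalse: "\<not> test e s \<Longrightarrow> exec (While e c) s (1 + expr_cost e s) s"
| WhileTrue: "test e s \<Longrightarrow> exec c s t1 s1 \<Longrightarrow> exec (While e c) s1 t2 s2 \<Longrightarrow>
    exec (While e c) s (1 + expr_cost e s + t1 + t2) s2"

lemma exec_deterministic:
  "exec c s t s1 \<Longrightarrow> exec c s t' s1' \<Longrightarrow> t' = t \<and> s1' = s1"
proof (induction arbitrary: t' s1' rule: exec.induct)
  case (Skip s)
  then show ?case by (cases rule: exec.cases) simp_all
next
  case (Assign x e s)
  then show ?case by (cases rule: exec.cases) simp_all
next
  case (Seq c1 s t1 s1 c2 t2 s2)
  from Seq.prems obtain u1 u2 r where "exec c1 s u1 r" "exec c2 r u2 s1'" "t' = u1 + u2"
    by (cases rule: exec.cases) blast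
  with Seq.IH show ?case by blast
next
  case (IfTrue e s c1 t s1 c2)
  from IfTrue.prems IfTrue.hyps(1) obtain u where "exec c1 s u s1'" "t' = 1 + expr_cost e s + u"
    by (cases rule: exec.cases) blast+
  with IfTrue.IH show ?case by blast
next
  case (IfFalse e s c2 t s1 c1)
  from IfFalse.prems IfFalse.hyps(1) obtain u where "exec c2 s u s1'" "t' = 1 + expr_cost e s + u"
    by (cases rule: exec.cases) blast+
  with IfFalse.IH show ?case by blast
next
  case (WhileFalse e s c)
  from WhileFalse.prems WhileFalse.hyps(1) show ?case
    by (cases rule: exec.cases) blast+
next
  case (WhileTrue e s c t1 s1 t2 s2)
  from WhileTrue.prems WhileTrue.hyps(1) obtain u1 u2 r where
    "exec c s u1 r" "exec (While e c) r u2 s1'" "t' = 1 + expr_cost e s + u1 + u2"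
    by (cases rule: exec.cases) blast+
  with WhileTrue.IH show ?case by blast
qed

definition computes :: "com \<Rightarrow> val \<Rightarrow> nat \<Rightarrow> val \<Rightarrow> bool" where
  "computes c x t y \<longleftrightarrow> (\<exists>s. exec c ((\<lambda>_. Atom 0)(0 := x)) t s \<and> s 0 = y)"


section \<open>Encoding of instances and solutions\<close>

fun val_of_list :: "val list \<Rightarrow> val" where
  "val_of_list [] = Atom 0"
| "val_of_list (v # vs) = Node v (val_of_list vs)"

definition val_of_nat :: "nat \<Rightarrow> val" where
  "val_of_nat n = Atom (int n)"

text \<open>A rational number is given by its reduced numerator and positive denominator.\<close>

definition val_of_rat :: "rat \<Rightarrow> val" where
  "val_of_rat q = (case quotient_of q of (a, b) \<Rightarrow> Node (Atom a) (Atom b))"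

text \<open>
  A weighted graph is presented as a list of its vertices with their weights and a list of its
  edges, both in arbitrary order and without repetition.
\<close>

definition encodes_weighted_graph :: "ugraph \<Rightarrow> (nat \<Rightarrow> rat) \<Rightarrow> val \<Rightarrow> bool" where
  "encodes_weighted_graph G w x \<longleftrightarrow> (\<exists>vs es.
     distinct vs \<and> set vs = verts G \<and>
     distinct (map (\<lambda>(u, v). {u, v}) es) \<and> set (map (\<lambda>(u, v). {u, v}) es) = edges G \<and>
     x = Node (val_of_list (map (\<lambda>v. Node (val_of_nat v) (val_of_rat (w v))) vs))
              (val_of_list (map (\<lambda>(u, v). Node (val_of_nat u) (val_of_nat v)) es)))"

definition encodes_vertex_set :: "nat set \<Rightarrow> val \<Rightarrow> bool" where
  "encodes_vertex_set I y \<longleftrightarrow>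
     (\<exists>vs. distinct vs \<and> set vs = I \<and> y = val_of_list (map val_of_nat vs))"

text \<open>
  As usual for a problem restricted to a graph class, nothing is required of the program on
  inputs that do not encode a member of the class.
\<close>

definition poly_time_MWIS_algorithm :: "com \<Rightarrow> ugraph set \<Rightarrow> bool" where
  "poly_time_MWIS_algorithm c \<G> \<longleftrightarrow> (\<exists>p :: nat poly.
     \<forall>G\<in>\<G>. \<forall>w x. encodes_weighted_graph G w x \<longrightarrow>
       (\<exists>t y I. computes c x t y \<and> t \<le> poly p (vsize x) \<and>
          encodes_vertex_set I y \<and> max_weight_indep_set G w I))"

end

theory Submission
  imports Defs
begin

text \<open>
  Let \<open>f\<close> bound \<open>oct\<close> on the class and put \<open>p = f 3\<close>.  If \<open>B\<close> is a maximum induced bipartite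
  subgraph of \<open>G\<close> and \<open>J\<close> is an independent set outside \<open>B\<close>, then \<open>G[B \<union> J]\<close> has clique number
  at most 3, so it becomes bipartite after deleting at most \<open>p\<close> vertices, and the maximality of \<open>B\<close>
  gives \<open>|J| \<le> p\<close>.  It suffices that \<open>B\<close> is maximum among the bipartite subgraphs that differ from
  it in at most \<open>2p + 1\<close> vertices, and such a \<open>B\<close> is found by local search.  For every independent
  \<open>X\<close> of size at most \<open>p\<close>, one then adds to \<open>X\<close> an optimal solution of the bipartite graph
  \<open>B - N[X]\<close>, computed from a maximum flow (augmentation with capacity scaling, which is polynomial
  for binary weights).

  To show that while programs do all this in polynomial time, the functions on encoded data that
  they compute in polynomial time are shown to be closed under composition, pairing, case
  distinction and iterations whose intermediate values stay polynomially bounded.  The algorithm is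
  then an ordinary function on lists and integers.
\<close>

section \<open>Programs and polynomial time\<close>

text \<open>The number 3 is made up of two colour classes of \<open>B\<close> and one independent
  set. As only \<open>f 3\<close> enters, \<open>p\<close> is a constant of the class, and
  enumerating all lists of length at most \<open>p\<close> or \<open>2 * p + 1\<close> is
  polynomial. The radius \<open>2 * p + 1\<close> belongs to the one exchange that the argument
  performs: \<open>p + 1\<close> vertices of a too large \<open>J\<close> come in, a transversal of
  at most \<open>p\<close> vertices goes out. The obstacle on the side of running time is that a
  polynomial bound for one step does not bound its iteration, since values may double in every
  round. Therefore \<open>poly_time_on\<close> is relative to a set of inputs, and loops come with
  invariants that bound all intermediate values; those of the flow computation serve this purpose as
  much as correctness. Searches for a fixed point are written as folds over a list that only counts
  rounds. Surplus rounds leave a saturated value unchanged, so termination is immediate and what has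
  to be shown is that the counter is long enough.\<close>

lemma poly_nat_mono: "a \<le> b \<Longrightarrow> poly p a \<le> poly (p :: nat poly) b"
  by (induction p) (auto intro!: add_mono mult_mono)

class encodable =
  fixes enc :: "'a \<Rightarrow> val"

instantiation nat :: encodable begin
definition "enc n = Atom (int n)"
instance ..
end

instantiation int :: encodable begin
definition "enc n = Atom n"
instance ..
end

instantiation bool :: encodable begin
definition "enc b = Atom (of_bool b)"
instance ..
end

instantiation prod :: (encodable, encodable) encodable begin
definition "enc z = Node (enc (fst z)) (enc (snd z))"
instance ..
end

instantiation list :: (encodable) encodable begin
definition "enc xs = val_of_list (map enc xs)"
instance ..
end

abbreviation sz :: "'a::encodable \<Rightarrow> nat" where "sz x \<equiv> vsize (enc x)"

lemma enc_simps [simp]: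
  "enc (n::nat) = Atom (int n)" "enc (i::int) = Atom i" "enc b = Atom (of_bool b)"
  "enc (x, y) = Node (enc x) (enc y)" "enc [] = Atom 0" "enc (z # zs) = Node (enc z) (enc zs)"
  by (simp_all add: enc_nat_def enc_int_def enc_bool_def enc_prod_def enc_list_def)

lemma enc_pair: "enc z = Node (enc (fst z)) (enc (snd z))"
  by (simp add: enc_prod_def)

subsection \<open>Sizes\<close>

lemma vsize_pos: "vsize v \<ge> 1"
  by (cases v) auto

lemma vsize_left: "vsize (left v) \<le> vsize v"
  by (cases v) (auto intro: floorlog_mono)

lemma vsize_right: "vsize (right v) \<le> vsize v"
  by (cases v) (auto intro: floorlog_mono)

lemma vsize_Atom_mono: "\<bar>a\<bar> \<le> \<bar>b\<bar> \<Longrightarrow> vsize (Atom a) \<le> vsize (Atom b)"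
  by (auto intro!: floorlog_mono)

lemma floorlog_le: "n < 2 ^ k \<Longrightarrow> floorlog 2 n \<le> k"
  by (intro floorlog_leI) auto

lemma lt_floorlog: "n < 2 ^ floorlog 2 n"
  using floorlog_leD[of 2 n "floorlog 2 n"] by auto

lemma vsize_Atom_add: "vsize (Atom (a + b)) \<le> vsize (Atom a) + vsize (Atom b)"
proof -
  let ?a = "nat \<bar>a\<bar>" and ?b = "nat \<bar>b\<bar>"
  have "nat \<bar>a + b\<bar> \<le> ?a + ?b" by linarith
  also have "?a + ?b < 2 ^ floorlog 2 ?a + 2 ^ floorlog 2 ?b"
    by (intro add_strict_mono lt_floorlog)
  also have "\<dots> \<le> 2 ^ (floorlog 2 ?a + floorlog 2 ?b) + 2 ^ (floorlog 2 ?a + floorlog 2 ?b)"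
    by (intro add_mono power_increasing) auto
  also have "\<dots> = 2 ^ (1 + floorlog 2 ?a + floorlog 2 ?b)" by simp
  finally have "floorlog 2 (nat \<bar>a + b\<bar>) \<le> 1 + floorlog 2 ?a + floorlog 2 ?b"
    by (rule floorlog_le)
  then show ?thesis by simp
qed

lemma vsize_Atom_mult: "vsize (Atom (a * b)) \<le> vsize (Atom a) + vsize (Atom b)"
proof -
  let ?a = "nat \<bar>a\<bar>" and ?b = "nat \<bar>b\<bar>"
  have "floorlog 2 (nat \<bar>a * b\<bar>) \<le> floorlog 2 ?a + floorlog 2 ?b"
  proof (rule floorlog_le)
    have "nat \<bar>a * b\<bar> = ?a * ?b" by (simp add: abs_mult nat_mult_distrib)
    also have "\<dots> < 2 ^ floorlog 2 ?a * 2 ^ floorlog 2 ?b"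
      by (intro mult_strict_mono' lt_floorlog) auto
    also have "\<dots> = 2 ^ (floorlog 2 ?a + floorlog 2 ?b)" by (simp add: power_add)
    finally show "nat \<bar>a * b\<bar> < 2 ^ (floorlog 2 ?a + floorlog 2 ?b)" .
  qed
  then show ?thesis by simp
qed

lemma vsize_Atom_diff: "vsize (Atom (a - b)) \<le> vsize (Atom a) + vsize (Atom b)"
  using vsize_Atom_add[of a "- b"] by simp

lemma vsize_of_bool: "vsize (Atom (of_bool b)) \<le> 2"
  by (auto simp: floorlog_def)

lemma sz_list: "sz xs = 1 + (\<Sum>x\<leftarrow>xs. 1 + sz x)"
  by (induction xs) (auto simp: floorlog_def)

lemma sz_list_mem: "x \<in> set xs \<Longrightarrow> sz x < sz xs"
  by (induction xs) auto

lemma length_le_sz: "length xs < sz xs"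
  by (induction xs) auto

lemma sz_list_le:
  assumes "length xs \<le> L" "\<And>x. x \<in> set xs \<Longrightarrow> sz x \<le> M"
  shows "sz xs \<le> 1 + L * (1 + M)"
proof -
  have "(\<Sum>x\<leftarrow>xs. 1 + sz x) \<le> (\<Sum>x\<leftarrow>xs. 1 + M)"
    by (rule sum_list_mono) (use assms in auto)
  also have "\<dots> = length xs * (1 + M)" by (simp add: sum_list_triv)
  also have "\<dots> \<le> L * (1 + M)" using assms(1) by (intro mult_right_mono) auto
  finally show ?thesis by (simp add: sz_list)
qed

lemma sz_filter: "sz (filter P xs) \<le> sz xs"
  by (induction xs) auto

lemma sz_append: "sz (xs @ ys) \<le> sz xs + sz ys"
  by (induction xs) auto

subsection \<open>Polynomially bounded functions\<close>

text \<open>Polynomials over the naturals are monotone, so size bounds can be substituted into them.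
  The bound is demanded on \<open>D\<close> alone because many sizes are controlled only for inputs
  that satisfy an invariant.\<close>

definition pbdd :: "'a::encodable set \<Rightarrow> ('a \<Rightarrow> nat) \<Rightarrow> bool" where
  "pbdd D g \<longleftrightarrow> (\<exists>p. \<forall>x\<in>D. g x \<le> poly p (sz x))"

named_theorems pbdd_intros

lemma pbddI: "(\<And>x. x \<in> D \<Longrightarrow> g x \<le> poly p (sz x)) \<Longrightarrow> pbdd D g"
  unfolding pbdd_def by blast

lemma pbdd_const [pbdd_intros]: "pbdd D (\<lambda>_. c)"
  by (rule pbddI[of _ _ "[:c:]"]) simp

lemma pbdd_sz [pbdd_intros]: "pbdd D (\<lambda>x. sz x)"
  by (rule pbddI[of _ _ "[:0, 1:]"]) simp

lemma pbdd_add [pbdd_intros]: "pbdd D f \<Longrightarrow> pbdd D g \<Longrightarrow> pbdd D (\<lambda>x. f x + g x)"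
  unfolding pbdd_def by (metis add_mono poly_add)

lemma pbdd_mult [pbdd_intros]: "pbdd D f \<Longrightarrow> pbdd D g \<Longrightarrow> pbdd D (\<lambda>x. f x * g x)"
  unfolding pbdd_def by (metis mult_le_mono poly_mult)

lemma pbdd_mono: "pbdd D g \<Longrightarrow> (\<And>x. x \<in> D \<Longrightarrow> f x \<le> g x) \<Longrightarrow> pbdd D f"
  unfolding pbdd_def by (meson order_trans)

lemma pbdd_Suc [pbdd_intros]: "pbdd D f \<Longrightarrow> pbdd D (\<lambda>x. Suc (f x))"
  using pbdd_add[OF pbdd_const[of D 1]] by simp

lemma pbdd_subset: "pbdd D g \<Longrightarrow> D' \<subseteq> D \<Longrightarrow> pbdd D' g"
  unfolding pbdd_def by blast

lemma pbdd_comp: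
  assumes "pbdd E g" "\<And>x. x \<in> D \<Longrightarrow> f x \<in> E" "pbdd D (\<lambda>x. sz (f x))"
  shows "pbdd D (\<lambda>x. g (f x))"
proof -
  from assms obtain p q where p: "\<And>y. y \<in> E \<Longrightarrow> g y \<le> poly p (sz y)"
    and q: "\<And>x. x \<in> D \<Longrightarrow> sz (f x) \<le> poly q (sz x)"
    unfolding pbdd_def by blast
  show ?thesis
  proof (rule pbddI[of _ _ "pcompose p q"])
    fix x assume x: "x \<in> D"
    have "g (f x) \<le> poly p (sz (f x))" using p assms(2) x by blast
    also have "\<dots> \<le> poly p (poly q (sz x))" using q x poly_nat_mono by blast
    finally show "g (f x) \<le> poly (pcompose p q) (sz x)" by (simp add: poly_pcompose)
  qed
qed

subsection \<open>Running programs on variable 0 with clean scratch variables\<close>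

text \<open>The contract behind composition: variable 0 carries input and output, the variables
  below \<open>N\<close> are zero before and after, and all others return unchanged whatever they
  contain. A caller can therefore park values in the variables from \<open>N\<close> on.\<close>

definition runs :: "com \<Rightarrow> nat \<Rightarrow> val \<Rightarrow> nat \<Rightarrow> val \<Rightarrow> bool" where
  "runs c N x B y \<longleftrightarrow>
     (\<forall>s. s 0 = x \<and> (\<forall>i. 0 < i \<and> i < N \<longrightarrow> s i = Atom 0) \<longrightarrow> (\<exists>t\<le>B. exec c s t (s(0 := y))))"

lemma runs_mono: "runs c N x B y \<Longrightarrow> N \<le> N' \<Longrightarrow> B \<le> B' \<Longrightarrow> runs c N' x B' y"
  unfolding runs_def by (fastforce dest: order_trans[of _ B B'])

lemma runs_Seq:
  assumes "runs c1 N x B1 y" "runs c2 N y B2 z"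
  shows "runs (Seq c1 c2) N x (B1 + B2) z"
  unfolding runs_def
proof (intro allI impI)
  fix s assume s: "s 0 = x \<and> (\<forall>i. 0 < i \<and> i < N \<longrightarrow> s i = Atom 0)"
  then obtain t1 where 1: "t1 \<le> B1" "exec c1 s t1 (s(0 := y))"
    using assms(1) unfolding runs_def by blast
  let ?s = "s(0 := y)"
  have "?s 0 = y \<and> (\<forall>i. 0 < i \<and> i < N \<longrightarrow> ?s i = Atom 0)" using s by auto
  then obtain t2 where 2: "t2 \<le> B2" "exec c2 ?s t2 (?s(0 := z))"
    using assms(2) unfolding runs_def by blast
  show "\<exists>t\<le>B1 + B2. exec (Seq c1 c2) s t (s(0 := z))"
    using exec.Seq[OF 1(2) 2(2)] 1(1) 2(1) by (intro exI[of _ "t1 + t2"]) auto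
qed

lemma runs_Assign:
  assumes "\<And>s. s 0 = x \<Longrightarrow> eval_expr e s = y \<and> 1 + expr_cost e s \<le> B"
  shows "runs (Assign 0 e) N x B y"
  unfolding runs_def
proof (intro allI impI)
  fix s assume s: "s 0 = x \<and> (\<forall>i. 0 < i \<and> i < N \<longrightarrow> s i = Atom 0)"
  then show "\<exists>t\<le>B. exec (Assign 0 e) s t (s(0 := y))"
    using assms[of s] exec.Assign[of 0 e s] by auto
qed

text \<open>Both programs overwrite variable 0, so the input is kept in \<open>N\<close> and the
  first result in \<open>Suc N\<close>, beyond the scratch area of either program. Both variables
  are reset at the end, as the contract with bound \<open>Suc (Suc N)\<close> demands.\<close>

definition pair_com :: "nat \<Rightarrow> com \<Rightarrow> com \<Rightarrow> com" where
  "pair_com N c1 c2 =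
     Seq (Assign N (Var 0)) (Seq c1 (Seq (Assign (Suc N) (Var 0)) (Seq (Assign 0 (Var N)) (Seq c2
     (Seq (Assign 0 (MkNode (Var (Suc N)) (Var 0)))
     (Seq (Assign N (Const 0)) (Assign (Suc N) (Const 0))))))))"

lemma runs_pair:
  assumes "runs c1 N x B1 y" "runs c2 N x B2 z" "N \<ge> 1"
  shows "runs (pair_com N c1 c2) (Suc (Suc N)) x
           (B1 + B2 + 2 * vsize x + 3 * vsize y + 2 * vsize z + 9) (Node y z)"
  unfolding runs_def
proof (intro allI impI)
  fix s :: state
  assume s: "s 0 = x \<and> (\<forall>i. 0 < i \<and> i < Suc (Suc N) \<longrightarrow> s i = Atom 0)"
  let ?s1 = "s(N := x)"
  let ?s2 = "?s1(0 := y)"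
  let ?s3 = "?s2(Suc N := y)"
  let ?s4 = "?s3(0 := x)"
  let ?s5 = "?s4(0 := z)"
  let ?s6 = "?s5(0 := Node y z)"
  let ?s7 = "?s6(N := Atom 0)"
  let ?s8 = "?s7(Suc N := Atom 0)"
  have N: "N \<noteq> 0" using assms(3) by simp
  have e1: "exec (Assign N (Var 0)) s (1 + vsize x) ?s1"
    using exec.Assign[of N "Var 0" s] s by simp
  have "?s1 0 = x \<and> (\<forall>i. 0 < i \<and> i < N \<longrightarrow> ?s1 i = Atom 0)" using s N by auto
  then obtain t1 where t1: "t1 \<le> B1" "exec c1 ?s1 t1 ?s2"
    using assms(1) unfolding runs_def by blast
  have e2: "exec (Assign (Suc N) (Var 0)) ?s2 (1 + vsize y) ?s3"
    using exec.Assign[of "Suc N" "Var 0" ?s2] by simp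
  have e3: "exec (Assign 0 (Var N)) ?s3 (1 + vsize x) ?s4"
    using exec.Assign[of 0 "Var N" ?s3] N by simp
  have "?s4 0 = x \<and> (\<forall>i. 0 < i \<and> i < N \<longrightarrow> ?s4 i = Atom 0)" using s N by auto
  then obtain t2 where t2: "t2 \<le> B2" "exec c2 ?s4 t2 ?s5"
    using assms(2) unfolding runs_def by blast
  have e4: "exec (Assign 0 (MkNode (Var (Suc N)) (Var 0))) ?s5 (2 + 2 * vsize y + 2 * vsize z) ?s6"
    using exec.Assign[of 0 "MkNode (Var (Suc N)) (Var 0)" ?s5] by (simp add: algebra_simps flip: mult_2)
  have e5: "exec (Assign N (Const 0)) ?s6 2 ?s7"
    using exec.Assign[of N "Const 0" ?s6] by (simp add: floorlog_def numeral_2_eq_2)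
  have e6: "exec (Assign (Suc N) (Const 0)) ?s7 2 ?s8"
    using exec.Assign[of "Suc N" "Const 0" ?s7] by (simp add: floorlog_def numeral_2_eq_2)
  have fin: "?s8 = s(0 := Node y z)" using s N by (auto simp: fun_eq_iff)
  show "\<exists>t\<le>B1 + B2 + 2 * vsize x + 3 * vsize y + 2 * vsize z + 9.
      exec (pair_com N c1 c2) s t (s(0 := Node y z))"
    using exec.Seq[OF e1 exec.Seq[OF t1(2) exec.Seq[OF e2 exec.Seq[OF e3 exec.Seq[OF t2(2)
          exec.Seq[OF e4 exec.Seq[OF e5 e6]]]]]]] t1(1) t2(1)
    unfolding fin pair_com_def
    by (intro exI[of _ "1 + vsize x + (t1 + (1 + vsize y + (1 + vsize x +
      (t2 + (2 + 2 * vsize y + 2 * vsize z + (2 + 2))))))"]) auto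
qed

text \<open>A test is a mere expression, whereas conditions are computed by whole programs. The
  condition is therefore computed beforehand and paired with the data, and each branch strips it off
  before it starts.\<close>

lemma runs_If:
  assumes "b \<noteq> Atom 0 \<Longrightarrow> runs c1 N x B y" "b = Atom 0 \<Longrightarrow> runs c2 N x B y"
  shows "runs (If (Left (Var 0)) (Seq (Assign 0 (Right (Var 0))) c1)
                                 (Seq (Assign 0 (Right (Var 0))) c2))
           N (Node b x) (B + 2 * vsize (Node b x) + vsize x + vsize b + 2) y"
proof -
  have as: "runs (Assign 0 (Right (Var 0))) N (Node b x) (1 + vsize (Node b x) + vsize x) x"
    by (rule runs_Assign) simp
  show ?thesis
  unfolding runs_def
  proof (intro allI impI)
    fix s :: state
    assume s: "s 0 = Node b x \<and> (\<forall>i. 0 < i \<and> i < N \<longrightarrow> s i = Atom 0)"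
    let ?A = "Seq (Assign 0 (Right (Var 0)))"
    obtain c where c: "c = (if b \<noteq> Atom 0 then c1 else c2)" by simp
    have "runs (?A c) N (Node b x) (1 + vsize (Node b x) + vsize x + B) y"
      using runs_Seq[OF as] assms c by auto
    then obtain t where t: "t \<le> 1 + vsize (Node b x) + vsize x + B" "exec (?A c) s t (s(0 := y))"
      using s unfolding runs_def by blast
    have "exec (If (Left (Var 0)) (?A c1) (?A c2)) s
        (1 + expr_cost (Left (Var 0)) s + t) (s(0 := y))"
      using exec.IfTrue[of "Left (Var 0)" s "?A c1" t _ "?A c2"]
        exec.IfFalse[of "Left (Var 0)" s "?A c2" t _ "?A c1"] s t(2) c
      by (cases "b = Atom 0") auto
    then show "\<exists>t\<le>B + 2 * vsize (Node b x) + vsize x + vsize b + 2.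
        exec (If (Left (Var 0)) (?A c1) (?A c2)) s t (s(0 := y))"
      using t(1) s by (intro exI[of _ "1 + expr_cost (Left (Var 0)) s + t"]) auto
  qed
qed

text \<open>The left half of the current value is the loop condition, so a test costs at most
  \<open>2 * M\<close>. The factor \<open>Suc k\<close> accounts for the final test that
  fails.\<close>

lemma runs_While:
  assumes "\<And>i. i < k \<Longrightarrow> left (y i) \<noteq> Atom 0 \<and> runs c N (y i) B (y (Suc i))"
    and "left (y k) = Atom 0" "\<And>i. i \<le> k \<Longrightarrow> vsize (y i) \<le> M"
  shows "runs (While (Left (Var 0)) c) N (y 0) (Suc k * (1 + B + 2 * M)) (y k)"
  using assms
proof (induction k arbitrary: y)
  case 0
  show ?case unfolding runs_def
  proof (intro allI impI)
    fix s :: state assume s: "s 0 = y 0 \<and> (\<forall>i. 0 < i \<and> i < N \<longrightarrow> s i = Atom 0)"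
    have "exec (While (Left (Var 0)) c) s (1 + expr_cost (Left (Var 0)) s) (s(0 := y 0))"
      using exec.WhileFalse[of "Left (Var 0)" s c] 0 s fun_upd_triv[of s 0] by auto
    moreover have "1 + expr_cost (Left (Var 0)) s \<le> Suc 0 * (1 + B + 2 * M)"
      using 0 s vsize_left[of "y 0"] by force
    ultimately show "\<exists>t\<le>Suc 0 * (1 + B + 2 * M). exec (While (Left (Var 0)) c) s t (s(0 := y 0))"
      by blast
  qed
next
  case (Suc k)
  let ?W = "While (Left (Var 0)) c"
  have IH: "runs ?W N (y 1) (Suc k * (1 + B + 2 * M)) (y (Suc k))"
    using Suc.IH[of "\<lambda>i. y (Suc i)"] Suc.prems by auto
  show ?case unfolding runs_def
  proof (intro allI impI)
    fix s :: state assume s: "s 0 = y 0 \<and> (\<forall>i. 0 < i \<and> i < N \<longrightarrow> s i = Atom 0)"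
    have "runs c N (y 0) B (y 1)" using Suc.prems(1)[of 0] by simp
    then obtain t1 where t1: "t1 \<le> B" "exec c s t1 (s(0 := y 1))"
      using s unfolding runs_def by blast
    let ?s = "s(0 := y 1)"
    have "?s 0 = y 1 \<and> (\<forall>i. 0 < i \<and> i < N \<longrightarrow> ?s i = Atom 0)" using s by auto
    then obtain t2 where t2: "t2 \<le> Suc k * (1 + B + 2 * M)" "exec ?W ?s t2 (?s(0 := y (Suc k)))"
      using IH unfolding runs_def by blast
    have "exec ?W s (1 + expr_cost (Left (Var 0)) s + t1 + t2) (s(0 := y (Suc k)))"
      using exec.WhileTrue[OF _ t1(2) t2(2)] Suc.prems(1)[of 0] s by auto
    moreover have "1 + expr_cost (Left (Var 0)) s + t1 + t2 \<le> Suc (Suc k) * (1 + B + 2 * M)"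
      using Suc.prems(3)[of 0] s vsize_left[of "y 0"] t1(1) t2(1) by auto
    ultimately show "\<exists>t\<le>Suc (Suc k) * (1 + B + 2 * M). exec ?W s t (s(0 := y (Suc k)))"
      by blast
  qed
qed

subsection \<open>Polynomial-time computable functions\<close>

text \<open>The output size is recorded together with the time because a program that is run on the
  result is charged in terms of that size.\<close>

definition poly_time_on :: "'a::encodable set \<Rightarrow> ('a \<Rightarrow> 'b::encodable) \<Rightarrow> bool" where
  "poly_time_on D f \<longleftrightarrow> pbdd D (\<lambda>x. sz (f x)) \<and>
     (\<exists>c N g. N \<ge> 1 \<and> pbdd D g \<and> (\<forall>x\<in>D. runs c N (enc x) (g x) (enc (f x))))"

lemma poly_time_onI:
  assumes "pbdd D (\<lambda>x. sz (f x))" "pbdd D g" "N \<ge> 1"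
    "\<And>x. x \<in> D \<Longrightarrow> runs c N (enc x) (g x) (enc (f x))"
  shows "poly_time_on D f"
  using assms unfolding poly_time_on_def by blast

named_theorems pt_intros

lemma poly_time_on_subset: "poly_time_on D f \<Longrightarrow> D' \<subseteq> D \<Longrightarrow> poly_time_on D' f"
proof -
  assume "poly_time_on D f" and D: "D' \<subseteq> D"
  then obtain c N g where *: "pbdd D (\<lambda>x. sz (f x))" "pbdd D g" "N \<ge> 1"
    "\<And>x. x \<in> D \<Longrightarrow> runs c N (enc x) (g x) (enc (f x))" unfolding poly_time_on_def by blast
  show ?thesis
    by (rule poly_time_onI[OF pbdd_subset[OF *(1) D] pbdd_subset[OF *(2) D] *(3)]) (use *(4) D in blast)
qed

lemma poly_time_on_cong:
  "poly_time_on D f \<Longrightarrow> (\<And>x. x \<in> D \<Longrightarrow> g x = f x) \<Longrightarrow> poly_time_on D g"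
  unfolding poly_time_on_def pbdd_def by simp

lemma pbdd_sz_pt: "poly_time_on D f \<Longrightarrow> pbdd D (\<lambda>x. sz (f x))"
  unfolding poly_time_on_def by blast

lemma pt_expr:
  assumes "\<And>x s. x \<in> D \<Longrightarrow> s 0 = enc x \<Longrightarrow> eval_expr e s = enc (f x) \<and> expr_cost e s \<le> C * sz x + C"
    "\<And>x. x \<in> D \<Longrightarrow> sz (f x) \<le> C * sz x + C"
  shows "poly_time_on D f"
proof (rule poly_time_onI[where N = 1])
  show "pbdd D (\<lambda>x. sz (f x))"
    by (rule pbdd_mono[where g = "\<lambda>x. C * sz x + C"]) (intro pbdd_intros assms(2))+
  show "pbdd D (\<lambda>x. 1 + (C * sz x + C))"
    by (intro pbdd_intros)
  show "runs (Assign 0 e) 1 (enc x) (1 + (C * sz x + C)) (enc (f x))" if "x \<in> D" for x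
    by (rule runs_Assign) (use assms(1)[OF that] in auto)
qed simp

lemma pt_id [pt_intros]: "poly_time_on D (\<lambda>x. x)"
  by (rule pt_expr[where e = "Var 0" and C = 1]) auto

lemma pt_comp:
  assumes g: "poly_time_on E g" and f: "poly_time_on D f" and D: "\<And>x. x \<in> D \<Longrightarrow> f x \<in> E"
  shows "poly_time_on D (\<lambda>x. g (f x))"
proof -
  from f obtain c1 N1 g1 where 1: "pbdd D (\<lambda>x. sz (f x))" "pbdd D g1" "N1 \<ge> 1"
    "\<And>x. x \<in> D \<Longrightarrow> runs c1 N1 (enc x) (g1 x) (enc (f x))" unfolding poly_time_on_def by blast
  from g obtain c2 N2 g2 where 2: "pbdd E (\<lambda>x. sz (g x))" "pbdd E g2" "N2 \<ge> 1"
    "\<And>x. x \<in> E \<Longrightarrow> runs c2 N2 (enc x) (g2 x) (enc (g x))" unfolding poly_time_on_def by blast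
  show ?thesis
  proof (rule poly_time_onI[where N = "max N1 N2"])
    show "pbdd D (\<lambda>x. sz (g (f x)))" by (rule pbdd_comp[OF 2(1) D 1(1)])
    show "pbdd D (\<lambda>x. g1 x + g2 (f x))" by (intro pbdd_add 1 pbdd_comp[OF 2(2) D 1(1)])
    show "runs (Seq c1 c2) (max N1 N2) (enc x) (g1 x + g2 (f x)) (enc (g (f x)))" if "x \<in> D" for x
      by (rule runs_Seq) (auto intro: runs_mono[OF 1(4)[OF that]] runs_mono[OF 2(4)[OF D[OF that]]])
  qed (use 1(3) in auto)
qed

lemma pt_Pair [pt_intros]:
  assumes f: "poly_time_on D f" and g: "poly_time_on D g"
  shows "poly_time_on D (\<lambda>x. (f x, g x))"
proof -
  from f obtain c1 N1 g1 where 1: "pbdd D (\<lambda>x. sz (f x))" "pbdd D g1" "N1 \<ge> 1"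
    "\<And>x. x \<in> D \<Longrightarrow> runs c1 N1 (enc x) (g1 x) (enc (f x))" unfolding poly_time_on_def by blast
  from g obtain c2 N2 g2 where 2: "pbdd D (\<lambda>x. sz (g x))" "pbdd D g2" "N2 \<ge> 1"
    "\<And>x. x \<in> D \<Longrightarrow> runs c2 N2 (enc x) (g2 x) (enc (g x))" unfolding poly_time_on_def by blast
  let ?N = "max N1 N2"
  show ?thesis
  proof (rule poly_time_onI[where N = "Suc (Suc ?N)"])
    show "pbdd D (\<lambda>x. sz (f x, g x))"
      by simp (intro pbdd_intros 1 2)
    show "pbdd D (\<lambda>x. g1 x + g2 x + 2 * sz x + 3 * sz (f x) + 2 * sz (g x) + 9)"
      by (intro pbdd_intros 1 2)
    show "runs (pair_com ?N c1 c2) (Suc (Suc ?N)) (enc x)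
        (g1 x + g2 x + 2 * sz x + 3 * sz (f x) + 2 * sz (g x) + 9) (enc (f x, g x))"
      if "x \<in> D" for x
      unfolding enc_simps
      by (rule runs_pair) (use 1(3) in \<open>auto intro: runs_mono[OF 1(4)[OF that]] runs_mono[OF 2(4)[OF that]]\<close>)
  qed simp
qed

lemma pt_unary:
  assumes "poly_time_on UNIV h" "poly_time_on D f"
  shows "poly_time_on D (\<lambda>x. h (f x))"
  using pt_comp[OF assms] by simp

lemma pt_binary:
  assumes "poly_time_on UNIV (\<lambda>z. h (fst z) (snd z))" "poly_time_on D f" "poly_time_on D g"
  shows "poly_time_on D (\<lambda>x. h (f x) (g x))"
  using pt_comp[OF assms(1) pt_Pair[OF assms(2,3)]] by simp

lemma pt_ternary:
  assumes "poly_time_on UNIV (\<lambda>z. h (fst z) (fst (snd z)) (snd (snd z)))"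
    "poly_time_on D f" "poly_time_on D g" "poly_time_on D k"
  shows "poly_time_on D (\<lambda>x. h (f x) (g x) (k x))"
  using pt_comp[OF assms(1) pt_Pair[OF assms(2) pt_Pair[OF assms(3,4)]]] by simp

fun const_expr :: "val \<Rightarrow> expr" where
  "const_expr (Atom i) = Const i"
| "const_expr (Node a b) = MkNode (const_expr a) (const_expr b)"

lemma pt_const [pt_intros]: "poly_time_on D (\<lambda>_. c)"
proof -
  have e: "eval_expr (const_expr v) s = v" for v s by (induction v) auto
  have c: "expr_cost (const_expr v) s = expr_cost (const_expr v) s'" for v s s'
    by (induction v) (auto simp: e)
  show ?thesis
  proof (rule pt_expr[where e = "const_expr (enc c)"
          and C = "sz c + expr_cost (const_expr (enc c)) (\<lambda>_. Atom 0)"])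
    fix x :: 'a and s :: state
    show "eval_expr (const_expr (enc c)) s = enc c \<and> expr_cost (const_expr (enc c)) s \<le>
        (sz c + expr_cost (const_expr (enc c)) (\<lambda>_. Atom 0)) * sz x +
        (sz c + expr_cost (const_expr (enc c)) (\<lambda>_. Atom 0))"
      using c[of "enc c" s "\<lambda>_. Atom 0"] e[of "enc c" s] by linarith
  qed simp
qed

lemma enc_fst: "left (enc z) = enc (fst z)" and enc_snd: "right (enc z) = enc (snd z)" for z :: "'a::encodable \<times> 'b::encodable"
  by (cases z; simp)+

lemma sz_fst: "sz (fst z) \<le> sz z" and sz_snd: "sz (snd z) \<le> sz z" for z :: "'a::encodable \<times> 'b::encodable"
  by (cases z; simp)+

lemma pt_fst [pt_intros]:
  fixes f :: "'c::encodable \<Rightarrow> 'a::encodable \<times> 'b::encodable"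
  assumes "poly_time_on D f"
  shows "poly_time_on D (\<lambda>x. fst (f x))"
proof (rule pt_unary[where h = fst, OF _ assms], rule pt_expr[where e = "Left (Var 0)" and C = 2])
  fix z :: "'a \<times> 'b" and s :: state
  show "sz (fst z) \<le> 2 * sz z + 2" using sz_fst[of z] by linarith
  assume "s 0 = enc z"
  then show "eval_expr (Left (Var 0)) s = enc (fst z) \<and> expr_cost (Left (Var 0)) s \<le> 2 * sz z + 2"
    using sz_fst[of z] by (simp add: enc_fst)
qed

lemma pt_snd [pt_intros]:
  fixes f :: "'c::encodable \<Rightarrow> 'a::encodable \<times> 'b::encodable"
  assumes "poly_time_on D f"
  shows "poly_time_on D (\<lambda>x. snd (f x))"
proof (rule pt_unary[where h = snd, OF _ assms], rule pt_expr[where e = "Right (Var 0)" and C = 2])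
  fix z :: "'a \<times> 'b" and s :: state
  show "sz (snd z) \<le> 2 * sz z + 2" using sz_snd[of z] by linarith
  assume "s 0 = enc z"
  then show "eval_expr (Right (Var 0)) s = enc (snd z) \<and> expr_cost (Right (Var 0)) s \<le> 2 * sz z + 2"
    using sz_snd[of z] by (simp add: enc_snd)
qed

lemma pt_int [pt_intros]: "poly_time_on D f \<Longrightarrow> poly_time_on D (\<lambda>x. int (f x))"
  by (rule pt_unary[where h = int], rule pt_expr[where e = "Var 0" and C = 1]) auto

lemma pt_add_int [pt_intros]:
  "poly_time_on D f \<Longrightarrow> poly_time_on D g \<Longrightarrow> poly_time_on D (\<lambda>x. f x + g x :: int)"
proof (erule (1) pt_binary[where h = "(+)", rotated], rule pt_expr[where e = "Add (Left (Var 0)) (Right (Var 0))" and C = 6])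
  fix z :: "int \<times> int"
  have *: "vsize (Atom (fst z + snd z)) \<le> sz z"
    using vsize_Atom_add[of "fst z" "snd z"] by (simp add: enc_pair[of z])
  then show "sz (fst z + snd z) \<le> 6 * sz z + 6" by simp
  show "eval_expr (Add (Left (Var 0)) (Right (Var 0))) s = enc (fst z + snd z) \<and>
      expr_cost (Add (Left (Var 0)) (Right (Var 0))) s \<le> 6 * sz z + 6" if "s 0 = enc z" for s :: state
    using that * vsize_left[of "enc z"] vsize_right[of "enc z"] by (auto simp: enc_fst enc_snd simp del: vsize.simps)
qed

lemma pt_diff_int [pt_intros]:
  "poly_time_on D f \<Longrightarrow> poly_time_on D g \<Longrightarrow> poly_time_on D (\<lambda>x. f x - g x :: int)"
proof (erule (1) pt_binary[where h = "(-)", rotated], rule pt_expr[where e = "Sub (Left (Var 0)) (Right (Var 0))" and C = 6])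
  fix z :: "int \<times> int"
  have *: "vsize (Atom (fst z - snd z)) \<le> sz z"
    using vsize_Atom_diff[of "fst z" "snd z"] by (simp add: enc_pair[of z])
  then show "sz (fst z - snd z) \<le> 6 * sz z + 6" by simp
  show "eval_expr (Sub (Left (Var 0)) (Right (Var 0))) s = enc (fst z - snd z) \<and>
      expr_cost (Sub (Left (Var 0)) (Right (Var 0))) s \<le> 6 * sz z + 6" if "s 0 = enc z" for s :: state
    using that * vsize_left[of "enc z"] vsize_right[of "enc z"] by (auto simp: enc_fst enc_snd simp del: vsize.simps)
qed

lemma pt_mult_int [pt_intros]:
  "poly_time_on D f \<Longrightarrow> poly_time_on D g \<Longrightarrow> poly_time_on D (\<lambda>x. f x * g x :: int)"
proof (erule (1) pt_binary[where h = times, rotated], rule pt_expr[where e = "Mul (Left (Var 0)) (Right (Var 0))" and C = 6])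
  fix z :: "int \<times> int"
  have *: "vsize (Atom (fst z * snd z)) \<le> sz z"
    using vsize_Atom_mult[of "fst z" "snd z"] by (simp add: enc_pair[of z])
  then show "sz (fst z * snd z) \<le> 6 * sz z + 6" by simp
  show "eval_expr (Mul (Left (Var 0)) (Right (Var 0))) s = enc (fst z * snd z) \<and>
      expr_cost (Mul (Left (Var 0)) (Right (Var 0))) s \<le> 6 * sz z + 6" if "s 0 = enc z" for s :: state
    using that * vsize_left[of "enc z"] vsize_right[of "enc z"] by (auto simp: enc_fst enc_snd simp del: vsize.simps)
qed

lemma pt_less_int [pt_intros]:
  "poly_time_on D f \<Longrightarrow> poly_time_on D g \<Longrightarrow> poly_time_on D (\<lambda>x. (f x :: int) < g x)"
proof (erule (1) pt_binary[where h = "(<)", rotated], rule pt_expr[where e = "Less (Left (Var 0)) (Right (Var 0))" and C = 6])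
  fix z :: "int \<times> int"
  have *: "vsize (Atom (of_bool (fst z < snd z))) \<le> 2" by (rule vsize_of_bool)
  then show "sz (fst z < snd z) \<le> 6 * sz z + 6" unfolding enc_simps by linarith
  show "eval_expr (Less (Left (Var 0)) (Right (Var 0))) s = enc (fst z < snd z) \<and>
      expr_cost (Less (Left (Var 0)) (Right (Var 0))) s \<le> 6 * sz z + 6" if "s 0 = enc z" for s :: state
    using that * vsize_left[of "enc z"] vsize_right[of "enc z"]
    by (auto simp: enc_fst enc_snd simp del: vsize.simps of_bool_def)
qed

lemma pt_of_bool [pt_intros]: "poly_time_on D f \<Longrightarrow> poly_time_on D (\<lambda>x. of_bool (f x) :: int)"
  by (rule pt_unary[where h = of_bool], rule pt_expr[where e = "Var 0" and C = 1]) auto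

text \<open>Natural numbers and integers share their encoding, so passing to integers costs only a
  copy.\<close>

lemma pt_less_nat [pt_intros]:
  "poly_time_on D f \<Longrightarrow> poly_time_on D g \<Longrightarrow> poly_time_on D (\<lambda>x. (f x :: nat) < g x)"
  by (subst of_nat_less_iff[where 'a = int, symmetric]) (intro pt_intros)

text \<open>Truth values are encoded as 0 and 1; the Boolean connectives become comparisons of sums
  and products.\<close>

lemma pt_not [pt_intros]: "poly_time_on D f \<Longrightarrow> poly_time_on D (\<lambda>x. \<not> f x)"
  by (rule poly_time_on_cong[where f = "\<lambda>x. of_bool (f x) < (1 :: int)"], intro pt_intros) auto

lemma pt_conj [pt_intros]:
  "poly_time_on D f \<Longrightarrow> poly_time_on D g \<Longrightarrow> poly_time_on D (\<lambda>x. f x \<and> g x)"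
  by (rule poly_time_on_cong[where f = "\<lambda>x. 0 < of_bool (f x) * (of_bool (g x) :: int)"], intro pt_intros) auto

lemma pt_disj [pt_intros]:
  "poly_time_on D f \<Longrightarrow> poly_time_on D g \<Longrightarrow> poly_time_on D (\<lambda>x. f x \<or> g x)"
  by (rule poly_time_on_cong[where f = "\<lambda>x. 0 < of_bool (f x) + (of_bool (g x) :: int)"], intro pt_intros) auto

lemma pt_eq_bool [pt_intros]:
  "poly_time_on D f \<Longrightarrow> poly_time_on D g \<Longrightarrow> poly_time_on D (\<lambda>x. (f x :: bool) = g x)"
  by (rule poly_time_on_cong[where f = "\<lambda>x. (f x \<and> g x) \<or> (\<not> f x \<and> \<not> g x)"], intro pt_intros) auto

lemma pt_le_int [pt_intros]:
  "poly_time_on D f \<Longrightarrow> poly_time_on D g \<Longrightarrow> poly_time_on D (\<lambda>x. (f x :: int) \<le> g x)"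
  by (rule poly_time_on_cong[where f = "\<lambda>x. \<not> (g x < f x)"], intro pt_intros) auto

lemma pt_eq_nat [pt_intros]:
  "poly_time_on D f \<Longrightarrow> poly_time_on D g \<Longrightarrow> poly_time_on D (\<lambda>x. (f x :: nat) = g x)"
  by (rule poly_time_on_cong[where f = "\<lambda>x. \<not> (f x < g x) \<and> \<not> (g x < f x)"], intro pt_intros) auto

lemma pt_eq_pair [pt_intros]:
  fixes f :: "_ \<Rightarrow> nat \<times> nat"
  shows "poly_time_on D f \<Longrightarrow> poly_time_on D g \<Longrightarrow> poly_time_on D (\<lambda>x. f x = g x)"
  by (subst prod_eq_iff) (intro pt_intros)

lemma pt_if [pt_intros]:
  assumes b: "poly_time_on D b" and f: "poly_time_on {x \<in> D. b x} f"
    and g: "poly_time_on {x \<in> D. \<not> b x} g"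
  shows "poly_time_on D (\<lambda>x. if b x then f x else g x)"
proof -
  from f obtain c1 N1 g1 where 1: "pbdd {x \<in> D. b x} (\<lambda>x. sz (f x))" "pbdd {x \<in> D. b x} g1" "N1 \<ge> 1"
    "\<And>x. x \<in> {x \<in> D. b x} \<Longrightarrow> runs c1 N1 (enc x) (g1 x) (enc (f x))" unfolding poly_time_on_def by blast
  from g obtain c2 N2 g2 where 2: "pbdd {x \<in> D. \<not> b x} (\<lambda>x. sz (g x))" "pbdd {x \<in> D. \<not> b x} g2" "N2 \<ge> 1"
    "\<And>x. x \<in> {x \<in> D. \<not> b x} \<Longrightarrow> runs c2 N2 (enc x) (g2 x) (enc (g x))" unfolding poly_time_on_def by blast
  have split: "pbdd D (\<lambda>x. if b x then h1 x else h2 x)"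
    if "pbdd {x \<in> D. b x} h1" "pbdd {x \<in> D. \<not> b x} h2" for h1 h2
  proof -
    from that obtain p q where "\<And>x. x \<in> D \<Longrightarrow> b x \<Longrightarrow> h1 x \<le> poly p (sz x)"
      "\<And>x. x \<in> D \<Longrightarrow> \<not> b x \<Longrightarrow> h2 x \<le> poly q (sz x)" unfolding pbdd_def by blast
    then show ?thesis by (intro pbddI[of _ _ "p + q"]) (auto intro: trans_le_add1 trans_le_add2)
  qed
  let ?f = "\<lambda>x. if b x then f x else g x" and ?N = "max N1 N2"
  let ?B = "\<lambda>x. if b x then g1 x else g2 x"
  \<comment> \<open>The program for the conditional reads its condition from the left half of the
    input, so the function is considered on the pairs \<open>(b x, x)\<close> and then composed with
    the pairing map.\<close>
  have "poly_time_on ((\<lambda>x. (b x, x)) ` D) (\<lambda>z. if fst z then f (snd z) else g (snd z))"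
  proof (rule poly_time_onI[where N = ?N])
    have D: "pbdd ((\<lambda>x. (b x, x)) ` D) (\<lambda>z. h (snd z))" if "pbdd D h" for h
      by (rule pbdd_comp[OF that]) (auto intro!: pbdd_mono[OF pbdd_sz])
    show "pbdd ((\<lambda>x. (b x, x)) ` D) (\<lambda>z. sz (if fst z then f (snd z) else g (snd z)))"
      by (rule pbdd_mono[OF D[OF split[OF 1(1) 2(1)]]]) auto
    show "pbdd ((\<lambda>x. (b x, x)) ` D) (\<lambda>z. ?B (snd z) + 2 * sz z + sz (snd z) + sz (fst z) + 2)"
      by (intro pbdd_intros D[OF split[OF 1(2) 2(2)]] D)
        (rule pbdd_mono[OF pbdd_const[of _ 2]], auto simp: floorlog_def)
    show "runs (If (Left (Var 0)) (Seq (Assign 0 (Right (Var 0))) c1) (Seq (Assign 0 (Right (Var 0))) c2))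
       ?N (enc z) (?B (snd z) + 2 * sz z + sz (snd z) + sz (fst z) + 2)
       (enc (if fst z then f (snd z) else g (snd z)))" if zD: "z \<in> (\<lambda>x. (b x, x)) ` D" for z
    proof -
      from zD obtain x where x: "x \<in> D" "z = (b x, x)" by auto
      show ?thesis
        unfolding x(2) enc_simps(4) fst_conv snd_conv
        by (rule runs_If) (use x(1) in \<open>auto intro: runs_mono[OF 1(4)] runs_mono[OF 2(4)]\<close>)
    qed
  qed (use 1(3) in auto)
  from pt_comp[OF this pt_Pair[OF b pt_id]] show ?thesis by (simp cong: if_cong)
qed

text \<open>One bound \<open>M\<close> for all intermediate values excludes growth by repeated
  doubling; the time is then the number of rounds times a fixed polynomial in \<open>M\<close>. The
  first component of the state is the loop condition, and the number \<open>k x\<close> belongs to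
  the analysis only: the program never computes it.\<close>

lemma pt_while:
  fixes h :: "'c::encodable \<times> 'a::encodable \<Rightarrow> 'c \<times> 'a"
  assumes h: "poly_time_on E h" and K: "pbdd D k" and M: "pbdd D M"
    and run: "\<And>x i. x \<in> D \<Longrightarrow> i < k x \<Longrightarrow> (h ^^ i) x \<in> E \<and> enc (fst ((h ^^ i) x)) \<noteq> Atom 0"
    and stop: "\<And>x. x \<in> D \<Longrightarrow> enc (fst ((h ^^ k x) x)) = Atom 0"
    and size: "\<And>x i. x \<in> D \<Longrightarrow> i \<le> k x \<Longrightarrow> sz ((h ^^ i) x) \<le> M x"
  shows "poly_time_on D (\<lambda>x. (h ^^ k x) x)"
proof -
  from h obtain c N g where c: "pbdd E g" "N \<ge> 1"
    "\<And>x. x \<in> E \<Longrightarrow> runs c N (enc x) (g x) (enc (h x))" unfolding poly_time_on_def by blast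
  then obtain p where p: "\<And>x. x \<in> E \<Longrightarrow> g x \<le> poly p (sz x)" unfolding pbdd_def by blast
  obtain q where q: "\<And>x. x \<in> D \<Longrightarrow> M x \<le> poly q (sz x)" using M unfolding pbdd_def by blast
  let ?B = "\<lambda>x. poly p (M x)"
  have B: "pbdd D ?B"
    by (rule pbddI[of _ _ "pcompose p q"]) (simp add: poly_pcompose poly_nat_mono q)
  show ?thesis
  proof (rule poly_time_onI[OF _ _ c(2)])
    show "pbdd D (\<lambda>x. sz ((h ^^ k x) x))" by (rule pbdd_mono[OF M]) (auto intro: size)
    show "pbdd D (\<lambda>x. Suc (k x) * (1 + ?B x + 2 * M x))" by (intro pbdd_intros K M B)
    show "runs (While (Left (Var 0)) c) N (enc x) (Suc (k x) * (1 + ?B x + 2 * M x)) (enc ((h ^^ k x) x))"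
      if x: "x \<in> D" for x
    proof -
      have "runs c N (enc ((h ^^ i) x)) (?B x) (enc ((h ^^ Suc i) x))" if "i < k x" for i
      proof -
        have E: "(h ^^ i) x \<in> E" using run x that by blast
        have "g ((h ^^ i) x) \<le> poly p (sz ((h ^^ i) x))" using p E by blast
        also have "\<dots> \<le> ?B x" using size[OF x, of i] that by (intro poly_nat_mono) auto
        finally show ?thesis using runs_mono[OF c(3)[OF E]] by auto
      qed
      then show ?thesis
        using runs_While[where y = "\<lambda>i. enc ((h ^^ i) x)" and k = "k x" and c = c and N = N
            and B = "?B x" and M = "M x"] run[OF x] stop[OF x] size[OF x]
        by (simp add: enc_fst)
    qed
  qed
qed

subsection \<open>Lists\<close>

lemma pt_tl [pt_intros]: "poly_time_on D f \<Longrightarrow> poly_time_on D (\<lambda>x. tl (f x))"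
proof (erule pt_unary[where h = tl, rotated], rule pt_expr[where e = "Right (Var 0)" and C = 2])
  fix xs :: "'b list" and s :: state
  have r: "right (enc xs) = enc (tl xs)" by (cases xs) auto
  then have le: "sz (tl xs) \<le> sz xs" using vsize_right[of "enc xs"] by simp
  then show "sz (tl xs) \<le> 2 * sz xs + 2" by linarith
  assume "s 0 = enc xs"
  then show "eval_expr (Right (Var 0)) s = enc (tl xs) \<and> expr_cost (Right (Var 0)) s \<le> 2 * sz xs + 2"
    using le r by simp
qed

lemma pt_hd:
  assumes "poly_time_on D f" "\<And>x. x \<in> D \<Longrightarrow> f x \<noteq> []"
  shows "poly_time_on D (\<lambda>x. hd (f x))"
proof (rule pt_comp[where g = hd and E = "{xs. xs \<noteq> []}", OF _ assms(1)])
  show "poly_time_on {xs. xs \<noteq> []} (hd :: 'b list \<Rightarrow> 'b)"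
  proof (rule pt_expr[where e = "Left (Var 0)" and C = 2])
    fix xs :: "'b list" and s :: state assume "xs \<in> {xs. xs \<noteq> []}"
    then have r: "left (enc xs) = enc (hd xs)" by (cases xs) auto
    then have le: "sz (hd xs) \<le> sz xs" using vsize_left[of "enc xs"] by simp
    then show "sz (hd xs) \<le> 2 * sz xs + 2" by linarith
    assume "s 0 = enc xs"
    then show "eval_expr (Left (Var 0)) s = enc (hd xs) \<and> expr_cost (Left (Var 0)) s \<le> 2 * sz xs + 2"
      using le r by simp
  qed
qed (use assms(2) in simp)

text \<open>A nonempty list has the same encoding as the pair of its head and its tail, so the
  program is the identity.\<close>

lemma pt_Cons [pt_intros]:
  assumes "poly_time_on D f" "poly_time_on D g"
  shows "poly_time_on D (\<lambda>x. f x # g x)"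
proof (rule pt_binary[where h = Cons, OF _ assms], rule pt_expr[where e = "Var 0" and C = 1])
  fix z :: "'b \<times> 'b list" and s :: state
  have *: "enc (fst z # snd z) = enc z" by (cases z) simp
  then show "sz (fst z # snd z) \<le> 1 * sz z + 1" by simp
  assume "s 0 = enc z"
  then show "eval_expr (Var 0) s = enc (fst z # snd z) \<and> expr_cost (Var 0) s \<le> 1 * sz z + 1"
    using * by simp
qed

lemma sz_drop: "sz (drop n xs) \<le> sz xs"
proof (induction xs arbitrary: n)
  case (Cons x xs)
  then show ?case by (cases n) (auto intro: trans_le_add2 le_SucI)
qed simp

text \<open>The list still to be processed is itself the loop condition, as the empty list is the
  only one encoded by the integer 0. The context \<open>x\<close> travels along in the state, and
  the step has to be polynomial only on the triples in \<open>S\<close>, which cover what occurs in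
  a run.\<close>

lemma pt_fold_reachable:
  fixes step :: "'x::encodable \<Rightarrow> 'e::encodable \<Rightarrow> 'a::encodable \<Rightarrow> 'a"
  assumes l: "poly_time_on D l" and a: "poly_time_on D a"
    and step: "poly_time_on S (\<lambda>z. step (fst z) (fst (snd z)) (snd (snd z)))"
    and S: "\<And>x n. x \<in> D \<Longrightarrow> n < length (l x) \<Longrightarrow> (x, l x ! n, fold (step x) (take n (l x)) (a x)) \<in> S"
    and M: "pbdd D M"
    and size: "\<And>x n. x \<in> D \<Longrightarrow> n \<le> length (l x) \<Longrightarrow> sz (fold (step x) (take n (l x)) (a x)) \<le> M x"
  shows "poly_time_on D (\<lambda>x. fold (step x) (l x) (a x))"
proof -
  define h where "h = (\<lambda>y :: 'e list \<times> 'x \<times> 'a. (tl (fst y), fst (snd y),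
    step (fst (snd y)) (hd (fst y)) (snd (snd y))))"
  define init where "init = (\<lambda>x. (l x, x, a x))"
  define E where "E = {y. fst y \<noteq> [] \<and> (fst (snd y), hd (fst y), snd (snd y)) \<in> S}"
  have pow: "(h ^^ i) (init x) = (drop i (l x), x, fold (step x) (take i (l x)) (a x))"
    if "i \<le> length (l x)" for i x
    using that
  proof (induction i)
    case (Suc i)
    then show ?case
      by (simp add: h_def tl_drop drop_Suc hd_drop_conv_nth take_Suc_conv_app_nth)
  qed (simp add: init_def)
  have pi: "poly_time_on D init" unfolding init_def by (intro pt_intros l a)
  have "poly_time_on E (\<lambda>y. (\<lambda>z. step (fst z) (fst (snd z)) (snd (snd z))) (fst (snd y), hd (fst y), snd (snd y)))"
    by (rule pt_comp[OF step]) (auto intro!: pt_intros pt_hd simp: E_def)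
  then have ph: "poly_time_on E h" unfolding h_def by (intro pt_intros) simp
  have proj: "pbdd (init ` D) (\<lambda>y. f (fst (snd y)))" if "pbdd D f" for f :: "'x \<Rightarrow> nat"
    by (rule pbdd_comp[OF that]) (auto simp: init_def intro!: pbdd_sz_pt pt_intros)
  have "poly_time_on (init ` D) (\<lambda>y. (h ^^ length (fst y)) y)"
  proof (rule pt_while[OF ph])
    show "pbdd (init ` D) (\<lambda>y. length (fst y))"
      by (rule pbdd_mono[OF pbdd_sz_pt[OF pt_fst[OF pt_id]]]) (simp add: length_le_sz less_imp_le)
    show "pbdd (init ` D) (\<lambda>y. 2 + sz (fst y) + sz (fst (snd y)) + M (fst (snd y)))"
      by (intro pbdd_intros proj[OF M] pbdd_sz_pt pt_intros)
  next
    fix y i assume y: "y \<in> init ` D" and i: "i < length (fst y)"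
    then obtain x where x: "x \<in> D" "y = init x" by auto
    have i: "i < length (l x)" using i x by (simp add: init_def)
    have "(h ^^ i) y = (drop i (l x), x, fold (step x) (take i (l x)) (a x))" using pow x i by simp
    moreover obtain u us where "drop i (l x) = u # us" using i by (metis Cons_nth_drop_Suc)
    moreover have "u = l x ! i" using calculation(2) i by (metis hd_drop_conv_nth list.sel(1))
    ultimately show "(h ^^ i) y \<in> E \<and> enc (fst ((h ^^ i) y)) \<noteq> Atom 0"
      using S[OF x(1) i] by (simp add: E_def)
  next
    fix y assume "y \<in> init ` D"
    then obtain x where x: "x \<in> D" "y = init x" by auto
    then show "enc (fst ((h ^^ length (fst y)) y)) = Atom 0" using pow[of "length (l x)" x]
      by (simp add: init_def)
  next
    fix y i assume y: "y \<in> init ` D" and i: "i \<le> length (fst y)"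
    then obtain x where x: "x \<in> D" "y = init x" by auto
    have i: "i \<le> length (l x)" using i x by (simp add: init_def)
    show "sz ((h ^^ i) y) \<le> 2 + sz (fst y) + sz (fst (snd y)) + M (fst (snd y))"
      using size[OF x(1) i] sz_drop[of i "l x"] unfolding x(2) pow[OF i] by (simp add: init_def)
  qed
  from pt_snd[OF pt_snd[OF pt_comp[OF this pi]]]
  have "poly_time_on D (\<lambda>x. snd (snd ((h ^^ length (fst (init x))) (init x))))" by simp
  then show ?thesis
    by (rule poly_time_on_cong) (use pow in \<open>simp add: init_def\<close>)
qed

lemma fold_invariant:
  assumes "P a" "\<And>e a. e \<in> set l \<Longrightarrow> P a \<Longrightarrow> P (f e a)"
  shows "P (fold f l a)"
  using assms by (induction l arbitrary: a) auto

text \<open>For accumulators without a convenient closed form: an invariant describes the reachable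
  values and at the same time bounds their size.\<close>

lemma pt_fold:
  fixes step :: "'x::encodable \<Rightarrow> 'e::encodable \<Rightarrow> 'a::encodable \<Rightarrow> 'a"
  assumes l: "poly_time_on D l" and a: "poly_time_on D a"
    and Inv: "\<And>x. x \<in> D \<Longrightarrow> Inv x (a x)"
      "\<And>x e a. x \<in> D \<Longrightarrow> e \<in> set (l x) \<Longrightarrow> Inv x a \<Longrightarrow> Inv x (step x e a)"
    and M: "pbdd D M" and size: "\<And>x a. x \<in> D \<Longrightarrow> Inv x a \<Longrightarrow> sz a \<le> M x"
    and step: "poly_time_on {z. fst z \<in> D \<and> fst (snd z) \<in> set (l (fst z)) \<and> Inv (fst z) (snd (snd z))}
      (\<lambda>z. step (fst z) (fst (snd z)) (snd (snd z)))"
  shows "poly_time_on D (\<lambda>x. fold (step x) (l x) (a x))"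
proof (rule pt_fold_reachable[OF l a step _ M])
  have *: "Inv x (fold (step x) (take n (l x)) (a x))" if "x \<in> D" for x n
    by (rule fold_invariant) (use that Inv in_set_takeD in fast)+
  then show "(x, l x ! n, fold (step x) (take n (l x)) (a x))
      \<in> {z. fst z \<in> D \<and> fst (snd z) \<in> set (l (fst z)) \<and> Inv (fst z) (snd (snd z))}"
    if "x \<in> D" "n < length (l x)" for x n using that by simp
  show "sz (fold (step x) (take n (l x)) (a x)) \<le> M x" if "x \<in> D" for x n
    using size * that by blast
qed

lemma sz_rev [simp]: "sz (rev xs) = sz xs"
  by (simp add: sz_list flip: rev_map)

lemma sz_take: "sz (take n xs) \<le> sz xs"
proof (induction xs arbitrary: n)
  case (Cons x xs)
  then show ?case by (cases n) (auto simp: floorlog_def)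
qed simp

lemma pt_rev [pt_intros]:
  assumes "poly_time_on D l"
  shows "poly_time_on D (\<lambda>x. rev (l x))"
proof -
  have *: "fold Cons xs ys = rev xs @ ys" for xs ys :: "'b list" by (induction xs arbitrary: ys) auto
  have "poly_time_on D (\<lambda>x. fold (\<lambda>e a. e # a) (l x) [])"
    by (rule pt_fold_reachable[OF assms, where M = "\<lambda>x. sz (l x)" and S = UNIV])
      (auto intro!: pt_intros pbdd_sz_pt assms sz_take simp: *)
  then show ?thesis by (simp add: *)
qed

text \<open>An element of \<open>l x\<close> is smaller than \<open>l x\<close>, whose size is
  polynomial in that of \<open>x\<close>; a bound in terms of \<open>(x, e)\<close> thus becomes one
  in terms of \<open>x\<close> alone, uniform over the list.\<close>

lemma pbdd_list_bound:
  assumes l: "poly_time_on D l"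
    and g: "pbdd {z. fst z \<in> D \<and> snd z \<in> set (l (fst z))} (\<lambda>z. g (fst z) (snd z))"
  obtains M where "pbdd D M" "\<And>x e. x \<in> D \<Longrightarrow> e \<in> set (l x) \<Longrightarrow> g x e \<le> M x"
proof -
  obtain q where q: "\<And>x e. x \<in> D \<Longrightarrow> e \<in> set (l x) \<Longrightarrow> g x e \<le> poly q (sz (x, e))"
    using g unfolding pbdd_def by force
  have p: "pbdd D (\<lambda>x. sz (x, l x))"
    using pbdd_sz_pt[OF pt_Pair[OF pt_id l]] .
  have P: "pbdd (UNIV :: ('a \<times> 'b list) set) (\<lambda>z. poly q (sz z))" by (rule pbddI[of _ _ q]) simp
  show thesis
  proof (rule that)
    show "pbdd D (\<lambda>x. poly q (sz (x, l x)))"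
      by (rule pbdd_comp[OF P _ p]) simp
    fix x e assume x: "x \<in> D" "e \<in> set (l x)"
    have "sz (x, e) \<le> sz (x, l x)" using sz_list_mem[OF x(2)] by simp
    then show "g x e \<le> poly q (sz (x, l x))" using q[OF x] poly_nat_mono order_trans by blast
  qed
qed

lemma pt_map [pt_intros]:
  assumes l: "poly_time_on D l"
    and g: "poly_time_on {z. fst z \<in> D \<and> snd z \<in> set (l (fst z))} (\<lambda>z. g (fst z) (snd z))"
  shows "poly_time_on D (\<lambda>x. map (g x) (l x))"
proof -
  have *: "fold (\<lambda>e a. f e # a) xs ys = rev (map f xs) @ ys" for f :: "'b \<Rightarrow> 'c" and xs ys
    by (induction xs arbitrary: ys) auto
  obtain M where M: "pbdd D M" "\<And>x e. x \<in> D \<Longrightarrow> e \<in> set (l x) \<Longrightarrow> sz (g x e) \<le> M x"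
    by (rule pbdd_list_bound[OF l pbdd_sz_pt[OF g]]) blast
  let ?S = "{z. fst z \<in> D \<and> fst (snd z) \<in> set (l (fst z))}"
  have "poly_time_on ?S (\<lambda>z. (\<lambda>z. g (fst z) (snd z)) (fst z, fst (snd z)))"
    by (rule pt_comp[OF g]) (auto intro!: pt_intros)
  then have "poly_time_on ?S (\<lambda>z :: _ \<times> _ \<times> 'c list. g (fst z) (fst (snd z)))" by simp
  then have "poly_time_on D (\<lambda>x. fold (\<lambda>e a. g x e # a) (l x) [])"
  proof (intro pt_fold_reachable[OF l, where S = ?S and M = "\<lambda>x. 1 + sz (l x) * (1 + M x)"])
    show "pbdd D (\<lambda>x. 1 + sz (l x) * (1 + M x))" by (intro pbdd_intros M(1) pbdd_sz_pt[OF l])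
    show "sz (fold (\<lambda>e a. g x e # a) (take n (l x)) []) \<le> 1 + sz (l x) * (1 + M x)"
      if "x \<in> D" for x n
      unfolding * append_Nil2 sz_rev
      by (rule sz_list_le) (use that M(2) length_le_sz[of "l x"] in \<open>auto dest: in_set_takeD\<close>)
  qed (auto intro!: pt_intros)
  from pt_rev[OF this] show ?thesis by (simp add: *)
qed

lemma pt_filter [pt_intros]:
  assumes l: "poly_time_on D l"
    and g: "poly_time_on {z. fst z \<in> D \<and> snd z \<in> set (l (fst z))} (\<lambda>z. g (fst z) (snd z))"
  shows "poly_time_on D (\<lambda>x. filter (g x) (l x))"
proof -
  have *: "fold (\<lambda>e a. if f e then e # a else a) xs ys = rev (filter f xs) @ ys" for f :: "'b \<Rightarrow> bool" and xs ys
    by (induction xs arbitrary: ys) auto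
  let ?S = "{z. fst z \<in> D \<and> fst (snd z) \<in> set (l (fst z))}"
  have "poly_time_on ?S (\<lambda>z. (\<lambda>z. g (fst z) (snd z)) (fst z, fst (snd z)))"
    by (rule pt_comp[OF g]) (auto intro!: pt_intros)
  then have "poly_time_on ?S (\<lambda>z :: _ \<times> _ \<times> 'b list. g (fst z) (fst (snd z)))" by simp
  then have "poly_time_on D (\<lambda>x. fold (\<lambda>e a. if g x e then e # a else a) (l x) [])"
  proof (intro pt_fold_reachable[OF l, where S = ?S and M = "\<lambda>x. sz (l x)"])
    show "sz (fold (\<lambda>e a. if g x e then e # a else a) (take n (l x)) []) \<le> sz (l x)" for x n
      unfolding * append_Nil2 sz_rev using sz_filter sz_take order_trans by blast
  qed (auto intro!: pt_intros pbdd_sz_pt[OF l])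
  from pt_rev[OF this] show ?thesis by (simp add: *)
qed

lemma pt_append [pt_intros]:
  assumes "poly_time_on D f" "poly_time_on D g"
  shows "poly_time_on D (\<lambda>x. f x @ g x)"
proof -
  have *: "fold Cons xs ys = rev xs @ ys" for xs ys :: "'b list" by (induction xs arbitrary: ys) auto
  have "poly_time_on D (\<lambda>x. fold (\<lambda>e a. e # a) (rev (f x)) (g x))"
  proof (rule pt_fold_reachable[where M = "\<lambda>x. sz (f x) + sz (g x)" and S = UNIV])
    show "sz (fold Cons (take n (rev (f x))) (g x)) \<le> sz (f x) + sz (g x)" for x n
      unfolding * using sz_append[of "rev (take n (rev (f x)))" "g x"] sz_take[of n "rev (f x)"] by simp
  qed (auto intro!: pt_intros pbdd_intros pbdd_sz_pt assms)
  then show ?thesis by (simp add: *)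
qed

lemma sz_concat: "sz (concat xss) \<le> sz xss"
proof (induction xss)
  case (Cons xs xss)
  then show ?case using sz_append[of xs "concat xss"] by simp
qed simp

lemma pt_concat [pt_intros]:
  assumes "poly_time_on D f"
  shows "poly_time_on D (\<lambda>x. concat (f x))"
proof -
  have *: "fold (\<lambda>e a. e @ a) xss ys = concat (rev xss) @ ys" for xss and ys :: "'b list"
    by (induction xss arbitrary: ys) auto
  have "poly_time_on D (\<lambda>x. fold (\<lambda>e a. e @ a) (rev (f x)) [])"
  proof (rule pt_fold_reachable[where M = "\<lambda>x. sz (f x)" and S = UNIV])
    show "sz (fold (@) (take n (rev (f x))) []) \<le> sz (f x)" for x n
      unfolding * using sz_concat[of "rev (take n (rev (f x)))"] sz_take[of n "rev (f x)"] by simp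
  qed (auto intro!: pt_intros pbdd_sz_pt assms)
  then show ?thesis by (simp add: *)
qed

lemma pt_list_ex [pt_intros]:
  assumes l: "poly_time_on D l"
    and g: "poly_time_on {z. fst z \<in> D \<and> snd z \<in> set (l (fst z))} (\<lambda>z. g (fst z) (snd z))"
  shows "poly_time_on D (\<lambda>x. list_ex (g x) (l x))"
proof -
  have "fold (\<lambda>e a. g x e \<or> a) xs b = (list_ex (g x) xs \<or> b)" for x xs b
    by (induction xs arbitrary: b) auto
  moreover let ?S = "{z. fst z \<in> D \<and> fst (snd z) \<in> set (l (fst z))}"
  have "poly_time_on ?S (\<lambda>z. (\<lambda>z. g (fst z) (snd z)) (fst z, fst (snd z)))"
    by (rule pt_comp[OF g]) (auto intro!: pt_intros)
  then have "poly_time_on ?S (\<lambda>z :: _ \<times> _ \<times> bool. g (fst z) (fst (snd z)))" by simp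
  then have "poly_time_on D (\<lambda>x. fold (\<lambda>e a. g x e \<or> a) (l x) False)"
    by (intro pt_fold_reachable[OF l, where S = ?S and M = "\<lambda>_. 2"])
      (auto intro!: pt_intros pbdd_intros simp: floorlog_def)
  ultimately show ?thesis by simp
qed

lemma pt_list_all [pt_intros]:
  assumes l: "poly_time_on D l"
    and g: "poly_time_on {z. fst z \<in> D \<and> snd z \<in> set (l (fst z))} (\<lambda>z. g (fst z) (snd z))"
  shows "poly_time_on D (\<lambda>x. list_all (g x) (l x))"
proof -
  have "poly_time_on D (\<lambda>x. \<not> list_ex (\<lambda>e. \<not> g x e) (l x))" by (intro pt_intros assms)
  then show ?thesis by (simp add: list_all_iff list_ex_iff)
qed

lemma pt_mem [pt_intros]:
  fixes f :: "_ \<Rightarrow> nat"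
  assumes f: "poly_time_on D f" and l: "poly_time_on D l"
  shows "poly_time_on D (\<lambda>x. f x \<in> set (l x))"
proof -
  have "poly_time_on UNIV (\<lambda>z :: nat \<times> nat list. list_ex (\<lambda>e. e = fst z) (snd z))"
    by (intro pt_intros)
  from pt_comp[OF this pt_Pair[OF f l]] show ?thesis by (simp add: list_ex_iff)
qed

lemma sz_sum_list: "sz (sum_list xs :: int) \<le> sz xs"
proof (induction xs)
  case (Cons x xs)
  then show ?case using vsize_Atom_add[of x "sum_list xs"] by (simp del: vsize.simps add: vsize.simps(2))
qed simp

lemma sz_prod_list: "sz (prod_list xs :: int) \<le> 1 + sz xs"
proof (induction xs)
  case (Cons x xs)
  then show ?case using vsize_Atom_mult[of x "prod_list xs"] by (simp del: vsize.simps add: vsize.simps(2))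
qed (simp add: floorlog_def)

lemma pt_sum_list [pt_intros]:
  fixes l :: "_ \<Rightarrow> int list"
  assumes "poly_time_on D l"
  shows "poly_time_on D (\<lambda>x. sum_list (l x))"
proof -
  have *: "fold (\<lambda>e a. e + a) xs a = sum_list xs + a" for xs and a :: int
    by (induction xs arbitrary: a) auto
  have "poly_time_on D (\<lambda>x. fold (\<lambda>e a. e + a) (l x) 0)"
  proof (rule pt_fold_reachable[where M = "\<lambda>x. sz (l x)" and S = UNIV])
    show "sz (fold (+) (take n (l x)) 0) \<le> sz (l x)" for x n
      unfolding * add_0_right using sz_sum_list sz_take order_trans by blast
  qed (auto intro!: pt_intros pbdd_sz_pt assms)
  then show ?thesis by (simp add: *)
qed

lemma pt_prod_list [pt_intros]:
  fixes l :: "_ \<Rightarrow> int list"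
  assumes "poly_time_on D l"
  shows "poly_time_on D (\<lambda>x. prod_list (l x))"
proof -
  have *: "fold (\<lambda>e a. e * a) xs a = prod_list xs * a" for xs and a :: int
    by (induction xs arbitrary: a) auto
  have "poly_time_on D (\<lambda>x. fold (\<lambda>e a. e * a) (l x) 1)"
  proof (rule pt_fold_reachable[where M = "\<lambda>x. 1 + sz (l x)" and S = UNIV])
    show "sz (fold times (take n (l x)) 1) \<le> 1 + sz (l x)" for x n
      unfolding * mult_1_right using sz_prod_list[of "take n (l x)"] sz_take[of n "l x"] by linarith
  qed (auto intro!: pt_intros pbdd_intros pbdd_sz_pt assms)
  then show ?thesis by (simp add: *)
qed

lemma pt_length_less [pt_intros]:
  assumes "poly_time_on D f" "poly_time_on D g"
  shows "poly_time_on D (\<lambda>x. length (f x) < length (g x))"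
proof -
  have *: "sum_list (map (\<lambda>_. 1) xs) = int (length xs)" for xs :: "'z list" by (induction xs) auto
  have "poly_time_on D (\<lambda>x. sum_list (map (\<lambda>_. 1 :: int) (f x)) < sum_list (map (\<lambda>_. 1) (g x)))"
    by (intro pt_intros assms)
  then show ?thesis by (simp add: *)
qed

definition lookup :: "'v \<Rightarrow> ('k \<times> 'v) list \<Rightarrow> 'k \<Rightarrow> 'v" where
  "lookup d l k = fold (\<lambda>z a. if fst z = k then snd z else a) l d"

lemma lookup_map: "lookup d (map (\<lambda>v. (v, c v)) V) k = (if k \<in> set V then c k else d)"
proof -
  have "fold (\<lambda>z a. if fst z = k then snd z else a) (map (\<lambda>v. (v, c v)) V) a = (if k \<in> set V then c k else a)" for a
    by (induction V arbitrary: a) auto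
  then show ?thesis by (simp add: lookup_def)
qed

lemma lookup_in: "lookup d l k \<in> insert d (snd ` set l)"
  unfolding lookup_def by (rule fold_invariant) auto

lemma lookup_mem: "k \<in> fst ` set l \<Longrightarrow> (k, lookup d l k) \<in> set l"
proof (induction l rule: rev_induct)
  case (snoc z l)
  then show ?case by (cases z) (auto simp: lookup_def)
qed simp

text \<open>The equality test on keys is a parameter because it has to be programmed for each type
  of keys separately. The accumulator is always the default or a value from the list, which bounds
  its size.\<close>

lemma pt_lookup_gen:
  fixes dv :: "'x::encodable \<Rightarrow> 'v::encodable" and k :: "'x \<Rightarrow> 'k::encodable"
  assumes eq: "poly_time_on UNIV (\<lambda>z. fst z = (snd z :: 'k))"
    and d: "poly_time_on D dv" and l: "poly_time_on D l" and k: "poly_time_on D k"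
  shows "poly_time_on D (\<lambda>x. lookup (dv x) (l x) (k x))"
proof -
  let ?D = "UNIV :: ('v \<times> ('k \<times> 'v) list \<times> 'k) set"
  have "poly_time_on ?D (\<lambda>y. fold (\<lambda>z a. if fst z = snd (snd y) then snd z else a) (fst (snd y)) (fst y))"
  proof (rule pt_fold[where Inv = "\<lambda>y a. a \<in> insert (fst y) (snd ` set (fst (snd y)))" and M = "\<lambda>y. sz y"])
    fix x :: "'v \<times> ('k \<times> 'v) list \<times> 'k" and a assume a: "a \<in> insert (fst x) (snd ` set (fst (snd x)))"
    obtain d l k where x: "x = (d, l, k)" by (cases x) auto
    from a consider "a = d" | z where "z \<in> set l" "a = snd z" by (auto simp: x)
    then show "sz a \<le> sz x"
    proof cases
      case 2
      then show ?thesis using sz_list_mem[OF 2(1)] by (simp add: x enc_pair[of z])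
    qed (simp add: x)
  qed (auto intro!: pt_intros pbdd_intros pt_binary[OF eq])
  from pt_comp[OF this pt_Pair[OF d pt_Pair[OF l k]]] show ?thesis by (simp add: lookup_def)
qed

lemma pt_lookup_nat [pt_intros]:
  fixes k :: "_ \<Rightarrow> nat"
  shows "poly_time_on D d \<Longrightarrow> poly_time_on D l \<Longrightarrow> poly_time_on D k \<Longrightarrow>
    poly_time_on D (\<lambda>x. lookup (d x) (l x) (k x))"
  by (rule pt_lookup_gen) (intro pt_intros)

lemma pt_lookup_pair [pt_intros]:
  fixes k :: "_ \<Rightarrow> nat \<times> nat"
  shows "poly_time_on D d \<Longrightarrow> poly_time_on D l \<Longrightarrow> poly_time_on D k \<Longrightarrow>
    poly_time_on D (\<lambda>x. lookup (d x) (l x) (k x))"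
  by (rule pt_lookup_gen) (intro pt_intros)

section \<open>The algorithm\<close>

subsection \<open>Iteration until saturation\<close>

lemma fold_const: "fold (\<lambda>_. f) l x = (f ^^ length l) x"
  by (induction l arbitrary: x) (auto simp: funpow_swap1)

text \<open>Every round that changes the value gains at least \<open>d\<close>, and at most
  \<open>n * d\<close> is left to be gained; once a round changes nothing, no later one does. So
  \<open>n\<close> blind rounds end in a fixed point. Local search, graph search and flow
  augmentation all rest on this.\<close>

lemma saturate:
  fixes m :: "'a \<Rightarrow> int" and d N :: int
  assumes inv: "\<And>x. P x \<Longrightarrow> P (f x)" and inc: "\<And>x. P x \<Longrightarrow> f x \<noteq> x \<Longrightarrow> m x + d \<le> m (f x)"
    and bound: "\<And>x. P x \<Longrightarrow> m x \<le> N" and d: "d > 0" and x: "P x" "N \<le> m x + int n * d"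
  shows "P ((f ^^ n) x) \<and> f ((f ^^ n) x) = (f ^^ n) x"
  using x
proof (induction n arbitrary: x)
  case 0
  then show ?case using inc[of x] bound[of "f x"] inv[of x] d by force
next
  case (Suc n)
  show ?case
  proof (cases "f x = x")
    case True
    then have "(f ^^ k) x = x" for k by (induction k) auto
    then show ?thesis using True Suc.prems by metis
  next
    case False
    then have "N \<le> m (f x) + int n * d" using inc[of x] Suc.prems by (simp add: algebra_simps)
    then show ?thesis using Suc.IH[of "f x"] inv Suc.prems by (simp add: funpow_swap1)
  qed
qed

text \<open>After \<open>saturate\<close> has produced a fixed point of a whole sweep, this shows
  that each single step of the sweep leaves it fixed, since any change would have increased the
  measure for good.\<close>

lemma fold_grows:
  fixes m :: "'a \<Rightarrow> nat"
  assumes "\<And>e x. f e x = x \<or> m x < m (f e x)"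
  shows "fold f es x = x \<and> (\<forall>e\<in>set es. f e x = x) \<or> m x < m (fold f es x)"
proof (induction es arbitrary: x)
  case (Cons e es)
  show ?case
  proof (cases "f e x = x")
    case True
    then show ?thesis using Cons[of x] by simp
  next
    case False
    then have "m x < m (f e x)" using assms by blast
    then show ?thesis using Cons[of "f e x"] by auto
  qed
qed simp

subsection \<open>Two-colouring by merging components\<close>

definition adj :: "(nat \<times> nat) list \<Rightarrow> nat \<Rightarrow> nat \<Rightarrow> bool" where
  "adj es u v \<longleftrightarrow> list_ex (\<lambda>e. e = (u, v) \<or> e = (v, u)) es"

lemma adj_iff: "adj es u v \<longleftrightarrow> (u, v) \<in> set es \<or> (v, u) \<in> set es"
  by (auto simp: adj_def list_ex_iff)

lemma adj_sym: "adj es u v = adj es v u"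
  by (auto simp: adj_iff)

text \<open>A colouring assigns to each vertex the name of its component and its colour.\<close>

type_synonym colouring = "(nat \<times> nat \<times> bool) list"

definition comp_of :: "colouring \<Rightarrow> nat \<Rightarrow> nat" where "comp_of C v = fst (lookup (0, False) C v)"
definition col_of :: "colouring \<Rightarrow> nat \<Rightarrow> bool" where "col_of C v = snd (lookup (0, False) C v)"

text \<open>Endpoints in different components cause the component of \<open>snd e\<close> to take
  the name of that of \<open>fst e\<close>. The inequality of Booleans is an exclusive or: the
  renamed component is inverted exactly if both endpoints have the same colour.\<close>

definition merge :: "nat \<times> nat \<Rightarrow> colouring \<Rightarrow> colouring" where
  "merge e C = (if comp_of C (fst e) = comp_of C (snd e) then C
     else map (\<lambda>z. if fst (snd z) = comp_of C (snd e)
       then (fst z, comp_of C (fst e), snd (snd z) \<noteq> (col_of C (fst e) = col_of C (snd e))) else z) C)"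

definition edges_within :: "(nat \<times> nat) list \<Rightarrow> nat list \<Rightarrow> (nat \<times> nat) list" where
  "edges_within es B = filter (\<lambda>e. fst e \<in> set B \<and> snd e \<in> set B) es"

definition two_colouring :: "(nat \<times> nat) list \<Rightarrow> nat list \<Rightarrow> colouring" where
  "two_colouring es B = fold merge (edges_within es B) (map (\<lambda>v. (v, v, False)) B)"

text \<open>The colouring is computed for any graph and checked afterwards. A positive answer thus
  carries its own witness, and reasoning about the merging is confined to the converse,
  \<open>bipartite_onI\<close>.\<close>

definition bipartite_on :: "(nat \<times> nat) list \<Rightarrow> nat list \<Rightarrow> bool" where
  "bipartite_on es B \<longleftrightarrow> list_all (\<lambda>e. col_of (two_colouring es B) (fst e) \<noteq> col_of (two_colouring es B) (snd e))
     (edges_within es B)"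

section \<open>Completeness of the two-colouring test\<close>

definition merge_fun :: "nat \<times> nat \<Rightarrow> (nat \<Rightarrow> nat \<times> bool) \<Rightarrow> nat \<Rightarrow> nat \<times> bool" where
  "merge_fun e c = (if fst (c (fst e)) = fst (c (snd e)) then c
     else (\<lambda>z. if fst (c z) = fst (c (snd e))
       then (fst (c (fst e)), snd (c z) \<noteq> (snd (c (fst e)) = snd (c (snd e)))) else c z))"

abbreviation tabulate :: "nat list \<Rightarrow> (nat \<Rightarrow> 'a) \<Rightarrow> (nat \<times> 'a) list" where
  "tabulate B c \<equiv> map (\<lambda>v. (v, c v)) B"

lemma merge_tabulate:
  "fst e \<in> set B \<Longrightarrow> snd e \<in> set B \<Longrightarrow> merge e (tabulate B c) = tabulate B (merge_fun e c)"
  by (auto simp: merge_def merge_fun_def comp_of_def col_of_def lookup_map)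

lemma merge_fun_in:
  "fst e \<in> set B \<Longrightarrow> snd e \<in> set B \<Longrightarrow> \<forall>v\<in>set B. fst (c v) \<in> set B \<Longrightarrow>
   \<forall>v\<in>set B. fst (merge_fun e c v) \<in> set B"
  by (auto simp: merge_fun_def)

text \<open>The vertices are distinct, so these are paths, given by their vertices. An odd length
  means an even number of edges, and from length 3 on an edge between the ends closes such a path to
  an odd cycle.\<close>

definition walk :: "(nat \<Rightarrow> nat \<Rightarrow> bool) \<Rightarrow> nat set \<Rightarrow> nat \<Rightarrow> nat list \<Rightarrow> nat \<Rightarrow> bool" where
  "walk A P u xs v \<longleftrightarrow> xs \<noteq> [] \<and> hd xs = u \<and> last xs = v \<and> distinct xs \<and> set xs \<subseteq> P \<and> successively A xs"

lemma walk_mono: "walk A P u xs v \<Longrightarrow> P \<subseteq> Q \<Longrightarrow> walk A Q u xs v"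
  by (auto simp: walk_def)

lemma walk_append:
  "walk A P u xs v \<Longrightarrow> walk A Q u' ys v' \<Longrightarrow> A v u' \<Longrightarrow> P \<inter> Q = {} \<Longrightarrow> walk A (P \<union> Q) u (xs @ ys) v'"
  by (auto simp: walk_def successively_append_iff)

lemma walk_rev:
  assumes "\<And>x y. A x y = A y x" "walk A P u xs v"
  shows "walk A P v (rev xs) u"
  using assms(2) assms(1) by (auto simp: walk_def hd_rev last_rev)

definition no_odd_cycle :: "(nat \<times> nat) list \<Rightarrow> nat set \<Rightarrow> bool" where
  "no_odd_cycle es B \<longleftrightarrow> (\<forall>u v xs. walk (adj es) B u xs v \<and> odd (length xs) \<and> 3 \<le> length xs \<longrightarrow> \<not> adj es v u)"

text \<open>Colours record the parity of paths. The path has to stay inside the component, because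
  then paths in different components are disjoint and can be concatenated when the components are
  merged.\<close>

definition connected_colouring :: "(nat \<times> nat) list \<Rightarrow> nat set \<Rightarrow> (nat \<Rightarrow> nat \<times> bool) \<Rightarrow> bool" where
  "connected_colouring es B c \<longleftrightarrow> (\<forall>x\<in>B. \<forall>y\<in>B. fst (c x) = fst (c y) \<longrightarrow>
     (\<exists>xs. walk (adj es) {z \<in> B. fst (c z) = fst (c x)} x xs y \<and> (odd (length xs) \<longleftrightarrow> snd (c x) = snd (c y))))"

text \<open>Vertices of the two merged components are joined by a path to \<open>u\<close>, the edge
  \<open>e\<close>, and a path from \<open>v\<close> onwards. The inversion makes \<open>u\<close>
  and \<open>v\<close> differ in colour, which matches the parity of the concatenated path.\<close>

lemma connected_colouring_merge:
  assumes c: "connected_colouring es B c" and e: "e \<in> set es" "fst e \<in> B" "snd e \<in> B"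
  shows "connected_colouring es B (merge_fun e c)"
proof (cases "fst (c (fst e)) = fst (c (snd e))")
  case True
  then show ?thesis using c by (simp add: merge_fun_def)
next
  case False
  obtain u v where uv: "e = (u, v)" by (cases e)
  let ?K = "\<lambda>i. {z \<in> B. fst (c z) = i}"
  let ?d = "merge_fun e c"
  have ne: "fst (c u) \<noteq> fst (c v)" using False uv by simp
  have A: "adj es u v" "adj es v u" using e(1) uv by (auto simp: adj_iff)
  have d: "?d z = (if fst (c z) = fst (c v) then (fst (c u), snd (c z) \<noteq> (snd (c u) = snd (c v))) else c z)" for z
    using ne uv by (simp add: merge_fun_def)
  have disj: "?K (fst (c u)) \<inter> ?K (fst (c v)) = {}" using ne by auto
  have new: "{z \<in> B. fst (?d z) = fst (c u)} = ?K (fst (c u)) \<union> ?K (fst (c v))"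
    by (auto simp: d)
  have cross: "\<exists>xs. walk (adj es) (?K (fst (c u)) \<union> ?K (fst (c v))) x xs y \<and>
      (odd (length xs) \<longleftrightarrow> snd (?d x) = snd (?d y))"
    if x: "x \<in> B" "fst (c x) = fst (c u)" and y: "y \<in> B" "fst (c y) = fst (c v)" for x y
  proof -
    obtain xs where xs: "walk (adj es) (?K (fst (c u))) x xs u" "odd (length xs) \<longleftrightarrow> snd (c x) = snd (c u)"
      using c x e uv unfolding connected_colouring_def by fastforce
    obtain ys where ys: "walk (adj es) (?K (fst (c v))) v ys y" "odd (length ys) \<longleftrightarrow> snd (c v) = snd (c y)"
      using c y e uv unfolding connected_colouring_def by fastforce
    show ?thesis
      using walk_append[OF xs(1) ys(1) A(1) disj] xs(2) ys(2) x y ne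
      by (intro exI[of _ "xs @ ys"]) (auto simp: d)
  qed
  show ?thesis
    unfolding connected_colouring_def
  proof (intro ballI impI)
    fix x y assume x: "x \<in> B" and y: "y \<in> B" and eq: "fst (?d x) = fst (?d y)"
    consider (same) "fst (c x) = fst (c y)"
      | (xy) "fst (c x) = fst (c u)" "fst (c y) = fst (c v)"
      | (yx) "fst (c y) = fst (c u)" "fst (c x) = fst (c v)"
      using eq by (auto simp: d split: if_splits)
    then show "\<exists>xs. walk (adj es) {z \<in> B. fst (?d z) = fst (?d x)} x xs y \<and>
        (odd (length xs) \<longleftrightarrow> snd (?d x) = snd (?d y))"
    proof cases
      case same
      then obtain xs where xs: "walk (adj es) (?K (fst (c x))) x xs y" "odd (length xs) \<longleftrightarrow> snd (c x) = snd (c y)"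
        using c x y unfolding connected_colouring_def by blast
      have "?K (fst (c x)) \<subseteq> {z \<in> B. fst (?d z) = fst (?d x)}" by (auto simp: d)
      then show ?thesis using walk_mono[OF xs(1)] xs(2) same by (intro exI[of _ xs]) (auto simp: d)
    next
      case xy
      have "fst (?d x) = fst (c u)" using xy ne by (simp add: d)
      then show ?thesis using cross[OF x xy(1) y xy(2)] new by simp
    next
      case yx
      have "fst (?d x) = fst (c u)" using yx ne by (simp add: d)
      moreover obtain xs where "walk (adj es) (?K (fst (c u)) \<union> ?K (fst (c v))) y xs x"
        "odd (length xs) \<longleftrightarrow> snd (?d y) = snd (?d x)"
        using cross[OF y yx(1) x yx(2)] by blast
      ultimately show ?thesis using walk_rev[OF adj_sym] new
        by (intro exI[of _ "rev xs"]) auto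
    qed
  qed
qed

text \<open>Equal colours within one component would come with a path on an odd number of vertices
  between the endpoints, and \<open>e\<close> would close it to an odd cycle. Between different
  components the inversion takes care of the colours.\<close>

lemma merge_fun_separates:
  assumes no: "no_odd_cycle es B" and c: "connected_colouring es B c"
    and e: "e \<in> set es" "fst e \<in> B" "snd e \<in> B" "fst e \<noteq> snd e"
  shows "fst (merge_fun e c (fst e)) = fst (merge_fun e c (snd e)) \<and>
    snd (merge_fun e c (fst e)) \<noteq> snd (merge_fun e c (snd e))"
proof (cases "fst (c (fst e)) = fst (c (snd e))")
  case True
  obtain xs where xs: "walk (adj es) {z \<in> B. fst (c z) = fst (c (fst e))} (fst e) xs (snd e)"
    "odd (length xs) \<longleftrightarrow> snd (c (fst e)) = snd (c (snd e))"
    using c True e unfolding connected_colouring_def by blast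
  have "snd (c (fst e)) \<noteq> snd (c (snd e))"
  proof
    assume "snd (c (fst e)) = snd (c (snd e))"
    then have odd: "odd (length xs)" using xs by simp
    moreover have "length xs \<noteq> 1" using xs(1) e(4) by (auto simp: walk_def length_Suc_conv)
    moreover have "length xs \<noteq> 0" using xs(1) by (auto simp: walk_def)
    ultimately have "3 \<le> length xs" by presburger
    moreover have "walk (adj es) B (fst e) xs (snd e)" by (rule walk_mono[OF xs(1)]) auto
    ultimately show False using no odd e(1) unfolding no_odd_cycle_def
      by (metis adj_iff prod.collapse)
  qed
  with True show ?thesis by (simp add: merge_fun_def)
next
  case False
  then show ?thesis by (auto simp: merge_fun_def)
qed

text \<open>A merge inverts a component as a whole or leaves its colours alone, so the edges treated
  earlier stay properly coloured.\<close>

lemma merge_fun_keeps_separated: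
  "fst (c x) = fst (c y) \<Longrightarrow> snd (c x) \<noteq> snd (c y) \<Longrightarrow>
   fst (merge_fun e c x) = fst (merge_fun e c y) \<and> snd (merge_fun e c x) \<noteq> snd (merge_fun e c y)"
  by (auto simp: merge_fun_def)

lemma bipartite_onI:
  assumes no: "no_odd_cycle es (set B)" and loopless: "\<And>e. e \<in> set es \<Longrightarrow> fst e \<noteq> snd e"
  shows "bipartite_on es B"
proof -
  have "\<exists>c. fold merge ks (tabulate B (\<lambda>v. (v, False))) = tabulate B c \<and> connected_colouring es (set B) c \<and>
      (\<forall>e\<in>set ks. fst (c (fst e)) = fst (c (snd e)) \<and> snd (c (fst e)) \<noteq> snd (c (snd e)))"
    if "set ks \<subseteq> set (edges_within es B)" for ks
    using that
  proof (induction ks rule: rev_induct)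
    case Nil
    have "connected_colouring es (set B) (\<lambda>v. (v, False))"
      unfolding connected_colouring_def
    proof (intro ballI impI)
      fix x y assume "x \<in> set B" "fst (x, False) = fst (y, False)"
      then show "\<exists>xs. walk (adj es) {z \<in> set B. fst (z, False) = fst (x, False)} x xs y \<and>
          odd (length xs) = (snd (x, False) = snd (y, False))"
        by (intro exI[of _ "[x]"]) (auto simp: walk_def)
    qed
    then show ?case by auto
  next
    case (snoc e ks)
    then obtain c where c: "fold merge ks (tabulate B (\<lambda>v. (v, False))) = tabulate B c"
      "connected_colouring es (set B) c"
      "\<forall>e\<in>set ks. fst (c (fst e)) = fst (c (snd e)) \<and> snd (c (fst e)) \<noteq> snd (c (snd e))"
      by auto
    have e: "e \<in> set es" "fst e \<in> set B" "snd e \<in> set B" using snoc.prems by (auto simp: edges_within_def)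
    show ?case
    proof (intro exI[of _ "merge_fun e c"] conjI ballI)
      show "fold merge (ks @ [e]) (tabulate B (\<lambda>v. (v, False))) = tabulate B (merge_fun e c)"
        using merge_tabulate[OF e(2,3)] c(1) by simp
      show "connected_colouring es (set B) (merge_fun e c)" by (rule connected_colouring_merge[OF c(2) e])
      fix e' assume e': "e' \<in> set (ks @ [e])"
      have "fst (merge_fun e c (fst e')) = fst (merge_fun e c (snd e')) \<and>
          snd (merge_fun e c (fst e')) \<noteq> snd (merge_fun e c (snd e'))"
      proof (cases "e' = e")
        case True
        then show ?thesis using merge_fun_separates[OF no c(2) e loopless[OF e(1)]] by simp
      next
        case False
        then show ?thesis using merge_fun_keeps_separated c(3) e' by auto
      qed
      then show "fst (merge_fun e c (fst e')) = fst (merge_fun e c (snd e'))"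
        "snd (merge_fun e c (fst e')) \<noteq> snd (merge_fun e c (snd e'))" by blast+
    qed
  qed
  from this[of "edges_within es B"] obtain c where c: "two_colouring es B = tabulate B c"
    "\<forall>e\<in>set (edges_within es B). snd (c (fst e)) \<noteq> snd (c (snd e))"
    unfolding two_colouring_def by blast
  then show ?thesis
    by (auto simp: bipartite_on_def list_all_iff col_of_def lookup_map edges_within_def)
qed

lemma bipartite_onD:
  assumes "bipartite_on es B" "adj es u v" "u \<in> set B" "v \<in> set B"
  shows "col_of (two_colouring es B) u \<noteq> col_of (two_colouring es B) v"
  using assms unfolding bipartite_on_def list_all_iff adj_iff edges_within_def by fastforce

subsection \<open>A locally maximum induced bipartite subgraph\<close>

text \<open>\<open>X\<close> lists the vertices whose membership in \<open>B\<close> is toggled, so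
  that a single list describes insertions and deletions. An accepted exchange is a sublist of
  \<open>V\<close>, which keeps the sizes under control during the search.\<close>

definition improve :: "(nat \<times> nat) list \<Rightarrow> nat list \<Rightarrow> nat list \<Rightarrow> nat list \<Rightarrow> nat list" where
  "improve es V X B = (if length B < length (filter (\<lambda>v. (v \<in> set B) \<noteq> (v \<in> set X)) V) \<and>
       bipartite_on es (filter (\<lambda>v. (v \<in> set B) \<noteq> (v \<in> set X)) V)
     then filter (\<lambda>v. (v \<in> set B) \<noteq> (v \<in> set X)) V else B)"

fun lists_upto :: "nat \<Rightarrow> 'a list \<Rightarrow> 'a list list" where
  "lists_upto 0 V = [[]]"
| "lists_upto (Suc k) V = [] # concat (map (\<lambda>v. map ((#) v) (lists_upto k V)) V)"

lemma set_lists_upto: "set (lists_upto k V) = {xs. set xs \<subseteq> set V \<and> length xs \<le> k}"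
proof (induction k)
  case (Suc k)
  show ?case
  proof (intro set_eqI)
    fix xs show "xs \<in> set (lists_upto (Suc k) V) \<longleftrightarrow> xs \<in> {xs. set xs \<subseteq> set V \<and> length xs \<le> Suc k}"
      by (cases xs) (auto simp: Suc)
  qed
qed auto

text \<open>The outer list \<open>V\<close> only counts: a sweep that changes \<open>B\<close> makes
  it longer, hence \<open>length V\<close> sweeps reach a local optimum.\<close>

definition bipartite_part :: "nat \<Rightarrow> (nat \<times> nat) list \<Rightarrow> nat list \<Rightarrow> nat list" where
  "bipartite_part k es V = fold (\<lambda>_ B. fold (improve es V) (lists_upto k V) B) V []"

definition sublist_bip :: "(nat \<times> nat) list \<Rightarrow> nat list \<Rightarrow> nat list \<Rightarrow> bool" where
  "sublist_bip es V B \<longleftrightarrow> (\<exists>P. B = filter P V) \<and> bipartite_on es B"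

lemma sublist_bip_Nil: "sublist_bip es V []"
  unfolding sublist_bip_def
  by (auto intro!: exI[of _ "\<lambda>_. False"] simp: bipartite_on_def edges_within_def filter_empty_conv[symmetric])

lemma sublist_bip_improve: "sublist_bip es V B \<Longrightarrow> sublist_bip es V (improve es V X B)"
  by (auto simp: sublist_bip_def improve_def)

lemma sublist_bip_fold: "sublist_bip es V B \<Longrightarrow> sublist_bip es V (fold (improve es V) Xs B)"
  by (rule fold_invariant[where P = "sublist_bip es V"]) (auto intro: sublist_bip_improve)

lemma length_improve: "improve es V X B = B \<or> length B < length (improve es V X B)"
  by (simp add: improve_def)

lemma length_fold_improve:
  "fold (improve es V) Xs B = B \<and> (\<forall>X\<in>set Xs. improve es V X B = B) \<or> length B < length (fold (improve es V) Xs B)"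
  by (rule fold_grows) (rule length_improve)

lemma bipartite_part_correct:
  shows "sublist_bip es V (bipartite_part k es V)"
    and "set X \<subseteq> set V \<Longrightarrow> length X \<le> k \<Longrightarrow> improve es V X (bipartite_part k es V) = bipartite_part k es V"
proof -
  let ?f = "fold (improve es V) (lists_upto k V)"
  have "sublist_bip es V ((?f ^^ length V) []) \<and> ?f ((?f ^^ length V) []) = (?f ^^ length V) []"
  proof (rule saturate[where m = "\<lambda>B. int (length B)" and d = 1 and N = "int (length V)"])
    fix B assume "sublist_bip es V B"
    then show "sublist_bip es V (?f B)" by (rule sublist_bip_fold)
    show "?f B \<noteq> B \<Longrightarrow> int (length B) + 1 \<le> int (length (?f B))"
      using length_fold_improve[of es V "lists_upto k V" B] by auto
    show "int (length B) \<le> int (length V)" using \<open>sublist_bip es V B\<close>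
      by (auto simp: sublist_bip_def)
  qed (auto simp: sublist_bip_Nil)
  then have *: "sublist_bip es V (bipartite_part k es V)" "?f (bipartite_part k es V) = bipartite_part k es V"
    by (simp_all add: bipartite_part_def fold_const)
  show "sublist_bip es V (bipartite_part k es V)" by fact
  show "improve es V X (bipartite_part k es V) = bipartite_part k es V" if "set X \<subseteq> set V" "length X \<le> k"
    using length_fold_improve[of es V "lists_upto k V" "bipartite_part k es V"] * that
    by (auto simp: set_lists_upto)
qed

subsection \<open>Maximum weight independent sets in bipartite graphs\<close>

type_synonym flow = "((nat \<times> nat) \<times> int) list"

definition out_flow :: "flow \<Rightarrow> nat \<Rightarrow> int" where
  "out_flow F u = sum_list (map (\<lambda>z. if fst (fst z) = u then snd z else 0) F)"

definition in_flow :: "flow \<Rightarrow> nat \<Rightarrow> int" where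
  "in_flow F v = sum_list (map (\<lambda>z. if snd (fst z) = v then snd z else 0) F)"

definition shift :: "nat \<times> nat \<Rightarrow> int \<Rightarrow> flow \<Rightarrow> flow" where
  "shift e d F = map (\<lambda>z. if fst z = e then (fst z, snd z + d) else z) F"

text \<open>Every reached vertex carries the flow that results from pushing \<open>d\<close> units to it, so that
  augmenting paths need not be represented.\<close>

definition explore :: "int \<Rightarrow> nat \<times> nat \<Rightarrow> (nat \<times> flow) list \<Rightarrow> (nat \<times> flow) list" where
  "explore d e R =
    (if fst e \<in> set (map fst R) \<and> snd e \<notin> set (map fst R)
     then (snd e, shift e d (lookup [] R (fst e))) # R
     else if snd e \<in> set (map fst R) \<and> fst e \<notin> set (map fst R) \<and> d \<le> lookup 0 (lookup [] R (snd e)) e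
     then (fst e, shift e (0 - d) (lookup [] R (snd e))) # R
     else R)"

definition sources :: "nat list \<Rightarrow> (nat \<times> int) list \<Rightarrow> int \<Rightarrow> flow \<Rightarrow> (nat \<times> flow) list" where
  "sources P b d F = map (\<lambda>u. (u, F)) (filter (\<lambda>u. out_flow F u + d \<le> lookup 0 b u) P)"

definition reach :: "nat list \<Rightarrow> nat list \<Rightarrow> (nat \<times> int) list \<Rightarrow> int \<Rightarrow> flow \<Rightarrow> (nat \<times> flow) list" where
  "reach P Q b d F = fold (\<lambda>_ R. fold (explore d) (map fst F) R) (P @ Q) (sources P b d F)"

text \<open>Any reached vertex of \<open>Q\<close> with \<open>d\<close> units of spare capacity
  will do, as the flow stored with it is already the augmented one. Capacities are tested against
  the original \<open>F\<close>, which is also the result if there is no such vertex.\<close>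

definition augment :: "nat list \<Rightarrow> nat list \<Rightarrow> (nat \<times> int) list \<Rightarrow> int \<Rightarrow> flow \<Rightarrow> flow" where
  "augment P Q b d F = fold (\<lambda>z F'. if fst z \<in> set Q \<and> in_flow F (fst z) + d \<le> lookup 0 b (fst z)
     then snd z else F') (reach P Q b d F) F"

text \<open>The list is a counter of twice the number of edges and vertices. The preceding phase
  leaves a gap of at most that number of edges and vertices times \<open>2 * d\<close>, and every
  augmentation closes \<open>d\<close> of it.\<close>

definition phase :: "nat list \<Rightarrow> nat list \<Rightarrow> (nat \<times> int) list \<Rightarrow> int \<Rightarrow> flow \<Rightarrow> flow" where
  "phase P Q b d F = fold (\<lambda>_ F. augment P Q b d F)
     ((map (\<lambda>z. fst (fst z)) F @ P @ Q) @ (map (\<lambda>z. fst (fst z)) F @ P @ Q)) F"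

definition powers :: "int \<Rightarrow> int list" where
  "powers W = rev (map (\<lambda>i. 2 ^ i) [0..<(LEAST k. W < 2 ^ k)])"

text \<open>With nonnegative capacities the added 1 makes the argument of \<open>powers\<close>
  positive, so the list of step sizes is nonempty and ends with 1.\<close>

definition max_flow :: "nat list \<Rightarrow> nat list \<Rightarrow> (nat \<times> int) list \<Rightarrow> (nat \<times> nat) list \<Rightarrow> flow" where
  "max_flow P Q b ks = fold (phase P Q b) (powers (1 + sum_list (map (lookup 0 b) P)))
     (map (\<lambda>e. (e, 0)) ks)"

text \<open>As in Koenig's theorem, the unreached vertices of \<open>P\<close> and the reached
  vertices of \<open>Q\<close> form a vertex cover of minimum weight; this is its
  complement.\<close>

definition bip_indep :: "nat list \<Rightarrow> nat list \<Rightarrow> (nat \<times> int) list \<Rightarrow> (nat \<times> nat) list \<Rightarrow> nat list" where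
  "bip_indep P Q b ks =
     filter (\<lambda>u. u \<in> set (map fst (reach P Q b 1 (max_flow P Q b ks)))) P @
     filter (\<lambda>v. v \<notin> set (map fst (reach P Q b 1 (max_flow P Q b ks)))) Q"

text \<open>Capacities sit on the vertices and are the weights. They stand for arcs from a source to
  \<open>P\<close> and from \<open>Q\<close> to a sink, while the edges in \<open>ks\<close> are
  unbounded; minimum cuts are therefore vertex covers of minimum weight.\<close>

locale network =
  fixes P Q :: "nat list" and ks :: "(nat \<times> nat) list" and b :: "(nat \<times> int) list"
  assumes dist: "distinct P" "distinct Q" "distinct ks" and disj: "set P \<inter> set Q = {}"
    and ks: "set ks \<subseteq> set P \<times> set Q" and cap_nonneg: "v \<in> set P \<union> set Q \<Longrightarrow> 0 \<le> lookup 0 b v"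
begin

abbreviation K :: "(nat \<times> nat) set" where "K \<equiv> set ks"
abbreviation cap :: "nat \<Rightarrow> int" where "cap \<equiv> lookup 0 b"

definition fl :: "(nat \<times> nat \<Rightarrow> int) \<Rightarrow> flow" where "fl \<phi> = map (\<lambda>e. (e, \<phi> e)) ks"
definition outf :: "(nat \<times> nat \<Rightarrow> int) \<Rightarrow> nat \<Rightarrow> int" where "outf \<phi> u = (\<Sum>e\<in>K. if fst e = u then \<phi> e else 0)"
definition inn :: "(nat \<times> nat \<Rightarrow> int) \<Rightarrow> nat \<Rightarrow> int" where "inn \<phi> v = (\<Sum>e\<in>K. if snd e = v then \<phi> e else 0)"

lemma out_flow_fl: "out_flow (fl \<phi>) u = outf \<phi> u"
  unfolding out_flow_def fl_def outf_def sum.distinct_set_conv_list[OF dist(3)]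
  by (rule arg_cong[where f = sum_list]) simp

lemma in_flow_fl: "in_flow (fl \<phi>) u = inn \<phi> u"
  unfolding in_flow_def fl_def inn_def sum.distinct_set_conv_list[OF dist(3)]
  by (rule arg_cong[where f = sum_list]) simp

lemma map_fst_fl [simp]: "map fst (fl \<phi>) = ks"
  by (simp add: fl_def comp_def)

lemma fl_eq_iff: "fl \<phi> = fl \<psi> \<longleftrightarrow> (\<forall>e\<in>K. \<phi> e = \<psi> e)"
  by (auto simp: fl_def)

lemma sum_snd_fl: "sum_list (map snd (fl \<phi>)) = sum \<phi> K"
  unfolding fl_def sum.distinct_set_conv_list[OF dist(3)]
  by (rule arg_cong[where f = sum_list]) simp

lemma shift_fl: "shift e d (fl \<phi>) = fl (\<phi>(e := \<phi> e + d))"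
  by (auto simp: shift_def fl_def)

lemma lookup_fl: "e \<in> K \<Longrightarrow> lookup 0 (fl \<phi>) e = \<phi> e"
  unfolding fl_def
proof -
  assume e: "e \<in> K"
  have "fold (\<lambda>z a. if fst z = e then snd z else a) (map (\<lambda>e. (e, \<phi> e)) xs) a = (if e \<in> set xs then \<phi> e else a)" for xs a
    by (induction xs arbitrary: a) auto
  then show "lookup 0 (map (\<lambda>e. (e, \<phi> e)) ks) e = \<phi> e" using e by (simp add: lookup_def)
qed

lemma outf_upd:
  assumes "e \<in> K"
  shows "outf (\<phi>(e := \<phi> e + d)) u = outf \<phi> u + (if fst e = u then d else 0)"
proof -
  have "outf (\<phi>(e := \<phi> e + d)) u = (\<Sum>e'\<in>K. (if fst e' = u then \<phi> e' else 0) + (if e' = e then (if fst e = u then d else 0) else 0))"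
    unfolding outf_def by (rule sum.cong) auto
  then show ?thesis using assms by (simp add: sum.distrib outf_def)
qed

lemma inf_upd:
  assumes "e \<in> K"
  shows "inn (\<phi>(e := \<phi> e + d)) u = inn \<phi> u + (if snd e = u then d else 0)"
proof -
  have "inn (\<phi>(e := \<phi> e + d)) u = (\<Sum>e'\<in>K. (if snd e' = u then \<phi> e' else 0) + (if e' = e then (if snd e = u then d else 0) else 0))"
    unfolding inn_def by (rule sum.cong) auto
  then show ?thesis using assms by (simp add: sum.distrib inn_def)
qed

lemma sum_outf: "finite A \<Longrightarrow> sum (outf \<phi>) A = (\<Sum>e\<in>K. if fst e \<in> A then \<phi> e else 0)"
proof -
  assume A: "finite A"
  have "sum (outf \<phi>) A = (\<Sum>e\<in>K. \<Sum>u\<in>A. if fst e = u then \<phi> e else 0)"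
    unfolding outf_def by (rule sum.swap)
  also have "\<dots> = (\<Sum>e\<in>K. if fst e \<in> A then \<phi> e else 0)"
    by (intro sum.cong refl sum.delta'[OF A])
  finally show ?thesis .
qed

lemma sum_inf: "finite A \<Longrightarrow> sum (inn \<phi>) A = (\<Sum>e\<in>K. if snd e \<in> A then \<phi> e else 0)"
proof -
  assume A: "finite A"
  have "sum (inn \<phi>) A = (\<Sum>e\<in>K. \<Sum>u\<in>A. if snd e = u then \<phi> e else 0)"
    unfolding inn_def by (rule sum.swap)
  also have "\<dots> = (\<Sum>e\<in>K. if snd e \<in> A then \<phi> e else 0)"
    by (intro sum.cong refl sum.delta'[OF A])
  finally show ?thesis .
qed

lemma value_inf: "sum \<phi> K = sum (inn \<phi>) (set Q)"
proof -
  have "sum (inn \<phi>) (set Q) = (\<Sum>e\<in>K. if snd e \<in> set Q then \<phi> e else 0)"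
    by (rule sum_inf) simp
  also have "\<dots> = sum \<phi> K"
    by (rule sum.cong) (use ks in auto)
  finally show ?thesis ..
qed

section \<open>Feasible flows and the search for augmenting paths\<close>

definition feasible :: "(nat \<times> nat \<Rightarrow> int) \<Rightarrow> bool" where
  "feasible \<phi> \<longleftrightarrow> (\<forall>e\<in>K. 0 \<le> \<phi> e) \<and> (\<forall>u\<in>set P. outf \<phi> u \<le> cap u) \<and> (\<forall>v\<in>set Q. inn \<phi> v \<le> cap v)"

text \<open>The flow \<open>\<psi>\<close> has brought \<open>d\<close> units from \<open>s\<close>
  as far as \<open>x\<close>, where they wait to be sent on. For \<open>x\<close> in
  \<open>P\<close> this excess shows as an outflow reduced by \<open>d\<close>, for \<open>x\<close>
  in \<open>Q\<close> as an inflow raised by \<open>d\<close>; for \<open>x = s\<close> the two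
  corrections cancel.\<close>

definition pushed :: "(nat \<times> nat \<Rightarrow> int) \<Rightarrow> int \<Rightarrow> nat \<Rightarrow> (nat \<times> nat \<Rightarrow> int) \<Rightarrow> bool" where
  "pushed \<phi> d x \<psi> \<longleftrightarrow> (\<exists>s\<in>set P. outf \<phi> s + d \<le> cap s \<and>
     (\<forall>u\<in>set P. outf \<psi> u = outf \<phi> u + (if u = s then d else 0) - (if u = x then d else 0)) \<and>
     (\<forall>v\<in>set Q. inn \<psi> v = inn \<phi> v + (if v = x then d else 0)))"

text \<open>A stored flow may differ from \<open>\<phi>\<close> only on edges with both ends
  reached. On an edge with an unreached end it agrees with \<open>\<phi>\<close>, so the test that
  \<open>explore\<close> performs on the stored flow speaks about the residual network of
  \<open>\<phi>\<close>; \<open>cut_bound\<close> relies on this.\<close>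

definition reach_inv :: "(nat \<times> nat \<Rightarrow> int) \<Rightarrow> int \<Rightarrow> (nat \<times> flow) list \<Rightarrow> bool" where
  "reach_inv \<phi> d R \<longleftrightarrow> distinct (map fst R) \<and> set (sources P b d (fl \<phi>)) \<subseteq> set R \<and>
     (\<forall>z\<in>set R. fst z \<in> set P \<union> set Q \<and> (\<exists>\<psi>. snd z = fl \<psi> \<and> (\<forall>e\<in>K. 0 \<le> \<psi> e) \<and>
       (\<forall>e\<in>K. \<psi> e = \<phi> e \<or> fst e \<in> fst ` set R \<and> snd e \<in> fst ` set R) \<and> pushed \<phi> d (fst z) \<psi>))"

lemma reach_inv_sources:
  assumes "feasible \<phi>"
  shows "reach_inv \<phi> d (sources P b d (fl \<phi>))"
proof -
  have "pushed \<phi> d u \<phi>" if "u \<in> set P" "outf \<phi> u + d \<le> cap u" for u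
    using that disj unfolding pushed_def by (intro bexI[of _ u]) auto
  moreover have "map fst (sources P b d (fl \<phi>)) = filter (\<lambda>u. outf \<phi> u + d \<le> cap u) P"
    by (simp add: sources_def comp_def out_flow_fl)
  moreover have "\<exists>u. z = (u, fl \<phi>) \<and> u \<in> set P \<and> outf \<phi> u + d \<le> cap u"
    if "z \<in> set (sources P b d (fl \<phi>))" for z
    using that by (auto simp: sources_def out_flow_fl)
  moreover have "\<forall>e\<in>K. 0 \<le> \<phi> e" using assms by (simp add: feasible_def)
  ultimately show ?thesis
    unfolding reach_inv_def using dist(1) by fastforce
qed

lemma reach_inv_lookup:
  assumes "reach_inv \<phi> d R" "x \<in> fst ` set R"
  obtains \<psi> where "lookup [] R x = fl \<psi>" "\<forall>e\<in>K. 0 \<le> \<psi> e"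
    "\<forall>e\<in>K. \<psi> e = \<phi> e \<or> fst e \<in> fst ` set R \<and> snd e \<in> fst ` set R" "pushed \<phi> d x \<psi>"
proof -
  have "(x, lookup [] R x) \<in> set R" using lookup_mem[OF assms(2)] .
  then show thesis using assms(1) that unfolding reach_inv_def by fastforce
qed

text \<open>A forward step uses an unbounded edge and is always possible; a backward step asks for
  \<open>d\<close> units on the edge, so that the stored flow stays nonnegative.\<close>

lemma reach_inv_explore:
  assumes R: "reach_inv \<phi> d R" and e: "e \<in> K" and d: "0 \<le> d"
  shows "reach_inv \<phi> d (explore d e R)"
proof -
  have PQ: "fst e \<in> set P" "snd e \<in> set Q" "snd e \<notin> set P" "fst e \<notin> set Q" using subsetD[OF ks e] disj by (cases e; auto)+
  have extend: "reach_inv \<phi> d ((x, fl \<psi>) # R)"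
    if "x \<in> set P \<union> set Q" "x \<notin> fst ` set R" "\<forall>e\<in>K. 0 \<le> \<psi> e" "pushed \<phi> d x \<psi>"
      "\<forall>e\<in>K. \<psi> e = \<phi> e \<or> fst e \<in> insert x (fst ` set R) \<and> snd e \<in> insert x (fst ` set R)" for x \<psi>
    unfolding reach_inv_def
  proof (intro conjI ballI)
    fix z assume z: "z \<in> set ((x, fl \<psi>) # R)"
    show "fst z \<in> set P \<union> set Q" using z that(1) R unfolding reach_inv_def by auto
    show "\<exists>\<psi>. snd z = fl \<psi> \<and> (\<forall>e\<in>K. 0 \<le> \<psi> e) \<and>
       (\<forall>e\<in>K. \<psi> e = \<phi> e \<or> fst e \<in> fst ` set ((x, fl \<psi>') # R) \<and> snd e \<in> fst ` set ((x, fl \<psi>') # R)) \<and>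
       pushed \<phi> d (fst z) \<psi>" for \<psi>'
    proof (cases "z \<in> set R")
      case True
      then obtain \<chi> where "snd z = fl \<chi>" "\<forall>e\<in>K. 0 \<le> \<chi> e" "pushed \<phi> d (fst z) \<chi>"
        "\<forall>e\<in>K. \<chi> e = \<phi> e \<or> fst e \<in> fst ` set R \<and> snd e \<in> fst ` set R"
        using R unfolding reach_inv_def by blast
      then show ?thesis by (intro exI[of _ \<chi>]) auto
    next
      case False
      then show ?thesis using z that by (intro exI[of _ \<psi>]) auto
    qed
  qed (use R that in \<open>auto simp: reach_inv_def\<close>)
  consider (fwd) "fst e \<in> fst ` set R" "snd e \<notin> fst ` set R"
    | (bwd) "snd e \<in> fst ` set R" "fst e \<notin> fst ` set R" "d \<le> lookup 0 (lookup [] R (snd e)) e"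
    | (same) "explore d e R = R"
    by (cases "fst e \<in> fst ` set R"; cases "snd e \<in> fst ` set R";
        cases "d \<le> lookup 0 (lookup [] R (snd e)) e") (auto simp: explore_def)
  then show ?thesis
  proof cases
    case fwd
    obtain \<psi> where \<psi>: "lookup [] R (fst e) = fl \<psi>" "\<forall>e\<in>K. 0 \<le> \<psi> e"
      "\<forall>e\<in>K. \<psi> e = \<phi> e \<or> fst e \<in> fst ` set R \<and> snd e \<in> fst ` set R" "pushed \<phi> d (fst e) \<psi>"
      using reach_inv_lookup[OF R fwd(1)] by blast
    obtain s where s: "s \<in> set P" "outf \<phi> s + d \<le> cap s"
      "\<And>u. u \<in> set P \<Longrightarrow> outf \<psi> u = outf \<phi> u + (if u = s then d else 0) - (if u = fst e then d else 0)"
      "\<And>v. v \<in> set Q \<Longrightarrow> inn \<psi> v = inn \<phi> v + (if v = fst e then d else 0)"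
      using \<psi>(4) unfolding pushed_def by blast
    have p: "pushed \<phi> d (snd e) (\<psi>(e := \<psi> e + d))"
      unfolding pushed_def
    proof (intro bexI[of _ s] conjI ballI s(1,2))
      show "outf (\<psi>(e := \<psi> e + d)) u = outf \<phi> u + (if u = s then d else 0) - (if u = snd e then d else 0)"
        if "u \<in> set P" for u
        unfolding outf_upd[OF e] s(3)[OF that] using PQ that by auto
      show "inn (\<psi>(e := \<psi> e + d)) v = inn \<phi> v + (if v = snd e then d else 0)" if "v \<in> set Q" for v
        unfolding inf_upd[OF e] s(4)[OF that] using PQ that by auto
    qed
    have "reach_inv \<phi> d ((snd e, fl (\<psi>(e := \<psi> e + d))) # R)"
      by (rule extend) (use PQ fwd \<psi>(2,3) d p in auto)
    then show ?thesis using fwd by (simp add: explore_def \<psi>(1) shift_fl)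
  next
    case bwd
    obtain \<psi> where \<psi>: "lookup [] R (snd e) = fl \<psi>" "\<forall>e\<in>K. 0 \<le> \<psi> e"
      "\<forall>e\<in>K. \<psi> e = \<phi> e \<or> fst e \<in> fst ` set R \<and> snd e \<in> fst ` set R" "pushed \<phi> d (snd e) \<psi>"
      using reach_inv_lookup[OF R bwd(1)] by blast
    obtain s where s: "s \<in> set P" "outf \<phi> s + d \<le> cap s"
      "\<And>u. u \<in> set P \<Longrightarrow> outf \<psi> u = outf \<phi> u + (if u = s then d else 0) - (if u = snd e then d else 0)"
      "\<And>v. v \<in> set Q \<Longrightarrow> inn \<psi> v = inn \<phi> v + (if v = snd e then d else 0)"
      using \<psi>(4) unfolding pushed_def by blast
    have p: "pushed \<phi> d (fst e) (\<psi>(e := \<psi> e + (0 - d)))"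
      unfolding pushed_def
    proof (intro bexI[of _ s] conjI ballI s(1,2))
      show "outf (\<psi>(e := \<psi> e + (0 - d))) u = outf \<phi> u + (if u = s then d else 0) - (if u = fst e then d else 0)"
        if "u \<in> set P" for u
        unfolding outf_upd[OF e] s(3)[OF that] using PQ that by auto
      show "inn (\<psi>(e := \<psi> e + (0 - d))) v = inn \<phi> v + (if v = fst e then d else 0)" if "v \<in> set Q" for v
        unfolding inf_upd[OF e] s(4)[OF that] using PQ that by auto
    qed
    have "d \<le> \<psi> e" using bwd(3) by (simp add: \<psi>(1) lookup_fl[OF e])
    then have "reach_inv \<phi> d ((fst e, fl (\<psi>(e := \<psi> e + (0 - d)))) # R)"
      by (intro extend) (use PQ bwd \<psi>(2,3) d p in auto)
    then show ?thesis using bwd by (simp add: explore_def \<psi>(1) shift_fl)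
  next
    case same
    then show ?thesis using R by simp
  qed
qed

lemma reach_inv_fold:
  "reach_inv \<phi> d R \<Longrightarrow> set es \<subseteq> K \<Longrightarrow> 0 \<le> d \<Longrightarrow> reach_inv \<phi> d (fold (explore d) es R)"
  by (rule fold_invariant[where P = "reach_inv \<phi> d"]) (auto intro: reach_inv_explore)

lemma explore_grows: "explore d e R = R \<or> length R < length (explore d e R)"
  by (simp add: explore_def)

lemma length_reach_inv: "reach_inv \<phi> d R \<Longrightarrow> length R \<le> length (P @ Q)"
proof -
  assume R: "reach_inv \<phi> d R"
  have "length R = card (set (map fst R))" using R distinct_card[of "map fst R"] by (simp add: reach_inv_def)
  also have "\<dots> \<le> card (set (P @ Q))" using R by (intro card_mono) (auto simp: reach_inv_def)
  also have "\<dots> \<le> length (P @ Q)" by (rule card_length)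
  finally show ?thesis .
qed

text \<open>The reached vertices are distinct members of \<open>P @ Q\<close>, so
  \<open>length (P @ Q)\<close> sweeps saturate the search, and the result is closed under every
  single exploration step.\<close>

lemma reach_correct:
  assumes "feasible \<phi>" and d: "0 \<le> d"
  shows "reach_inv \<phi> d (reach P Q b d (fl \<phi>))"
    and "e \<in> K \<Longrightarrow> explore d e (reach P Q b d (fl \<phi>)) = reach P Q b d (fl \<phi>)"
proof -
  let ?f = "fold (explore d) ks" and ?R = "reach P Q b d (fl \<phi>)"
  have "reach_inv \<phi> d ((?f ^^ length (P @ Q)) (sources P b d (fl \<phi>))) \<and>
    ?f ((?f ^^ length (P @ Q)) (sources P b d (fl \<phi>))) = (?f ^^ length (P @ Q)) (sources P b d (fl \<phi>))"
  proof (rule saturate[where m = "\<lambda>R. int (length R)" and d = 1 and N = "int (length (P @ Q))"])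
    fix R assume R: "reach_inv \<phi> d R"
    show "reach_inv \<phi> d (?f R)" using reach_inv_fold[OF R _ d] by simp
    show "?f R \<noteq> R \<Longrightarrow> int (length R) + 1 \<le> int (length (?f R))"
      using fold_grows[of "explore d" length ks R] explore_grows by force
    show "int (length R) \<le> int (length (P @ Q))" using length_reach_inv[OF R] by linarith
  qed (use reach_inv_sources[OF assms(1)] in auto)
  then have *: "reach_inv \<phi> d ?R" "?f ?R = ?R" by (simp_all only: reach_def fold_const map_fst_fl)
  show "reach_inv \<phi> d ?R" by fact
  show "explore d e ?R = ?R" if "e \<in> K"
    using fold_grows[of "explore d" length ks ?R] explore_grows *(2) that by force
qed

section \<open>Vertex covers, cuts and duality\<close>

definition cover :: "nat set \<Rightarrow> bool" where
  "cover C \<longleftrightarrow> C \<subseteq> set P \<union> set Q \<and> (\<forall>e\<in>K. fst e \<in> C \<or> snd e \<in> C)"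

text \<open>The flow on every edge is charged to an endpoint in \<open>C\<close>, and no vertex is
  charged more than its capacity.\<close>

lemma weak_duality:
  assumes "feasible \<phi>" "cover C"
  shows "sum \<phi> K \<le> sum cap C"
proof -
  have "sum \<phi> K \<le> (\<Sum>e\<in>K. (if fst e \<in> set P \<inter> C then \<phi> e else 0) + (if snd e \<in> set Q \<inter> C then \<phi> e else 0))"
    using assms ks unfolding cover_def feasible_def by (intro sum_mono) fastforce
  also have "\<dots> = sum (outf \<phi>) (set P \<inter> C) + sum (inn \<phi>) (set Q \<inter> C)"
    by (simp add: sum.distrib sum_outf sum_inf)
  also have "\<dots> \<le> sum cap (set P \<inter> C) + sum cap (set Q \<inter> C)"
    using assms(1) unfolding feasible_def by (intro add_mono sum_mono) auto
  also have "\<dots> = sum cap C"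
    using assms(2) disj unfolding cover_def
    by (subst sum.union_disjoint[symmetric]) (auto intro!: sum.cong)
  finally show ?thesis .
qed

definition cut :: "int \<Rightarrow> (nat \<times> nat \<Rightarrow> int) \<Rightarrow> nat set" where
  "cut d \<phi> = (set P - fst ` set (reach P Q b d (fl \<phi>))) \<union> (set Q \<inter> fst ` set (reach P Q b d (fl \<phi>)))"

abbreviation total :: int where "total \<equiv> int (length ks + length P + length Q)"

text \<open>When no augmentation by \<open>d\<close> exists, the cut is almost tight: each of its
  vertices has less than \<open>d\<close> units to spare, and each edge with both ends in it carries
  less than \<open>d\<close>. Every vertex and edge contributes an error of at most
  \<open>d - 1\<close>, which vanishes for \<open>d = 1\<close>.\<close>

lemma cut_bound:
  assumes \<phi>: "feasible \<phi>" and d: "0 < d"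
    and no: "\<And>v. v \<in> set Q \<Longrightarrow> v \<in> fst ` set (reach P Q b d (fl \<phi>)) \<Longrightarrow> cap v < inn \<phi> v + d"
  shows "cover (cut d \<phi>)" "sum cap (cut d \<phi>) \<le> sum \<phi> K + total * (d - 1)"
proof -
  define R where "R = reach P Q b d (fl \<phi>)"
  define X where "X = fst ` set R"
  have R: "reach_inv \<phi> d R" "\<And>e. e \<in> K \<Longrightarrow> explore d e R = R"
    using reach_correct[OF \<phi>] d by (auto simp: R_def)
  have closed: "fst e \<in> X \<Longrightarrow> snd e \<in> X" if "e \<in> K" for e
    using R(2)[OF that] by (auto simp: explore_def X_def split: if_splits)
  have small: "\<phi> e < d" if e: "e \<in> K" "snd e \<in> X" "fst e \<notin> X" for e
  proof -
    obtain \<psi> where \<psi>: "lookup [] R (snd e) = fl \<psi>"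
      "\<forall>e\<in>K. \<psi> e = \<phi> e \<or> fst e \<in> fst ` set R \<and> snd e \<in> fst ` set R"
      using reach_inv_lookup[OF R(1)] e(2) unfolding X_def by blast
    \<comment> \<open>The end \<open>fst e\<close> is unreached, so the flow stored at
      \<open>snd e\<close> has not touched \<open>e\<close>; the backward step that failed on it
      then bounds \<open>\<phi> e\<close> itself.\<close>
    then have "\<psi> e = \<phi> e" using e unfolding X_def by blast
    moreover have "\<not> d \<le> lookup 0 (lookup [] R (snd e)) e"
      using R(2)[OF e(1)] e unfolding explore_def X_def by (auto split: if_splits)
    ultimately show ?thesis by (simp add: \<psi>(1) lookup_fl[OF e(1)])
  qed
  have src: "cap u < outf \<phi> u + d" if "u \<in> set P" "u \<notin> X" for u
  proof (rule ccontr)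
    assume "\<not> ?thesis"
    then have "(u, fl \<phi>) \<in> set (sources P b d (fl \<phi>))" using that by (auto simp: sources_def out_flow_fl)
    then show False using R(1) that unfolding reach_inv_def X_def by force
  qed
  have C: "cut d \<phi> = (set P - X) \<union> (set Q \<inter> X)" by (simp add: cut_def X_def R_def)
  show "cover (cut d \<phi>)" unfolding cover_def C using closed ks by auto
  have nn: "0 \<le> \<phi> e" if "e \<in> K" for e using \<phi> that by (simp add: feasible_def)
  have "sum cap (cut d \<phi>) = sum cap (set P - X) + sum cap (set Q \<inter> X)"
    unfolding C using disj by (intro sum.union_disjoint) auto
  also have "\<dots> \<le> (\<Sum>u\<in>set P - X. outf \<phi> u + (d - 1)) + (\<Sum>v\<in>set Q \<inter> X. inn \<phi> v + (d - 1))"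
  proof (intro add_mono sum_mono)
    show "cap u \<le> outf \<phi> u + (d - 1)" if "u \<in> set P - X" for u using src[of u] that by simp
    show "cap v \<le> inn \<phi> v + (d - 1)" if "v \<in> set Q \<inter> X" for v
      using no[of v] that by (simp add: X_def R_def)
  qed
  also have "\<dots> = (\<Sum>e\<in>K. (if fst e \<in> set P - X then \<phi> e else 0) + (if snd e \<in> set Q \<inter> X then \<phi> e else 0)) +
      int (card (set P - X)) * (d - 1) + int (card (set Q \<inter> X)) * (d - 1)"
    by (simp add: sum.distrib sum_outf sum_inf)
  also have "\<dots> \<le> (\<Sum>e\<in>K. \<phi> e + (d - 1)) + int (length P) * (d - 1) + int (length Q) * (d - 1)"
  proof (rule add_mono[OF add_mono[OF sum_mono mult_right_mono] mult_right_mono])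
    \<comment> \<open>An edge from outside \<open>X\<close> into \<open>X\<close> is counted at both
      ends; its second copy is paid for by \<open>d - 1\<close>.\<close>
    show "(if fst e \<in> set P - X then \<phi> e else 0) + (if snd e \<in> set Q \<inter> X then \<phi> e else 0) \<le> \<phi> e + (d - 1)"
      if "e \<in> K" for e
      using small[of e] nn[of e] d that by auto
    have "card (set P - X) \<le> card (set P)" "card (set Q \<inter> X) \<le> card (set Q)" by (auto intro: card_mono)
    then show "int (card (set P - X)) \<le> int (length P)" "int (card (set Q \<inter> X)) \<le> int (length Q)"
      using card_length[of P] card_length[of Q] by linarith+
  qed (use d in auto)
  also have "\<dots> = sum \<phi> K + total * (d - 1)"
    using distinct_card[OF dist(3)] unfolding sum.distrib by (simp add: algebra_simps)
  finally show "sum cap (cut d \<phi>) \<le> sum \<phi> K + total * (d - 1)" .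
qed

section \<open>Augmentation and capacity scaling\<close>

lemma pushed_feasible:
  assumes \<phi>: "feasible \<phi>" and v: "v \<in> set Q" "inn \<phi> v + d \<le> cap v" and d: "0 < d"
    and \<psi>: "pushed \<phi> d v \<psi>" "\<forall>e\<in>K. 0 \<le> \<psi> e"
  shows "feasible \<psi>" "sum \<psi> K = sum \<phi> K + d"
proof -
  obtain s where s: "s \<in> set P" "outf \<phi> s + d \<le> cap s"
    "\<forall>u\<in>set P. outf \<psi> u = outf \<phi> u + (if u = s then d else 0) - (if u = v then d else 0)"
    "\<forall>w\<in>set Q. inn \<psi> w = inn \<phi> w + (if w = v then d else 0)"
    using \<psi>(1) unfolding pushed_def by blast
  show "feasible \<psi>"
    using \<phi> \<psi>(2) s v disj d unfolding feasible_def by auto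
  have "sum (inn \<psi>) (set Q) = (\<Sum>w\<in>set Q. inn \<phi> w + (if w = v then d else 0))"
    using s(4) by (intro sum.cong) auto
  then show "sum \<psi> K = sum \<phi> K + d"
    using v(1) unfolding value_inf by (simp add: sum.distrib)
qed

lemma augment_cases:
  assumes \<phi>: "feasible \<phi>" and d: "0 < d"
  obtains (augmented) \<psi> where "augment P Q b d (fl \<phi>) = fl \<psi>" "feasible \<psi>" "sum \<psi> K = sum \<phi> K + d"
  | (stuck) "augment P Q b d (fl \<phi>) = fl \<phi>"
    "\<And>v. v \<in> set Q \<Longrightarrow> v \<in> fst ` set (reach P Q b d (fl \<phi>)) \<Longrightarrow> cap v < inn \<phi> v + d"
proof -
  define R where "R = reach P Q b d (fl \<phi>)"
  let ?c = "\<lambda>z. fst z \<in> set Q \<and> in_flow (fl \<phi>) (fst z) + d \<le> cap (fst z)"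
  have R: "reach_inv \<phi> d R" using reach_correct[OF \<phi>] d by (auto simp: R_def)
  have fold: "(fold (\<lambda>z F'. if ?c z then snd z else F') Rs F = F \<and> (\<forall>z\<in>set Rs. \<not> ?c z)) \<or>
      (\<exists>z\<in>set Rs. ?c z \<and> fold (\<lambda>z F'. if ?c z then snd z else F') Rs F = snd z)" for Rs F
  proof (induction Rs arbitrary: F)
    case (Cons z Rs)
    then show ?case using Cons[of "if ?c z then snd z else F"] by auto
  qed simp
  have aug: "augment P Q b d (fl \<phi>) = fold (\<lambda>z F'. if ?c z then snd z else F') R (fl \<phi>)"
    by (simp add: augment_def R_def)
  from fold[of R "fl \<phi>"] show thesis
  proof
    assume *: "fold (\<lambda>z F'. if ?c z then snd z else F') R (fl \<phi>) = fl \<phi> \<and> (\<forall>z\<in>set R. \<not> ?c z)"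
    show thesis by (rule stuck) (use * aug in \<open>fastforce simp: R_def in_flow_fl\<close>)+
  next
    assume "\<exists>z\<in>set R. ?c z \<and> fold (\<lambda>z F'. if ?c z then snd z else F') R (fl \<phi>) = snd z"
    then obtain z where z: "z \<in> set R" "?c z" "augment P Q b d (fl \<phi>) = snd z" using aug by auto
    then obtain \<psi> where \<psi>: "snd z = fl \<psi>" "\<forall>e\<in>K. 0 \<le> \<psi> e" "pushed \<phi> d (fst z) \<psi>"
      using R unfolding reach_inv_def by blast
    show thesis
      using augmented[of \<psi>] pushed_feasible[OF \<phi> _ _ d \<psi>(3,2)] z \<psi>(1) by (simp add: in_flow_fl)
  qed
qed

lemma augment_feasible:
  assumes "feasible \<phi>" "0 < d" obtains \<psi> where "augment P Q b d (fl \<phi>) = fl \<psi>" "feasible \<psi>"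
  using augment_cases[OF assms] assms(1) by metis

text \<open>A successful augmentation would raise the value by \<open>d\<close>, so at a fixed point
  the search was stuck and \<open>cut_bound\<close> applies.\<close>

lemma augment_fixed:
  assumes \<phi>: "feasible \<phi>" and d: "0 < d" and fixed: "augment P Q b d (fl \<phi>) = fl \<phi>"
  shows "cover (cut d \<phi>) \<and> sum cap (cut d \<phi>) \<le> sum \<phi> K + total * (d - 1)"
proof (cases rule: augment_cases[OF \<phi> d])
  case (1 \<psi>)
  then have "sum \<psi> K = sum \<phi> K" using fixed by (intro sum.cong) (auto simp: fl_eq_iff)
  then show ?thesis using 1 d by simp
next
  case 2
  then show ?thesis using cut_bound[OF \<phi> d] by blast
qed

text \<open>The cover \<open>C\<close> bounds the value of every feasible flow. The gap leaves room
  for \<open>2 * total\<close> augmentations by \<open>d\<close>, which is the length of the counter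
  in \<open>phase\<close>.\<close>

lemma phase_correct:
  assumes \<phi>: "feasible \<phi>" and d: "0 < d"
    and gap: "cover C" "sum cap C \<le> sum \<phi> K + total * (2 * d)"
  obtains \<psi> where "phase P Q b d (fl \<phi>) = fl \<psi>" "feasible \<psi>" "augment P Q b d (fl \<psi>) = fl \<psi>"
proof -
  let ?I = "\<lambda>F. \<exists>\<psi>. F = fl \<psi> \<and> feasible \<psi>"
  let ?f = "augment P Q b d" and ?n = "length ((map (\<lambda>z. fst (fst z)) (fl \<phi>) @ P @ Q) @ (map (\<lambda>z. fst (fst z)) (fl \<phi>) @ P @ Q))"
  have "?I ((?f ^^ ?n) (fl \<phi>)) \<and> ?f ((?f ^^ ?n) (fl \<phi>)) = (?f ^^ ?n) (fl \<phi>)"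
  proof (rule saturate[where m = "\<lambda>F. sum_list (map snd F)" and N = "sum cap C"])
    fix F assume "?I F"
    then obtain \<psi> where \<psi>: "F = fl \<psi>" "feasible \<psi>" by blast
    show "?I (?f F)" using augment_feasible[OF \<psi>(2) d] \<psi>(1) by metis
    show "?f F \<noteq> F \<Longrightarrow> sum_list (map snd F) + d \<le> sum_list (map snd (?f F))"
      using augment_cases[OF \<psi>(2) d] \<psi>(1) by (metis order_refl sum_snd_fl)
    show "sum_list (map snd F) \<le> sum cap C"
      using weak_duality[OF \<psi>(2) gap(1)] \<psi>(1) by (simp add: sum_snd_fl)
  next
    have "int ?n = 2 * total" by (simp add: fl_def)
    then have "int ?n * d = total * (2 * d)" by (metis mult.assoc mult.commute)
    then show "sum cap C \<le> sum_list (map snd (fl \<phi>)) + int ?n * d"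
      using gap(2) by (simp only: sum_snd_fl)
  qed (use \<phi> d in auto)
  moreover have "phase P Q b d (fl \<phi>) = (?f ^^ ?n) (fl \<phi>)" by (simp only: phase_def fold_const)
  ultimately show thesis using that by metis
qed

text \<open>The cut left by the phase with step \<open>2 ^ k\<close> is the cover that bounds the
  next phase: its gap \<open>total * (2 ^ k - 1)\<close> is at most \<open>total * 2 ^ k\<close>,
  that is, \<open>total\<close> times twice the next step.\<close>

lemma phases_correct:
  assumes "feasible \<phi>" "cover C" "sum cap C \<le> sum \<phi> K + total * 2 ^ k"
  shows "\<exists>\<psi>. fold (phase P Q b) (rev (map (\<lambda>i. 2 ^ i) [0..<k])) (fl \<phi>) = fl \<psi> \<and> feasible \<psi> \<and>
    (0 < k \<longrightarrow> augment P Q b 1 (fl \<psi>) = fl \<psi>)"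
  using assms
proof (induction k arbitrary: \<phi> C)
  case 0
  then show ?case by auto
next
  case (Suc k)
  obtain \<psi> where \<psi>: "phase P Q b (2 ^ k) (fl \<phi>) = fl \<psi>" "feasible \<psi>" "augment P Q b (2 ^ k) (fl \<psi>) = fl \<psi>"
    by (rule phase_correct[OF Suc.prems(1) _ Suc.prems(2), of "2 ^ k"]) (use Suc.prems(3) in auto)
  have fixed: "cover (cut (2 ^ k) \<psi>)" "sum cap (cut (2 ^ k) \<psi>) \<le> sum \<psi> K + total * (2 ^ k - 1)"
    using augment_fixed[OF \<psi>(2) _ \<psi>(3)] by auto
  have "total * (2 ^ k - 1) \<le> total * 2 ^ k" by (intro mult_left_mono) auto
  then have "\<exists>\<chi>. fold (phase P Q b) (rev (map (\<lambda>i. 2 ^ i) [0..<k])) (fl \<psi>) = fl \<chi> \<and> feasible \<chi> \<and>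
      (0 < k \<longrightarrow> augment P Q b 1 (fl \<chi>) = fl \<chi>)"
    using fixed by (intro Suc.IH[OF \<psi>(2)]) auto
  then show ?case using \<psi> by (cases k) auto
qed

lemma Least_power:
  assumes "1 \<le> W"
  shows "W < 2 ^ (LEAST k. W < (2::int) ^ k)" "0 < (LEAST k. W < (2::int) ^ k)"
proof -
  have "W < 2 ^ nat W"
  proof -
    have "int (nat W) < 2 ^ nat W" using of_nat_less_two_power by blast
    then show ?thesis using assms by simp
  qed
  then show 1: "W < 2 ^ (LEAST k. W < (2::int) ^ k)" by (rule LeastI)
  show "0 < (LEAST k. W < (2::int) ^ k)"
    using 1 assms by (cases "LEAST k. W < (2::int) ^ k") auto
qed

lemma sum_cap_P: "sum_list (map cap P) = sum cap (set P)"
  by (simp add: sum.distinct_set_conv_list[OF dist(1)])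

lemma feasible_zero: "feasible (\<lambda>_. 0)"
  using cap_nonneg by (simp add: feasible_def outf_def inn_def)

lemma max_flow_correct:
  obtains \<psi> where "max_flow P Q b ks = fl \<psi>" "feasible \<psi>" "augment P Q b 1 (fl \<psi>) = fl \<psi>"
proof -
  let ?W = "1 + sum_list (map cap P)"
  let ?k = "LEAST k. ?W < (2::int) ^ k"
  have W: "1 \<le> ?W" using cap_nonneg by (auto simp: sum_cap_P intro!: sum_nonneg)
  \<comment> \<open>The zero flow and the cover \<open>set P\<close> start the scaling. The factor
    \<open>total\<close> is at least 1 if \<open>P\<close> is nonempty; otherwise the sum is
    0.\<close>
  have "sum cap (set P) \<le> total * 2 ^ ?k"
  proof (cases "P = []")
    case False
    have "sum cap (set P) \<le> 1 * 2 ^ ?k" using Least_power(1)[OF W] sum_cap_P by linarith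
    also have "\<dots> \<le> total * 2 ^ ?k" using False by (intro mult_right_mono) (cases P, auto)
    finally show ?thesis .
  qed simp
  moreover have "cover (set P)" using ks by (auto simp: cover_def)
  moreover have "fl (\<lambda>_. 0) = map (\<lambda>e. (e, 0)) ks" by (simp add: fl_def)
  ultimately show thesis
    using phases_correct[OF feasible_zero, of "set P" ?k] Least_power(2)[OF W] that
    by (auto simp: max_flow_def powers_def)
qed

text \<open>For step 1 the error term vanishes, so the cut weighs no more than the flow and is a
  minimum cover. Independent sets are the complements of covers, which turns minimality into
  maximality.\<close>

theorem bip_indep_correct:
  shows "distinct (bip_indep P Q b ks)" "set (bip_indep P Q b ks) \<subseteq> set P \<union> set Q"
    "e \<in> K \<Longrightarrow> \<not> (fst e \<in> set (bip_indep P Q b ks) \<and> snd e \<in> set (bip_indep P Q b ks))"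
    "J \<subseteq> set P \<union> set Q \<Longrightarrow> (\<And>e. e \<in> K \<Longrightarrow> \<not> (fst e \<in> J \<and> snd e \<in> J)) \<Longrightarrow>
      sum cap J \<le> sum cap (set (bip_indep P Q b ks))"
proof -
  obtain \<psi> where \<psi>: "max_flow P Q b ks = fl \<psi>" "feasible \<psi>" "augment P Q b 1 (fl \<psi>) = fl \<psi>"
    by (rule max_flow_correct)
  have C: "cover (cut 1 \<psi>)" "sum cap (cut 1 \<psi>) \<le> sum \<psi> K"
    using augment_fixed[OF \<psi>(2) _ \<psi>(3)] by auto
  let ?I = "set (bip_indep P Q b ks)" and ?V = "set P \<union> set Q"
  have I: "?I = ?V - cut 1 \<psi>"
    using disj unfolding bip_indep_def \<psi>(1) cut_def by auto
  show "distinct (bip_indep P Q b ks)" using dist disj by (auto simp: bip_indep_def)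
  show "?I \<subseteq> ?V" using I by blast
  show "\<not> (fst e \<in> ?I \<and> snd e \<in> ?I)" if "e \<in> K" using C(1) I that unfolding cover_def by blast
  show "sum cap J \<le> sum cap ?I" if J: "J \<subseteq> ?V" "\<And>e. e \<in> K \<Longrightarrow> \<not> (fst e \<in> J \<and> snd e \<in> J)"
  proof -
    have "cover (?V - J)" using J(2) ks unfolding cover_def by fastforce
    then have "sum cap (cut 1 \<psi>) \<le> sum cap (?V - J)" using weak_duality[OF \<psi>(2)] C(2) by fastforce
    moreover have "sum cap (?V - J) = sum cap ?V - sum cap J" using J(1) by (simp add: sum_diff)
    moreover have "sum cap ?I = sum cap ?V - sum cap (cut 1 \<psi>)"
      unfolding I using C(1) by (simp add: sum_diff cover_def)
    ultimately show ?thesis by linarith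
  qed
qed

end

subsection \<open>Combining the parts\<close>

text \<open>Rebuilding the edges from the product of the colour classes orients them from the first
  class to the second and, for duplicate-free \<open>H\<close>, lists each of them once, whichever
  way round they stand in \<open>es\<close>.\<close>

definition solve_part :: "(nat \<times> nat) list \<Rightarrow> (nat \<times> int) list \<Rightarrow> colouring \<Rightarrow> nat list \<Rightarrow> nat list" where
  "solve_part es b C H =
     bip_indep (filter (\<lambda>v. \<not> col_of C v) H) (filter (\<lambda>v. col_of C v) H) b
       (filter (\<lambda>e. adj es (fst e) (snd e))
         (List.product (filter (\<lambda>v. \<not> col_of C v) H) (filter (\<lambda>v. col_of C v) H)))"

definition remaining :: "(nat \<times> nat) list \<Rightarrow> nat list \<Rightarrow> nat list \<Rightarrow> nat list" where
  "remaining es B X = filter (\<lambda>v. v \<notin> set X \<and> \<not> list_ex (\<lambda>u. adj es v u) X) B"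

text \<open>The empty list is the default for an \<open>X\<close> that is not independent. Forming
  the union by filtering the vertex list bounds its size and keeps it free of duplicates if that
  list is.\<close>

definition candidate :: "(nat \<times> nat) list \<Rightarrow> (nat \<times> int) list \<Rightarrow> nat list \<Rightarrow> nat list \<Rightarrow> nat list" where
  "candidate es b B X =
     (if list_all (\<lambda>u. list_all (\<lambda>v. \<not> adj es u v) X) X
      then filter (\<lambda>v. v \<in> set X \<or> v \<in> set (solve_part es b (two_colouring es B) (remaining es B X))) (map fst b)
      else [])"

definition weight :: "(nat \<times> int) list \<Rightarrow> nat list \<Rightarrow> int" where
  "weight b I = sum_list (map (\<lambda>v. lookup 0 b v) I)"

definition best_candidate :: "(nat \<times> nat) list \<Rightarrow> (nat \<times> int) list \<Rightarrow> nat list \<Rightarrow> nat list list \<Rightarrow> nat list" where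
  "best_candidate es b B Xs = fold (\<lambda>X I. if weight b I < weight b (candidate es b B X)
     then candidate es b B X else I) Xs []"

text \<open>Multiplying all weights by the product of their denominators makes them integral.\<close>

definition scaled_weights :: "(nat \<times> int \<times> int) list \<Rightarrow> (nat \<times> int) list" where
  "scaled_weights ws = filter (\<lambda>z. 0 < snd z)
     (map (\<lambda>z. (fst z, fst (snd z) * prod_list (map (\<lambda>y. if fst y = fst z then 1 else snd (snd y)) ws))) ws)"

text \<open>Vertices of nonpositive weight are already removed by \<open>scaled_weights\<close>;
  everything else happens in the subgraph induced by the others, where the bound on
  \<open>oct\<close> is still in force.\<close>

definition mwis :: "nat \<Rightarrow> (nat \<times> int \<times> int) list \<times> (nat \<times> nat) list \<Rightarrow> nat list" where
  "mwis p x = best_candidate (snd x) (scaled_weights (fst x))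
     (bipartite_part (2 * p + 1) (snd x) (map fst (scaled_weights (fst x))))
     (lists_upto p (map fst (scaled_weights (fst x))))"

subsection \<open>Correctness\<close>

lemma successively_nth: "successively A xs \<Longrightarrow> Suc i < length xs \<Longrightarrow> A (xs ! i) (xs ! Suc i)"
  by (induction A xs arbitrary: i rule: successively.induct) (auto simp: nth_Cons split: nat.splits)

lemma card_le_1I: "(\<And>x y. x \<in> A \<Longrightarrow> y \<in> A \<Longrightarrow> x = y) \<Longrightarrow> card A \<le> 1"
  by (cases "finite A") (auto simp: card_le_Suc0_iff_eq)

lemma clique_number_le:
  assumes "finite (verts G)" "\<And>A. clique G A \<Longrightarrow> card A \<le> k"
  shows "clique_number G \<le> k"
proof -
  have "{A. clique G A} \<subseteq> Pow (verts G)" by (auto simp: clique_def)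
  then have "finite {A. clique G A}" using assms(1) finite_subset by blast
  moreover have "{} \<in> {A. clique G A}" by (simp add: clique_def)
  ultimately show ?thesis unfolding clique_number_def by (subst Max_le_iff) (use assms(2) in auto)
qed

lemma oct_transversal:
  obtains S where "odd_cycle_transversal G S" "card S = oct G"
proof -
  have "odd_cycle_transversal G (verts G)"
    unfolding odd_cycle_transversal_def graph_cycle_def by (auto simp: Int_absorb1)
  then have "\<exists>k S. odd_cycle_transversal G S \<and> card S = k" by blast
  then have "\<exists>S. odd_cycle_transversal G S \<and> card S = oct G"
    unfolding oct_def by (rule LeastI_ex)
  then show thesis using that by blast
qed

lemma filter_colour_network:
  assumes "distinct H" "\<And>v. v \<in> set H \<Longrightarrow> 0 \<le> lookup 0 b v"
  shows "network (filter (\<lambda>v. \<not> col_of C v) H) (filter (\<lambda>v. col_of C v) H)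
     (filter (\<lambda>e. adj es (fst e) (snd e))
         (List.product (filter (\<lambda>v. \<not> col_of C v) H) (filter (\<lambda>v. col_of C v) H))) b"
  using assms by unfold_locales (auto intro: distinct_filter distinct_product)

text \<open>This isolates what the correctness proof takes from the class; \<open>p\<close> plays
  the role of \<open>f 3\<close>.\<close>

locale bounded_oct_graph =
  fixes G :: ugraph and es :: "(nat \<times> nat) list" and p :: nat
  assumes simple: "simple_graph G"
    and es: "set (map (\<lambda>(u, v). {u, v}) es) = edges G"
    and oct_le: "\<And>H. induced_subgraph H G \<Longrightarrow> clique_number H \<le> 3 \<Longrightarrow> oct H \<le> p"
begin

lemma adj_edge: "adj es u v \<longleftrightarrow> {u, v} \<in> edges G"
  unfolding es[symmetric] adj_iff by (force simp: doubleton_eq_iff)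

lemma loopless: "e \<in> set es \<Longrightarrow> fst e \<noteq> snd e"
proof
  assume e: "e \<in> set es" "fst e = snd e"
  have "(fst e, snd e) \<in> set es" using e(1) by simp
  then have "{fst e, snd e} \<in> edges G" unfolding adj_edge[symmetric] adj_iff by blast
  then show False using e(2) simple by (auto simp: simple_graph_def)
qed

text \<open>A path on an odd number of at least three vertices with adjacent ends is an odd cycle of
  \<open>H\<close> because \<open>H\<close> is induced, and inside \<open>verts H - S\<close> it
  would miss \<open>S\<close>.\<close>

lemma no_odd_cycle_minus_transversal:
  assumes H: "induced_subgraph H G" and S: "odd_cycle_transversal H S"
  shows "no_odd_cycle es (verts H - S)"
  unfolding no_odd_cycle_def
proof (intro allI impI notI)
  fix u v xs
  assume *: "walk (adj es) (verts H - S) u xs v \<and> odd (length xs) \<and> 3 \<le> length xs" and vu: "adj es v u"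
  have set: "set xs \<subseteq> verts H" using * by (auto simp: walk_def)
  have "graph_cycle H xs"
    unfolding graph_cycle_def
  proof (intro conjI allI impI)
    fix i assume i: "i < length xs"
    have "adj es (xs ! i) (xs ! (Suc i mod length xs))"
    proof (cases "Suc i < length xs")
      case True
      then show ?thesis using successively_nth[of "adj es" xs i] * unfolding walk_def by simp
    next
      \<comment> \<open>The last index wraps around to 0, where the edge in question is the closing
        one.\<close>
      case False
      then have "xs ! i = v" "xs ! (Suc i mod length xs) = u"
        using * i by (auto simp: walk_def last_conv_nth hd_conv_nth not_less_eq less_Suc_eq)
      then show ?thesis using vu by simp
    qed
    moreover have lt: "Suc i mod length xs < length xs"
      by (rule mod_less_divisor) (use i in linarith)
    moreover have "xs ! i \<in> verts H" "xs ! (Suc i mod length xs) \<in> verts H"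
      using set nth_mem[OF i] nth_mem[OF lt] by blast+
    ultimately show "{xs ! i, xs ! (Suc i mod length xs)} \<in> edges H"
      using H unfolding adj_edge induced_subgraph_def by auto
  qed (use * set in \<open>auto simp: walk_def\<close>)
  then have "S \<inter> set xs \<noteq> {}" using S * by (auto simp: odd_cycle_transversal_def)
  then show False using * by (auto simp: walk_def)
qed

text \<open>A larger \<open>J\<close> could be added to the bipartite part: the resulting graph has clique number at
  most 3, so that deleting \<open>p\<close> vertices makes it bipartite again.\<close>

lemma outside_bipartite_part:
  assumes V: "distinct V" "set V \<subseteq> verts G"
    and J: "J \<subseteq> set V" "J \<inter> set (bipartite_part (2 * p + 1) es V) = {}"
    and indep: "\<And>u v. u \<in> J \<Longrightarrow> v \<in> J \<Longrightarrow> \<not> adj es u v"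
  shows "card J \<le> p"
proof (rule ccontr)
  assume "\<not> card J \<le> p"
  then have "Suc p \<le> card J" by simp
  \<comment> \<open>Only \<open>p + 1\<close> vertices of \<open>J\<close> are used, so that the
    exchange below toggles at most \<open>2 * p + 1\<close> vertices.\<close>
  then obtain A where A: "A \<subseteq> J" "card A = Suc p" by (rule obtain_subset_with_card_n)
  define B where "B = bipartite_part (2 * p + 1) es V"
  define H where "H = (set B \<union> A, {e \<in> edges G. e \<subseteq> set B \<union> A})"
  have sb: "sublist_bip es V B" using bipartite_part_correct(1) by (simp add: B_def)
  then have B: "set B \<subseteq> set V" "distinct B" "bipartite_on es B"
    using V(1) by (auto simp: sublist_bip_def)
  have finA: "finite A" using A(2) card.infinite by fastforce
  have disj: "A \<inter> set B = {}" using A(1) J(2) by (auto simp: B_def)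
  have H: "induced_subgraph H G"
    using B(1) V(2) A(1) J(1) by (auto simp: H_def induced_subgraph_def)
  have "clique_number H \<le> 3"
  proof (rule clique_number_le)
    show "finite (verts H)" using finA by (simp add: H_def)
    fix K assume K: "clique H K"
    let ?c = "col_of (two_colouring es B)"
    have adj: "adj es x y" if "x \<in> K" "y \<in> K" "x \<noteq> y" for x y
      using K that unfolding clique_def adj_edge H_def by auto
    have "(K \<inter> A) \<union> {x \<in> K \<inter> set B. ?c x} \<union> {x \<in> K \<inter> set B. \<not> ?c x} = K"
      using K by (auto simp: clique_def H_def)
    moreover have "card ((K \<inter> A) \<union> {x \<in> K \<inter> set B. ?c x} \<union> {x \<in> K \<inter> set B. \<not> ?c x}) \<le>
        card (K \<inter> A) + card {x \<in> K \<inter> set B. ?c x} + card {x \<in> K \<inter> set B. \<not> ?c x}"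
      by (rule order_trans[OF card_Un_le add_right_mono[OF card_Un_le]])
    ultimately have "card K \<le> card (K \<inter> A) + card {x \<in> K \<inter> set B. ?c x} + card {x \<in> K \<inter> set B. \<not> ?c x}"
      by simp
    moreover have "card (K \<inter> A) \<le> 1"
      by (rule card_le_1I) (use adj indep A(1) in blast)
    moreover have "card {x \<in> K \<inter> set B. ?c x} \<le> 1"
      by (rule card_le_1I) (use adj bipartite_onD[OF B(3)] in blast)
    moreover have "card {x \<in> K \<inter> set B. \<not> ?c x} \<le> 1"
      by (rule card_le_1I) (use adj bipartite_onD[OF B(3)] in blast)
    ultimately show "card K \<le> 3" by linarith
  qed
  then have "oct H \<le> p" using oct_le[OF H] by blast
  then obtain S where S: "odd_cycle_transversal H S" "card S \<le> p" by (metis oct_transversal[of H])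
  then have SH: "S \<subseteq> set B \<union> A" by (simp add: odd_cycle_transversal_def H_def)
  then have finS: "finite S" using finA finite_subset by blast
  \<comment> \<open>Toggling \<open>X\<close> inserts \<open>A - S\<close> and removes
    \<open>set B \<inter> S\<close>, which turns \<open>B\<close> into the union of \<open>B\<close>
    and \<open>A\<close> without \<open>S\<close>.\<close>
  define X where "X = sorted_list_of_set ((A - S) \<union> (set B \<inter> S))"
  have setX: "set X = (A - S) \<union> (set B \<inter> S)" using finA by (simp add: X_def)
  let ?B = "filter (\<lambda>v. (v \<in> set B) \<noteq> (v \<in> set X)) V"
  have setB: "set ?B = (set B \<union> A) - S" using B(1) A(1) J(1) disj SH by (auto simp: setX)
  have "length X \<le> card A + card S"
  proof -
    have "length X = card ((A - S) \<union> (set B \<inter> S))" by (simp add: X_def)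
    also have "\<dots> \<le> card (A - S) + card (set B \<inter> S)" by (rule card_Un_le)
    also have "\<dots> \<le> card A + card S" using finA finS by (intro add_mono card_mono) auto
    finally show ?thesis .
  qed
  then have "length X \<le> 2 * p + 1" using A(2) S(2) by simp
  moreover have "set X \<subseteq> set V" using setX B(1) A(1) J(1) by auto
  ultimately have fixed: "improve es V X B = B"
    unfolding B_def by (intro bipartite_part_correct(2))
  have "card (set B \<union> A) = length B + Suc p"
    using disj finA A(2) distinct_card[OF B(2)] by (subst card_Un_disjoint) auto
  \<comment> \<open>At most \<open>p\<close> vertices are deleted from a set that has
    \<open>p + 1\<close> more elements than \<open>B\<close>.\<close>
  then have "length B < card ((set B \<union> A) - S)"
    using S(2) diff_card_le_card_Diff[OF finS, of "set B \<union> A"] by linarith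
  also have "\<dots> = length ?B" using V(1) by (subst setB[symmetric]) (rule distinct_card, simp)
  finally have len: "length B < length ?B" .
  have "no_odd_cycle es (set ?B)"
    using no_odd_cycle_minus_transversal[OF H S(1)] setB by (simp add: H_def)
  then have "bipartite_on es ?B" using bipartite_onI loopless by blast
  then have "improve es V X B = ?B" unfolding improve_def using len by (intro if_P conjI)
  then show False using fixed len by simp
qed

lemma solve_part_correct:
  fixes b :: "(nat \<times> int) list" and B :: "nat list"
  defines "C \<equiv> two_colouring es B"
  assumes B: "bipartite_on es B" "distinct B" and H: "set H \<subseteq> set B" "distinct H"
    and b: "\<And>v. v \<in> set H \<Longrightarrow> 0 \<le> lookup 0 b v"
  shows "set (solve_part es b C H) \<subseteq> set H"
    and "u \<in> set (solve_part es b C H) \<Longrightarrow> v \<in> set (solve_part es b C H) \<Longrightarrow> \<not> adj es u v"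
    and "J \<subseteq> set H \<Longrightarrow> (\<And>u v. u \<in> J \<Longrightarrow> v \<in> J \<Longrightarrow> \<not> adj es u v) \<Longrightarrow>
      sum (lookup 0 b) J \<le> sum (lookup 0 b) (set (solve_part es b C H))"
proof -
  let ?P = "filter (\<lambda>v. \<not> col_of C v) H" and ?Q = "filter (\<lambda>v. col_of C v) H"
  let ?ks = "filter (\<lambda>e. adj es (fst e) (snd e)) (List.product ?P ?Q)"
  have ks: "set ?ks = {(u, v). u \<in> set ?P \<and> v \<in> set ?Q \<and> adj es u v}" by auto
  interpret network ?P ?Q ?ks b by (rule filter_colour_network[OF H(2) b])
  have sol: "solve_part es b C H = bip_indep ?P ?Q b ?ks" by (simp add: solve_part_def)
  have PQ: "set ?P \<union> set ?Q = set H" by auto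
  show sub: "set (solve_part es b C H) \<subseteq> set H" using bip_indep_correct(2) sol PQ by simp
  show "\<not> adj es u v" if u: "u \<in> set (solve_part es b C H)" and v: "v \<in> set (solve_part es b C H)"
  proof
    assume a: "adj es u v"
    then have "col_of C u \<noteq> col_of C v"
      unfolding C_def using bipartite_onD[OF B(1)] u v sub H(1) by blast
    moreover have "u \<in> set H" "v \<in> set H" using sub u v by blast+
    ultimately have "(u, v) \<in> set ?ks \<or> (v, u) \<in> set ?ks"
      using a adj_sym[of es u v] unfolding ks by (cases "col_of C u") auto
    then show False using bip_indep_correct(3) u v sol by fastforce
  qed
  show "sum (lookup 0 b) J \<le> sum (lookup 0 b) (set (solve_part es b C H))"
    if "J \<subseteq> set H" "\<And>u v. u \<in> J \<Longrightarrow> v \<in> J \<Longrightarrow> \<not> adj es u v"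
    unfolding sol by (rule bip_indep_correct(4)) (use that PQ ks in auto)
qed

end

section \<open>Optimality of the best candidate\<close>

lemma best_candidate_cases:
  "best_candidate es b B Xs = [] \<or> (\<exists>X\<in>set Xs. best_candidate es b B Xs = candidate es b B X)"
  unfolding best_candidate_def
  by (rule fold_invariant[where P = "\<lambda>I. I = [] \<or> (\<exists>X\<in>set Xs. I = candidate es b B X)"]) auto

lemma best_candidate_max:
  "X \<in> set Xs \<Longrightarrow> weight b (candidate es b B X) \<le> weight b (best_candidate es b B Xs)"
  unfolding best_candidate_def
proof (induction Xs rule: rev_induct)
  case (snoc Y Xs)
  then show ?case by (auto simp: not_less intro: order_trans less_imp_le)
qed simp

lemma weight_sum: "distinct I \<Longrightarrow> weight b I = sum (lookup 0 b) (set I)"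
  by (simp add: weight_def sum.distinct_set_conv_list)

locale weighted_instance = bounded_oct_graph +
  fixes V :: "nat list" and c :: "nat \<Rightarrow> int"
  assumes V: "distinct V" "set V \<subseteq> verts G" and c: "\<And>v. v \<in> set V \<Longrightarrow> 0 < c v"
begin

abbreviation b :: "(nat \<times> int) list" where "b \<equiv> tabulate V c"
abbreviation B :: "nat list" where "B \<equiv> bipartite_part (2 * p + 1) es V"

lemma map_fst_b [simp]: "map fst b = V"
  by (simp add: comp_def)

lemma lookup_b: "v \<in> set V \<Longrightarrow> lookup 0 b v = c v"
  by (simp add: lookup_map)

lemma B_facts: "set B \<subseteq> set V" "distinct B" "bipartite_on es B"
  using bipartite_part_correct(1)[of es V "2 * p + 1"] V(1) by (auto simp: sublist_bip_def)

lemma remaining_facts: "set (remaining es B X) \<subseteq> set B" "distinct (remaining es B X)"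
  "\<And>v. v \<in> set (remaining es B X) \<Longrightarrow> 0 \<le> lookup 0 b v"
  using B_facts c by (auto simp: remaining_def lookup_b less_imp_le subset_iff)

lemma solve:
  defines "S \<equiv> \<lambda>X. set (solve_part es b (two_colouring es B) (remaining es B X))"
  shows "S X \<subseteq> set (remaining es B X)"
    and "u \<in> S X \<Longrightarrow> v \<in> S X \<Longrightarrow> \<not> adj es u v"
    and "J \<subseteq> set (remaining es B X) \<Longrightarrow> (\<And>u v. u \<in> J \<Longrightarrow> v \<in> J \<Longrightarrow> \<not> adj es u v) \<Longrightarrow>
      sum (lookup 0 b) J \<le> sum (lookup 0 b) (S X)"
proof -
  have nonneg: "\<And>v. v \<in> set (remaining es B X) \<Longrightarrow> 0 \<le> lookup 0 b v"
    by (rule remaining_facts(3))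
  note * = solve_part_correct[OF B_facts(3,2) remaining_facts(1,2)]
  show "S X \<subseteq> set (remaining es B X)"
    unfolding S_def by (rule *(1), rule nonneg)
  show "u \<in> S X \<Longrightarrow> v \<in> S X \<Longrightarrow> \<not> adj es u v"
    unfolding S_def by (rule *(2), rule nonneg)
  show "J \<subseteq> set (remaining es B X) \<Longrightarrow> (\<And>u v. u \<in> J \<Longrightarrow> v \<in> J \<Longrightarrow> \<not> adj es u v) \<Longrightarrow>
      sum (lookup 0 b) J \<le> sum (lookup 0 b) (S X)"
    unfolding S_def by (rule *(3), rule nonneg)
qed

text \<open>Edges inside \<open>X\<close> are excluded by the test in \<open>candidate\<close>,
  edges inside the solved part by \<open>solve\<close>, and edges between the two by
  \<open>remaining\<close>.\<close>

lemma candidate_indep: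
  assumes X: "set X \<subseteq> set V" and u: "u \<in> set (candidate es b B X)" and v: "v \<in> set (candidate es b B X)"
  shows "\<not> adj es u v"
proof -
  let ?S = "set (solve_part es b (two_colouring es B) (remaining es B X))"
  have indep: "\<And>u v. u \<in> set X \<Longrightarrow> v \<in> set X \<Longrightarrow> \<not> adj es u v"
    and uv: "u \<in> set X \<union> ?S" "v \<in> set X \<union> ?S"
    using u v by (auto simp: candidate_def list_all_iff split: if_splits)
  have "\<not> adj es x y" "\<not> adj es y x" if "x \<in> ?S" "y \<in> set X" for x y
  proof -
    have "x \<in> set (remaining es B X)" using solve(1)[of X] that(1) by blast
    then show "\<not> adj es x y" using that(2) by (simp add: remaining_def list_ex_iff)
    then show "\<not> adj es y x" by (simp add: adj_sym)
  qed
  then show ?thesis using uv indep solve(2)[of u X v] by blast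
qed

lemma best_candidate_indep:
  "set (best_candidate es b B (lists_upto p V)) \<subseteq> set V"
  "distinct (best_candidate es b B (lists_upto p V))"
  "u \<in> set (best_candidate es b B (lists_upto p V)) \<Longrightarrow> v \<in> set (best_candidate es b B (lists_upto p V)) \<Longrightarrow> \<not> adj es u v"
proof -
  consider "best_candidate es b B (lists_upto p V) = []"
    | X where "set X \<subseteq> set V" "best_candidate es b B (lists_upto p V) = candidate es b B X"
    using best_candidate_cases[of es b B "lists_upto p V"] by (auto simp: set_lists_upto)
  note cases = this
  show "set (best_candidate es b B (lists_upto p V)) \<subseteq> set V"
    by (cases rule: cases) (auto simp: candidate_def split: if_splits)
  show "distinct (best_candidate es b B (lists_upto p V))"
    by (cases rule: cases) (use V(1) in \<open>auto simp: candidate_def comp_def\<close>)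
  show "\<not> adj es u v" if "u \<in> set (best_candidate es b B (lists_upto p V))"
    "v \<in> set (best_candidate es b B (lists_upto p V))"
    by (cases rule: cases) (use that candidate_indep in auto)
qed

text \<open>The enumeration meets \<open>X = J - set B\<close>, which has at most \<open>p\<close>
  elements. The rest of \<open>J\<close> lies in \<open>B\<close> without neighbours in
  \<open>X\<close>, so it competes in the bipartite problem that \<open>candidate\<close> solves to
  optimality.\<close>

lemma best_candidate_optimal:
  assumes J: "J \<subseteq> set V" and indep: "\<And>u v. u \<in> J \<Longrightarrow> v \<in> J \<Longrightarrow> \<not> adj es u v"
  shows "sum c J \<le> sum c (set (best_candidate es b B (lists_upto p V)))"
proof -
  have finJ: "finite J" using J finite_subset by blast
  define X where "X = sorted_list_of_set (J - set B)"
  have X: "set X = J - set B" "distinct X" using finJ by (simp_all add: X_def)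
  have "card (J - set B) \<le> p"
    by (rule outside_bipartite_part[OF V]) (use J indep in auto)
  then have "X \<in> set (lists_upto p V)" using X J distinct_card[OF X(2)] by (auto simp: set_lists_upto)
  then have le: "weight b (candidate es b B X) \<le> weight b (best_candidate es b B (lists_upto p V))"
    by (rule best_candidate_max)
  let ?S = "set (solve_part es b (two_colouring es B) (remaining es B X))"
  have S: "?S \<subseteq> set B" "?S \<subseteq> set V" using solve(1)[of X] remaining_facts(1) B_facts(1) by blast+
  have rem: "J \<inter> set B \<subseteq> set (remaining es B X)"
    using indep X(1) by (auto simp: remaining_def list_ex_iff)
  have ind: "list_all (\<lambda>u. list_all (\<lambda>v. \<not> adj es u v) X) X"
    using indep X(1) by (auto simp: list_all_iff)
  have cand: "candidate es b B X = filter (\<lambda>v. v \<in> set X \<or> v \<in> ?S) V"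
    unfolding candidate_def map_fst_b using ind by simp
  have setc: "set (candidate es b B X) = (J - set B) \<union> ?S" "distinct (candidate es b B X)"
    unfolding cand using X(1) J S(2) V(1) by auto
  have "sum c J = sum c (J - set B) + sum c (J \<inter> set B)"
    using finJ by (metis add.commute sum.Int_Diff)
  also have "sum c (J \<inter> set B) = sum (lookup 0 b) (J \<inter> set B)"
    using J by (intro sum.cong) (auto simp: lookup_b)
  also have "\<dots> \<le> sum (lookup 0 b) ?S"
    by (rule solve(3)[OF rem]) (use indep in auto)
  also have "\<dots> = sum c ?S" using S(2) by (intro sum.cong) (auto simp: lookup_b)
  also have "sum c (J - set B) + sum c ?S = sum c (set (candidate es b B X))"
    unfolding setc(1) using finJ S(1) by (intro sum.union_disjoint[symmetric]) auto
  also have "\<dots> = weight b (candidate es b B X)"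
  proof -
    have "set (candidate es b B X) \<subseteq> set V" unfolding setc(1) using S(2) J by blast
    then show ?thesis
      unfolding weight_sum[OF setc(2)] by (intro sum.cong refl lookup_b[symmetric]) blast
  qed
  also have "\<dots> \<le> weight b (best_candidate es b B (lists_upto p V))" by (rule le)
  also have "\<dots> = sum c (set (best_candidate es b B (lists_upto p V)))"
    unfolding weight_sum[OF best_candidate_indep(2)] using best_candidate_indep(1)
    by (intro sum.cong) (auto simp: lookup_b subset_iff)
  finally show ?thesis by simp
qed

end

section \<open>Integral weights\<close>

definition scale :: "(nat \<Rightarrow> rat) \<Rightarrow> nat list \<Rightarrow> nat \<Rightarrow> int" where
  "scale w vs v = fst (quotient_of (w v)) * prod_list (map (\<lambda>u. if u = v then 1 else snd (quotient_of (w u))) vs)"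

definition common_denom :: "(nat \<Rightarrow> rat) \<Rightarrow> nat list \<Rightarrow> int" where
  "common_denom w vs = prod_list (map (\<lambda>u. snd (quotient_of (w u))) vs)"

lemma common_denom_pos: "0 < common_denom w vs"
  unfolding common_denom_def using quotient_of_denom_pos' by (induction vs) auto

lemma prod_list_remove:
  fixes f :: "nat \<Rightarrow> int"
  shows "distinct vs \<Longrightarrow> v \<in> set vs \<Longrightarrow> f v * prod_list (map (\<lambda>u. if u = v then 1 else f u) vs) = prod_list (map f vs)"
proof (induction vs)
  case (Cons a vs)
  show ?case
  proof (cases "a = v")
    case True
    then have m: "map (\<lambda>u. if u = v then 1 else f u) vs = map f vs" using Cons.prems by auto
    show ?thesis unfolding list.map prod_list.Cons m using True by simp
  next
    case False
    then show ?thesis using Cons by (simp add: mult.left_commute)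
  qed
qed simp

text \<open>Programs have no division. Multiplying the numerator of \<open>w v\<close> by the
  denominators of all other vertices has the effect of multiplying \<open>w v\<close> by one factor
  common to all vertices, and that factor is positive.\<close>

lemma of_int_scale:
  assumes "distinct vs" "v \<in> set vs"
  shows "of_int (scale w vs v) = w v * (of_int (common_denom w vs) :: rat)"
proof -
  obtain a d where q: "quotient_of (w v) = (a, d)" by force
  then have w: "w v = of_int a / of_int d" "d > 0" using quotient_of_div quotient_of_denom_pos by auto
  define m where "m = prod_list (map (\<lambda>u. if u = v then 1 else snd (quotient_of (w u))) vs)"
  have "d * m = common_denom w vs"
    using prod_list_remove[OF assms, of "\<lambda>u. snd (quotient_of (w u))"] by (simp add: q common_denom_def m_def)
  then have "w v * of_int (common_denom w vs) = of_int a / of_int d * (of_int d * of_int m)"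
    unfolding w(1) by (metis of_int_mult)
  also have "\<dots> = of_int (a * m)" using w(2) by simp
  also have "a * m = scale w vs v" by (simp add: scale_def q m_def)
  finally show ?thesis ..
qed

lemma scaled_weights_tabulate:
  "scaled_weights (map (\<lambda>v. (v, quotient_of (w v))) vs) =
    tabulate (filter (\<lambda>v. 0 < scale w vs v) vs) (scale w vs)"
proof -
  have *: "map (\<lambda>z. (fst z, fst (snd z) * prod_list (map (\<lambda>y. if fst y = fst z then 1 else snd (snd y)) (map (\<lambda>v. (v, quotient_of (w v))) vs))))
      (map (\<lambda>v. (v, quotient_of (w v))) vs) = tabulate vs (scale w vs)"
    by (simp add: scale_def comp_def cong: if_cong)
  show ?thesis unfolding scaled_weights_def * by (simp add: filter_map comp_def)
qed

context bounded_oct_graph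
begin

text \<open>Scaling by a common positive factor preserves comparisons between sets. A competing set
  \<open>J\<close> is first cut down to \<open>V\<close>, the vertices of positive weight, by which
  its weight does not decrease.\<close>

theorem mwis_correct:
  fixes w :: "nat \<Rightarrow> rat"
  assumes vs: "distinct vs" "set vs = verts G"
  defines "I \<equiv> mwis p (map (\<lambda>v. (v, quotient_of (w v))) vs, es)"
  shows "distinct I" "max_weight_indep_set G w (set I)"
proof -
  define V where "V = filter (\<lambda>v. 0 < scale w vs v) vs"
  interpret weighted_instance G es p V "scale w vs"
    by unfold_locales (use vs in \<open>auto simp: V_def\<close>)
  have I: "I = best_candidate es b B (lists_upto p V)"
    unfolding I_def mwis_def fst_conv snd_conv scaled_weights_tabulate V_def[symmetric] map_fst_b ..
  show "distinct I" unfolding I by (rule best_candidate_indep(2))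
  let ?D = "of_int (common_denom w vs) :: rat"
  have D: "?D > 0" using common_denom_pos by simp
  have pos: "0 < w v \<longleftrightarrow> v \<in> set V" if "v \<in> verts G" for v
  proof -
    have "0 < scale w vs v \<longleftrightarrow> 0 < w v * ?D"
      using of_int_scale[OF vs(1), of v w] that vs(2) of_int_0_less_iff[of "scale w vs v", where 'a = rat] by simp
    then show ?thesis using D that vs(2) by (simp add: V_def zero_less_mult_iff)
  qed
  have scale_sum: "of_int (sum (scale w vs) A) = sum w A * ?D" if "A \<subseteq> verts G" for A
    unfolding of_int_sum sum_distrib_right using that vs by (intro sum.cong) (auto simp: of_int_scale)
  have IV: "set I \<subseteq> set V" "set I \<subseteq> verts G" using best_candidate_indep(1) I V(2) by auto
  show "max_weight_indep_set G w (set I)"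
    unfolding max_weight_indep_set_def indep_set_def
  proof (intro conjI allI impI ballI)
    show "set I \<subseteq> verts G" by (rule IV)
    show "{u, v} \<notin> edges G" if "u \<in> set I" "v \<in> set I" for u v
      using best_candidate_indep(3) that unfolding I adj_edge[symmetric] by blast
    fix J assume J: "J \<subseteq> verts G \<and> (\<forall>u\<in>J. \<forall>v\<in>J. {u, v} \<notin> edges G)"
    have finJ: "finite J" using J simple finite_subset by (auto simp: simple_graph_def)
    have "sum (scale w vs) (J \<inter> set V) \<le> sum (scale w vs) (set I)"
      unfolding I by (rule best_candidate_optimal) (use J adj_edge in auto)
    then have "(of_int (sum (scale w vs) (J \<inter> set V)) :: rat) \<le> of_int (sum (scale w vs) (set I))"
      by (simp only: of_int_le_iff)
    moreover have "J \<inter> set V \<subseteq> verts G" using J by blast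
    ultimately have "sum w (J \<inter> set V) * ?D \<le> sum w (set I) * ?D"
      using scale_sum[of "J \<inter> set V"] scale_sum[OF IV(2)] by simp
    then have le: "sum w (J \<inter> set V) \<le> sum w (set I)" using D by simp
    have "sum w J = sum w (J \<inter> set V) + sum w (J - set V)"
      using finJ by (simp add: sum.Int_Diff)
    also have "sum w (J - set V) \<le> 0"
    proof (rule sum_nonpos)
      show "w v \<le> 0" if "v \<in> J - set V" for v
        using pos[of v] that J by (auto simp: not_less[symmetric])
    qed
    finally show "sum w J \<le> sum w (set I)" using le by linarith
  qed
qed

end

section \<open>Running time\<close>

subsection \<open>Colouring and local search\<close>

lemma pt_quaternary:
  assumes "poly_time_on UNIV (\<lambda>z. h (fst z) (fst (snd z)) (fst (snd (snd z))) (snd (snd (snd z))))"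
    "poly_time_on D f" "poly_time_on D g" "poly_time_on D k" "poly_time_on D l"
  shows "poly_time_on D (\<lambda>x. h (f x) (g x) (k x) (l x))"
  using pt_comp[OF assms(1) pt_Pair[OF assms(2) pt_Pair[OF assms(3) pt_Pair[OF assms(4,5)]]]] by simp

lemma pt_adj [pt_intros]:
  "poly_time_on D f \<Longrightarrow> poly_time_on D g \<Longrightarrow> poly_time_on D k \<Longrightarrow> poly_time_on D (\<lambda>x. adj (f x) (g x) (k x))"
  by (rule pt_ternary[where h = adj]) (unfold adj_def, intro pt_intros)

lemma pt_comp_of [pt_intros]:
  "poly_time_on D f \<Longrightarrow> poly_time_on D g \<Longrightarrow> poly_time_on D (\<lambda>x. comp_of (f x) (g x))"
  unfolding comp_of_def by (intro pt_intros)

lemma pt_col_of [pt_intros]: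
  "poly_time_on D f \<Longrightarrow> poly_time_on D g \<Longrightarrow> poly_time_on D (\<lambda>x. col_of (f x) (g x))"
  unfolding col_of_def by (intro pt_intros)

lemma pt_merge [pt_intros]:
  "poly_time_on D f \<Longrightarrow> poly_time_on D g \<Longrightarrow> poly_time_on D (\<lambda>x. merge (f x) (g x))"
  by (rule pt_binary[where h = merge]) (unfold merge_def, intro pt_intros)

lemma pt_edges_within [pt_intros]:
  "poly_time_on D f \<Longrightarrow> poly_time_on D g \<Longrightarrow> poly_time_on D (\<lambda>x. edges_within (f x) (g x))"
  by (rule pt_binary[where h = edges_within]) (unfold edges_within_def, intro pt_intros)

text \<open>Component names are always taken from the vertices in \<open>B\<close>, so merging
  creates no new numbers; this bounds the size of all intermediate colourings.\<close>

lemma pt_two_colouring [pt_intros]: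
  "poly_time_on D f \<Longrightarrow> poly_time_on D g \<Longrightarrow> poly_time_on D (\<lambda>x. two_colouring (f x) (g x))"
proof (erule (1) pt_binary[where h = two_colouring, rotated])
  let ?D = "UNIV :: ((nat \<times> nat) list \<times> nat list) set"
  show "poly_time_on ?D (\<lambda>z. two_colouring (fst z) (snd z))"
    unfolding two_colouring_def
  proof (rule pt_fold[where M = "\<lambda>x. 1 + sz (snd x) * (1 + (2 * sz (snd x) + 4))"
        and Inv = "\<lambda>x C. \<exists>c. C = tabulate (snd x) c \<and> (\<forall>v\<in>set (snd x). fst (c v) \<in> set (snd x))"])
    fix x :: "(nat \<times> nat) list \<times> nat list" and e and C :: colouring
    let ?B = "snd x"
    show "\<exists>c :: nat \<Rightarrow> nat \<times> bool. tabulate ?B (\<lambda>v. (v, False)) = tabulate ?B c \<and> (\<forall>v\<in>set ?B. fst (c v) \<in> set ?B)"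
      by (intro exI[of _ "\<lambda>v. (v, False)"]) auto
    assume "\<exists>c. C = tabulate ?B c \<and> (\<forall>v\<in>set ?B. fst (c v) \<in> set ?B)"
    then obtain c where c: "C = tabulate ?B c" "\<forall>v\<in>set ?B. fst (c v) \<in> set ?B" by blast
    show "\<exists>c. merge e C = tabulate ?B c \<and> (\<forall>v\<in>set ?B. fst (c v) \<in> set ?B)"
      if "e \<in> set (edges_within (fst x) ?B)"
      using merge_tabulate[of e ?B c] merge_fun_in[of e ?B c] c that by (auto simp: edges_within_def)
    show "sz C \<le> 1 + sz ?B * (1 + (2 * sz ?B + 4))"
      unfolding c(1)
    proof (rule sz_list_le)
      show "length (tabulate ?B c) \<le> sz ?B" using length_le_sz[of ?B] by simp
      fix y assume "y \<in> set (tabulate ?B c)"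
      then obtain v where v: "v \<in> set ?B" "y = (v, c v)" by auto
      have "sz v < sz ?B" "sz (fst (c v)) < sz ?B" using sz_list_mem v(1) c(2) by blast+
      moreover have "sz (snd (c v)) \<le> 2" unfolding enc_simps by (rule vsize_of_bool)
      ultimately show "sz y \<le> 2 * sz ?B + 4" unfolding v(2) by (simp add: enc_pair[of "c v"])
    qed
  qed (auto intro!: pt_intros pbdd_intros pbdd_sz_pt)
qed

lemma pt_bipartite_on [pt_intros]:
  "poly_time_on D f \<Longrightarrow> poly_time_on D g \<Longrightarrow> poly_time_on D (\<lambda>x. bipartite_on (f x) (g x))"
  by (rule pt_binary[where h = bipartite_on]) (unfold bipartite_on_def, intro pt_intros)

lemma pt_improve [pt_intros]:
  "poly_time_on D f \<Longrightarrow> poly_time_on D g \<Longrightarrow> poly_time_on D k \<Longrightarrow> poly_time_on D l \<Longrightarrow>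
   poly_time_on D (\<lambda>x. improve (f x) (g x) (k x) (l x))"
  by (rule pt_quaternary[where h = improve]) (unfold improve_def, intro pt_intros)

text \<open>Here \<open>k\<close> is a constant and not part of the input: the induction yields a
  program and a polynomial for each \<open>k\<close> separately. The values used are
  \<open>p\<close> and \<open>2 * p + 1\<close>.\<close>

lemma pt_lists_upto [pt_intros]:
  fixes f :: "_ \<Rightarrow> 'a::encodable list"
  shows "poly_time_on D f \<Longrightarrow> poly_time_on D (\<lambda>x. lists_upto k (f x))"
proof (erule pt_unary[where h = "lists_upto k", rotated])
  show "poly_time_on UNIV (lists_upto k :: 'a list \<Rightarrow> 'a list list)"
  proof (induction k)
    case 0
    then show ?case by (simp add: pt_const)
  next
    case (Suc k)
    have "poly_time_on UNIV (\<lambda>V :: 'a list. [] # concat (map (\<lambda>v. map (\<lambda>xs. v # xs) (lists_upto k V)) V))"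
      by (intro pt_intros pt_unary[OF Suc])
    then show ?case by simp
  qed
qed

lemma improve_filter: "(\<exists>P. B = filter P V) \<Longrightarrow> \<exists>P. improve es V X B = filter P V"
  by (auto simp: improve_def)

text \<open>The starting list is arbitrary here, so the invariant allows it to be still unchanged or
  already replaced by a sublist of \<open>V\<close>.\<close>

lemma pt_improve_all:
  "poly_time_on UNIV (\<lambda>z :: (nat \<times> nat) list \<times> nat list \<times> nat list.
    fold (improve (fst z) (fst (snd z))) (lists_upto k (fst (snd z))) (snd (snd z)))"
proof (rule pt_fold[where M = "\<lambda>z. sz z"
      and Inv = "\<lambda>z B. B = snd (snd z) \<or> (\<exists>P. B = filter P (fst (snd z)))"])
  fix z :: "(nat \<times> nat) list \<times> nat list \<times> nat list" and B
  assume "B = snd (snd z) \<or> (\<exists>P. B = filter P (fst (snd z)))"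
  then show "improve (fst z) (fst (snd z)) X B = snd (snd z) \<or>
      (\<exists>P. improve (fst z) (fst (snd z)) X B = filter P (fst (snd z)))" for X
    by (auto simp: improve_def)
  have "sz B \<le> sz (snd (snd z)) \<or> sz B \<le> sz (fst (snd z))"
    using \<open>B = _ \<or> _\<close> sz_filter by blast
  then show "sz B \<le> sz z"
    unfolding enc_pair[of z] enc_pair[of "snd z"] vsize.simps by linarith
qed (auto intro!: pt_intros pbdd_intros)

lemma pt_bipartite_part [pt_intros]:
  "poly_time_on D f \<Longrightarrow> poly_time_on D g \<Longrightarrow> poly_time_on D (\<lambda>x. bipartite_part k (f x) (g x))"
proof (erule (1) pt_binary[where h = "bipartite_part k", rotated])
  let ?D = "UNIV :: ((nat \<times> nat) list \<times> nat list) set"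
  show "poly_time_on ?D (\<lambda>z. bipartite_part k (fst z) (snd z))"
    unfolding bipartite_part_def
  proof (rule pt_fold[where M = "\<lambda>x. sz (snd x)" and Inv = "\<lambda>x B. \<exists>P. B = filter P (snd x)"])
    fix x :: "(nat \<times> nat) list \<times> nat list" and B
    show "\<exists>P. [] = filter P (snd x)" by (intro exI[of _ "\<lambda>_. False"]) simp
    assume B: "\<exists>P. B = filter P (snd x)"
    show "\<exists>P. fold (improve (fst x) (snd x)) (lists_upto k (snd x)) B = filter P (snd x)"
      by (rule fold_invariant[where P = "\<lambda>B. \<exists>P. B = filter P (snd x)"]) (use B improve_filter in blast)+
    show "sz B \<le> sz (snd x)" using B sz_filter by blast
  next
    let ?S = "{z. fst z \<in> ?D \<and> fst (snd z) \<in> set (snd (fst z)) \<and> (\<exists>P. snd (snd z) = filter P (snd (fst z)))}"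
    have "poly_time_on ?S (\<lambda>z. (fst (fst z), snd (fst z), snd (snd z)))" by (intro pt_intros)
    from pt_comp[OF pt_improve_all[of k] this]
    show "poly_time_on ?S (\<lambda>z. fold (improve (fst (fst z)) (snd (fst z))) (lists_upto k (snd (fst z))) (snd (snd z)))"
      by simp
  qed (auto intro!: pt_intros pbdd_intros pbdd_sz_pt)
qed

subsection \<open>Flows\<close>

lemma sz_lookup: "sz (lookup d l k) \<le> sz d + sz l"
proof -
  consider "lookup d l k = d" | z where "z \<in> set l" "lookup d l k = snd z"
    using lookup_in[of d l k] by auto
  then show ?thesis
  proof cases
    case (2 z)
    then show ?thesis using sz_list_mem[OF 2(1)] sz_snd[of z] by simp
  qed simp
qed

context network
begin

text \<open>The value on an edge is at most the outflow of its tail, hence at most a capacity stored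
  in \<open>b\<close>; its binary length is therefore bounded by the input.\<close>

lemma sz_fl:
  assumes "\<forall>e\<in>K. 0 \<le> \<psi> e" "\<forall>u\<in>set P. outf \<psi> u \<le> cap u"
  shows "sz (fl \<psi>) \<le> 1 + sz ks * (1 + (sz ks + sz b + 2))"
  unfolding fl_def
proof (rule sz_list_le)
  show "length (map (\<lambda>e. (e, \<psi> e)) ks) \<le> sz ks" using length_le_sz[of ks] by simp
  fix z assume "z \<in> set (map (\<lambda>e. (e, \<psi> e)) ks)"
  then obtain e where e: "e \<in> K" "z = (e, \<psi> e)" by auto
  have "\<psi> e = (if fst e = fst e then \<psi> e else 0)" by simp
  also have "\<dots> \<le> outf \<psi> (fst e)"
    unfolding outf_def by (rule member_le_sum[OF e(1)]) (use assms(1) in auto)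
  also have "\<dots> \<le> cap (fst e)" using assms(2) e(1) ks by auto
  finally have "sz (\<psi> e) \<le> sz (cap (fst e))"
    unfolding enc_simps using assms(1) e(1) by (intro vsize_Atom_mono) auto
  moreover have "sz (cap (fst e)) \<le> 1 + sz b" using sz_lookup[of "0::int" b "fst e"] by (simp add: floorlog_def)
  moreover have "sz e < sz ks" by (rule sz_list_mem[OF e(1)])
  ultimately show "sz z \<le> sz ks + sz b + 2" unfolding e(2) enc_simps(4) vsize.simps by linarith
qed

text \<open>A stored flow can exceed the capacity of the reached vertex in \<open>Q\<close> and so
  need not be feasible. The outflows still respect the capacities, as only the source gains and had
  \<open>d\<close> units to spare, and this is what \<open>sz_fl\<close> asks for.\<close>

lemma sz_reach_inv:
  assumes \<phi>: "feasible \<phi>" and d: "0 \<le> d" and R: "reach_inv \<phi> d R"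
  shows "sz R \<le> 1 + sz (P @ Q) * (1 + (2 + sz (P @ Q) + sz ks * (1 + (sz ks + sz b + 2))))"
proof (rule sz_list_le)
  show "length R \<le> sz (P @ Q)" using length_reach_inv[OF R] length_le_sz[of "P @ Q"] by linarith
  fix z assume z: "z \<in> set R"
  then obtain \<psi> where \<psi>: "snd z = fl \<psi>" "\<forall>e\<in>K. 0 \<le> \<psi> e" "pushed \<phi> d (fst z) \<psi>" "fst z \<in> set P \<union> set Q"
    using R unfolding reach_inv_def by blast
  from \<psi>(3) obtain s where s: "outf \<phi> s + d \<le> cap s"
    "\<forall>u\<in>set P. outf \<psi> u = outf \<phi> u + (if u = s then d else 0) - (if u = fst z then d else 0)"
    unfolding pushed_def by blast
  have "\<forall>u\<in>set P. outf \<psi> u \<le> cap u" using s d \<phi> by (auto simp: feasible_def intro: order_trans)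
  then have "sz (snd z) \<le> 1 + sz ks * (1 + (sz ks + sz b + 2))" unfolding \<psi>(1) by (rule sz_fl[OF \<psi>(2)])
  moreover have "sz (fst z) < sz (P @ Q)" using \<psi>(4) by (intro sz_list_mem) simp
  ultimately show "sz z \<le> 2 + sz (P @ Q) + sz ks * (1 + (sz ks + sz b + 2))"
    unfolding enc_pair[of z] vsize.simps by linarith
qed

lemma phase_feasible:
  assumes "feasible \<phi>" "0 < d" obtains \<psi> where "phase P Q b d (fl \<phi>) = fl \<psi>" "feasible \<psi>"
proof -
  have "\<exists>\<psi>. phase P Q b d (fl \<phi>) = fl \<psi> \<and> feasible \<psi>"
    unfolding phase_def
    by (rule fold_invariant[where P = "\<lambda>F. \<exists>\<psi>. F = fl \<psi> \<and> feasible \<psi>"])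
      (use assms in \<open>auto elim: augment_feasible\<close>)
  then show thesis using that by blast
qed

end

text \<open>The sets of inputs in the time bounds range over many networks at once, so the
  invariants of the locale are repackaged as predicates in which the network is an argument.\<close>

definition is_flow :: "nat list \<Rightarrow> nat list \<Rightarrow> (nat \<times> int) list \<Rightarrow> (nat \<times> nat) list \<Rightarrow> flow \<Rightarrow> bool" where
  "is_flow P Q b ks F \<longleftrightarrow> network P Q ks b \<and> (\<exists>\<phi>. F = network.fl ks \<phi> \<and> network.feasible P Q ks b \<phi>)"

definition is_reach :: "nat list \<Rightarrow> nat list \<Rightarrow> (nat \<times> int) list \<Rightarrow> int \<Rightarrow> flow \<Rightarrow> (nat \<times> flow) list \<Rightarrow> bool" where
  "is_reach P Q b d F R \<longleftrightarrow> (\<exists>ks \<phi>. network P Q ks b \<and> F = network.fl ks \<phi> \<and> network.feasible P Q ks b \<phi> \<and>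
     network.reach_inv P Q ks b \<phi> d R)"

lemma is_flow_keys: "is_flow P Q b ks F \<Longrightarrow> map fst F = ks"
  unfolding is_flow_def using network.map_fst_fl by blast

lemma is_flow_zero:
  assumes "network P Q ks b"
  shows "is_flow P Q b ks (map (\<lambda>e. (e, 0)) ks)"
proof -
  interpret network P Q ks b by fact
  have "map (\<lambda>e. (e, 0)) ks = fl (\<lambda>_. 0)" by (simp add: fl_def)
  then show ?thesis unfolding is_flow_def using assms feasible_zero by blast
qed

lemma is_flow_preserved:
  assumes "is_flow P Q b ks F" "0 < d"
  shows "is_flow P Q b ks (augment P Q b d F)" "is_flow P Q b ks (phase P Q b d F)"
proof -
  obtain \<phi> where *: "network P Q ks b" "F = network.fl ks \<phi>" "network.feasible P Q ks b \<phi>"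
    using assms(1) unfolding is_flow_def by blast
  interpret network P Q ks b by fact
  obtain \<psi> where "augment P Q b d F = fl \<psi>" "feasible \<psi>"
    using augment_feasible[OF *(3) assms(2)] *(2) by blast
  then show "is_flow P Q b ks (augment P Q b d F)" unfolding is_flow_def using *(1) by blast
  obtain \<chi> where "phase P Q b d F = fl \<chi>" "feasible \<chi>"
    using phase_feasible[OF *(3) assms(2)] *(2) by blast
  then show "is_flow P Q b ks (phase P Q b d F)" unfolding is_flow_def using *(1) by blast
qed

lemma sz_is_flow:
  assumes "is_flow P Q b ks F"
  shows "sz F \<le> 1 + sz ks * (1 + (sz ks + sz b + 2))"
proof -
  obtain \<phi> where *: "network P Q ks b" "F = network.fl ks \<phi>" "network.feasible P Q ks b \<phi>"
    using assms(1) unfolding is_flow_def by blast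
  interpret network P Q ks b by fact
  show ?thesis unfolding *(2) by (rule sz_fl) (use *(3) in \<open>auto simp: feasible_def\<close>)
qed

lemma is_reach_sources: "is_flow P Q b ks F \<Longrightarrow> is_reach P Q b d F (sources P b d F)"
  unfolding is_flow_def is_reach_def using network.reach_inv_sources by blast

lemma is_reach_explore:
  assumes "is_reach P Q b d F R" "e \<in> set (map fst F)" "0 \<le> d"
  shows "is_reach P Q b d F (explore d e R)"
proof -
  obtain ks \<phi> where *: "network P Q ks b" "F = network.fl ks \<phi>" "network.feasible P Q ks b \<phi>"
    "network.reach_inv P Q ks b \<phi> d R" using assms(1) unfolding is_reach_def by blast
  interpret network P Q ks b by fact
  have "reach_inv \<phi> d (explore d e R)"
    by (rule reach_inv_explore[OF *(4) _ assms(3)]) (use assms(2) *(2) in simp)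
  then show ?thesis unfolding is_reach_def using *(1-3) by blast
qed

lemma is_reach_fold:
  "is_reach P Q b d F R \<Longrightarrow> 0 \<le> d \<Longrightarrow> is_reach P Q b d F (fold (explore d) (map fst F) R)"
  by (rule fold_invariant[where P = "is_reach P Q b d F"]) (assumption | rule is_reach_explore)+

lemma sz_is_reach:
  assumes "is_reach P Q b d F R" "0 \<le> d"
  shows "sz R \<le> 1 + sz (P @ Q) * (1 + (2 + sz (P @ Q) + sz (map fst F) * (1 + (sz (map fst F) + sz b + 2))))"
proof -
  obtain ks \<phi> where "network P Q ks b" "F = network.fl ks \<phi>" "network.feasible P Q ks b \<phi>"
    "network.reach_inv P Q ks b \<phi> d R" using assms(1) unfolding is_reach_def by blast
  then show ?thesis using network.sz_reach_inv[of P Q ks b \<phi> d R] network.map_fst_fl[of P Q ks b \<phi>] assms(2)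
    by metis
qed

lemma pt_out_flow [pt_intros]:
  "poly_time_on D f \<Longrightarrow> poly_time_on D g \<Longrightarrow> poly_time_on D (\<lambda>x. out_flow (f x) (g x))"
  by (rule pt_binary[where h = out_flow]) (unfold out_flow_def, intro pt_intros)

lemma pt_in_flow [pt_intros]:
  "poly_time_on D f \<Longrightarrow> poly_time_on D g \<Longrightarrow> poly_time_on D (\<lambda>x. in_flow (f x) (g x))"
  by (rule pt_binary[where h = in_flow]) (unfold in_flow_def, intro pt_intros)

lemma pt_shift [pt_intros]:
  "poly_time_on D f \<Longrightarrow> poly_time_on D g \<Longrightarrow> poly_time_on D k \<Longrightarrow> poly_time_on D (\<lambda>x. shift (f x) (g x) (k x))"
  by (rule pt_ternary[where h = shift]) (unfold shift_def, intro pt_intros)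

lemma pt_explore [pt_intros]:
  "poly_time_on D f \<Longrightarrow> poly_time_on D g \<Longrightarrow> poly_time_on D k \<Longrightarrow> poly_time_on D (\<lambda>x. explore (f x) (g x) (k x))"
  by (rule pt_ternary[where h = explore]) (unfold explore_def, intro pt_intros)

lemma pt_sources [pt_intros]:
  "poly_time_on D f \<Longrightarrow> poly_time_on D g \<Longrightarrow> poly_time_on D k \<Longrightarrow> poly_time_on D l \<Longrightarrow>
   poly_time_on D (\<lambda>x. sources (f x) (g x) (k x) (l x))"
  by (rule pt_quaternary[where h = sources]) (unfold sources_def, intro pt_intros)

type_synonym flow_input = "nat list \<times> nat list \<times> (nat \<times> int) list \<times> int \<times> flow"

text \<open>Sweeps and single exploration steps share the invariant \<open>is_reach\<close>. Its
  size bound refers to the input and not to the previous accumulator, so it does not deteriorate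
  over the nested loops.\<close>

lemma pt_reach:
  fixes D :: "flow_input set"
  assumes D: "\<And>P Q b d F. (P, Q, b, d, F) \<in> D \<Longrightarrow> 0 \<le> d \<and> (\<exists>ks. is_flow P Q b ks F)"
  shows "poly_time_on D (\<lambda>y. reach (fst y) (fst (snd y)) (fst (snd (snd y))) (fst (snd (snd (snd y))))
    (snd (snd (snd (snd y)))))"
proof -
  let ?P = "\<lambda>y :: flow_input. fst y" and ?Q = "\<lambda>y :: flow_input. fst (snd y)"
    and ?b = "\<lambda>y :: flow_input. fst (snd (snd y))" and ?d = "\<lambda>y :: flow_input. fst (snd (snd (snd y)))"
    and ?F = "\<lambda>y :: flow_input. snd (snd (snd (snd y)))"
  let ?Inv = "\<lambda>y R. is_reach (?P y) (?Q y) (?b y) (?d y) (?F y) R"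
  have d: "0 \<le> ?d y" if "y \<in> D" for y using D[of "?P y" "?Q y" "?b y" "?d y" "?F y"] that by simp
  have Inv0: "?Inv y (sources (?P y) (?b y) (?d y) (?F y))" if "y \<in> D" for y
    using D[of "?P y" "?Q y" "?b y" "?d y" "?F y"] that is_reach_sources by force
  have M: "pbdd D (\<lambda>y. 1 + sz (?P y @ ?Q y) * (1 + (2 + sz (?P y @ ?Q y) +
      sz (map fst (?F y)) * (1 + (sz (map fst (?F y)) + sz (?b y) + 2)))))"
    by (intro pbdd_intros pbdd_sz_pt pt_intros)
  have size: "sz R \<le> 1 + sz (?P y @ ?Q y) * (1 + (2 + sz (?P y @ ?Q y) +
      sz (map fst (?F y)) * (1 + (sz (map fst (?F y)) + sz (?b y) + 2))))"
    if "y \<in> D" "?Inv y R" for y R using sz_is_reach[OF that(2) d[OF that(1)]] .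
  let ?S = "{z. fst z \<in> D \<and> ?Inv (fst z) (snd z)}"
  have inner: "poly_time_on ?S (\<lambda>z. fold (explore (?d (fst z))) (map fst (?F (fst z))) (snd z))"
  proof (rule pt_fold[where Inv = "\<lambda>z R. ?Inv (fst z) R"
        and M = "\<lambda>z. 1 + sz (?P (fst z) @ ?Q (fst z)) * (1 + (2 + sz (?P (fst z) @ ?Q (fst z)) +
          sz (map fst (?F (fst z))) * (1 + (sz (map fst (?F (fst z))) + sz (?b (fst z)) + 2))))"])
    show "pbdd ?S (\<lambda>z. 1 + sz (?P (fst z) @ ?Q (fst z)) * (1 + (2 + sz (?P (fst z) @ ?Q (fst z)) +
        sz (map fst (?F (fst z))) * (1 + (sz (map fst (?F (fst z))) + sz (?b (fst z)) + 2)))))"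
      by (intro pbdd_intros pbdd_sz_pt pt_intros)
  next
    fix z e R assume "z \<in> ?S" "e \<in> set (map fst (?F (fst z)))" "?Inv (fst z) R"
    then show "?Inv (fst z) (explore (?d (fst z)) e R)" using is_reach_explore d by blast
  next
    fix z R assume "z \<in> ?S" "?Inv (fst z) R"
    then show "sz R \<le> 1 + sz (?P (fst z) @ ?Q (fst z)) * (1 + (2 + sz (?P (fst z) @ ?Q (fst z)) +
        sz (map fst (?F (fst z))) * (1 + (sz (map fst (?F (fst z))) + sz (?b (fst z)) + 2))))"
      using size by blast
  qed (simp | intro pt_intros)+
  show ?thesis
    unfolding reach_def
  proof (rule pt_fold[where Inv = ?Inv and M = "\<lambda>y. 1 + sz (?P y @ ?Q y) * (1 + (2 + sz (?P y @ ?Q y) +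
      sz (map fst (?F y)) * (1 + (sz (map fst (?F y)) + sz (?b y) + 2))))"])
    fix y and e :: nat and R assume "y \<in> D" "?Inv y R"
    then show "?Inv y (fold (explore (?d y)) (map fst (?F y)) R)" using is_reach_fold d by blast
  next
    show "poly_time_on {z. fst z \<in> D \<and> fst (snd z) \<in> set (?P (fst z) @ ?Q (fst z)) \<and> ?Inv (fst z) (snd (snd z))}
      (\<lambda>z. fold (explore (?d (fst z))) (map fst (?F (fst z))) (snd (snd z)))" (is "poly_time_on ?T _")
    proof -
      have "poly_time_on ?T (\<lambda>z. (fst z, snd (snd z)))" by (intro pt_intros)
      from pt_comp[OF inner this] show ?thesis by simp
    qed
  qed (erule Inv0 | rule M | erule (1) size | intro pt_intros)+
qed

lemma pt_augment:
  fixes D :: "flow_input set"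
  assumes D: "\<And>P Q b d F. (P, Q, b, d, F) \<in> D \<Longrightarrow> 0 \<le> d \<and> (\<exists>ks. is_flow P Q b ks F)"
  shows "poly_time_on D (\<lambda>y. augment (fst y) (fst (snd y)) (fst (snd (snd y))) (fst (snd (snd (snd y))))
    (snd (snd (snd (snd y)))))"
  unfolding augment_def
proof (rule pt_fold[where M = "\<lambda>y. sz (snd (snd (snd (snd y)))) + sz (reach (fst y) (fst (snd y)) (fst (snd (snd y))) (fst (snd (snd (snd y))))
      (snd (snd (snd (snd y)))))"
      and Inv = "\<lambda>y F'. F' \<in> insert (snd (snd (snd (snd y)))) (snd ` set (reach (fst y) (fst (snd y)) (fst (snd (snd y))) (fst (snd (snd (snd y))))
      (snd (snd (snd (snd y))))))", OF pt_reach[OF D]])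
  fix y :: flow_input and F'
  let ?R = "reach (fst y) (fst (snd y)) (fst (snd (snd y))) (fst (snd (snd (snd y)))) (snd (snd (snd (snd y))))"
  assume "F' \<in> insert (snd (snd (snd (snd y)))) (snd ` set ?R)"
  then consider "F' = snd (snd (snd (snd y)))" | z where "z \<in> set ?R" "F' = snd z" by blast
  then show "sz F' \<le> sz (snd (snd (snd (snd y)))) + sz ?R"
  proof cases
    case (2 z)
    then show ?thesis using sz_list_mem[OF 2(1)] sz_snd[of z] by simp
  qed simp
qed (auto intro!: pt_intros pbdd_intros pbdd_sz_pt pt_reach[OF D])

text \<open>The bound is phrased in terms of the edges \<open>map fst F\<close> of the initial flow,
  which augmentation does not change; a bound relative to the preceding flow would compound over the
  rounds.\<close>

lemma pt_phase:
  fixes D :: "flow_input set"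
  assumes D: "\<And>P Q b d F. (P, Q, b, d, F) \<in> D \<Longrightarrow> 0 < d \<and> (\<exists>ks. is_flow P Q b ks F)"
  shows "poly_time_on D (\<lambda>y. phase (fst y) (fst (snd y)) (fst (snd (snd y))) (fst (snd (snd (snd y))))
    (snd (snd (snd (snd y)))))"
  unfolding phase_def
proof (rule pt_fold[where M = "\<lambda>y. 1 + sz (map fst (snd (snd (snd (snd y))))) *
      (1 + (sz (map fst (snd (snd (snd (snd y))))) + sz (fst (snd (snd y))) + 2))"
      and Inv = "\<lambda>y F'. is_flow (fst y) (fst (snd y)) (fst (snd (snd y))) (map fst (snd (snd (snd (snd y))))) F'"])
  fix y :: flow_input and F'
  assume y: "y \<in> D"
  obtain ks where *: "0 < fst (snd (snd (snd y)))" "is_flow (fst y) (fst (snd y)) (fst (snd (snd y))) ks (snd (snd (snd (snd y))))"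
    using D[of "fst y" "fst (snd y)" "fst (snd (snd y))" "fst (snd (snd (snd y)))" "snd (snd (snd (snd y)))"] y by auto
  then show "is_flow (fst y) (fst (snd y)) (fst (snd (snd y))) (map fst (snd (snd (snd (snd y))))) (snd (snd (snd (snd y))))"
    using is_flow_keys by metis
  assume F': "is_flow (fst y) (fst (snd y)) (fst (snd (snd y))) (map fst (snd (snd (snd (snd y))))) F'"
  show "is_flow (fst y) (fst (snd y)) (fst (snd (snd y))) (map fst (snd (snd (snd (snd y)))))
      (augment (fst y) (fst (snd y)) (fst (snd (snd y))) (fst (snd (snd (snd y)))) F')"
    by (rule is_flow_preserved(1)[OF F' *(1)])
  show "sz F' \<le> 1 + sz (map fst (snd (snd (snd (snd y))))) *
      (1 + (sz (map fst (snd (snd (snd (snd y))))) + sz (fst (snd (snd y))) + 2))"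
    by (rule sz_is_flow[OF F'])
next
  let ?l = "\<lambda>y :: flow_input. (map (\<lambda>z. fst (fst z)) (snd (snd (snd (snd y)))) @ fst y @ fst (snd y)) @
     (map (\<lambda>z. fst (fst z)) (snd (snd (snd (snd y)))) @ fst y @ fst (snd y))"
  let ?S = "{z. fst z \<in> D \<and> fst (snd z) \<in> set (?l (fst z)) \<and>
     is_flow (fst (fst z)) (fst (snd (fst z))) (fst (snd (snd (fst z)))) (map fst (snd (snd (snd (snd (fst z)))))) (snd (snd z))}"
  let ?t = "\<lambda>z. (fst (fst z), fst (snd (fst z)), fst (snd (snd (fst z))), fst (snd (snd (snd (fst z)))), snd (snd z))"
  have t: "poly_time_on ?S ?t" by (intro pt_intros)
  have "poly_time_on (?t ` ?S) (\<lambda>y. augment (fst y) (fst (snd y)) (fst (snd (snd y))) (fst (snd (snd (snd y))))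
    (snd (snd (snd (snd y)))))"
    by (rule pt_augment) (use D in fastforce)
  from pt_comp[OF this t]
  show "poly_time_on ?S (\<lambda>z. augment (fst (fst z)) (fst (snd (fst z))) (fst (snd (snd (fst z)))) (fst (snd (snd (snd (fst z))))) (snd (snd z)))"
    by simp
qed (intro pbdd_intros pbdd_sz_pt pt_intros)+

text \<open>The least exponent is not computed directly: a loop collects the powers by doubling
  while they are at most \<open>W\<close>, with the condition for the next round in the first
  component. The number of rounds is at most the binary length of \<open>W\<close>.\<close>

lemma pt_powers [pt_intros]:
  "poly_time_on D f \<Longrightarrow> poly_time_on D (\<lambda>x. powers (f x))"
proof (erule pt_unary[where h = powers, rotated])
  define k where "k = (\<lambda>W :: int. LEAST k. W < 2 ^ k)"
  define h where "h = (\<lambda>y :: bool \<times> int \<times> int \<times> int list. let W = fst (snd y); d = fst (snd (snd y)) in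
    (d + d \<le> W, W, d + d, d # snd (snd (snd y))))"
  define init where "init = (\<lambda>W :: int. (1 \<le> W, W, 1 :: int, [] :: int list))"
  have ex: "W < 2 ^ floorlog 2 (nat \<bar>W\<bar>)" for W :: int
  proof -
    have "int (nat \<bar>W\<bar>) < int (2 ^ floorlog 2 (nat \<bar>W\<bar>))" using lt_floorlog of_nat_less_iff by blast
    then show ?thesis by simp
  qed
  have k: "W < 2 ^ k W" "k W \<le> sz W" for W
  proof -
    show "W < 2 ^ k W" unfolding k_def by (rule LeastI[where P = "\<lambda>k. W < 2 ^ k", OF ex])
    have "k W \<le> floorlog 2 (nat \<bar>W\<bar>)" unfolding k_def by (rule Least_le[where P = "\<lambda>k. W < 2 ^ k", OF ex])
    then show "k W \<le> sz W" by simp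
  qed
  have small: "2 ^ i \<le> W" if "i < k W" for i W
    using not_less_Least[of i "\<lambda>i. W < 2 ^ i"] that unfolding k_def by (simp add: not_less)
  have pow: "(h ^^ i) (init W) = (2 ^ i \<le> W, W, 2 ^ i, rev (map (\<lambda>i. 2 ^ i) [0..<i]))" for i W
    by (induction i) (simp_all add: init_def h_def Let_def)
  have ph: "poly_time_on UNIV h" unfolding h_def Let_def by (intro pt_intros)
  have "poly_time_on (range init) (\<lambda>y. (h ^^ k (fst (snd y))) y)"
  proof (rule pt_while[OF ph, where M = "\<lambda>y. 20 + 3 * sz (fst (snd y)) + sz (fst (snd y)) * (1 + sz (fst (snd y)))"])
    show "pbdd (range init) (\<lambda>y. k (fst (snd y)))"
      by (rule pbdd_mono[OF pbdd_sz_pt[OF pt_fst[OF pt_snd[OF pt_id]]]]) (rule k(2))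
    show "pbdd (range init) (\<lambda>y. 20 + 3 * sz (fst (snd y)) + sz (fst (snd y)) * (1 + sz (fst (snd y))))"
      by (intro pbdd_intros pbdd_sz_pt pt_intros)
  next
    fix y i assume "y \<in> range init" "i < k (fst (snd y))"
    then obtain W where W: "y = init W" "i < k W" by (auto simp: init_def)
    then show "(h ^^ i) y \<in> UNIV \<and> enc (fst ((h ^^ i) y)) \<noteq> Atom 0" using small[OF W(2)] by (simp add: pow)
  next
    fix y assume "y \<in> range init"
    then obtain W where W: "y = init W" by auto
    have "fst (snd y) = W" by (simp add: W init_def)
    then show "enc (fst ((h ^^ k (fst (snd y))) y)) = Atom 0" using k(1)[of W] by (simp add: W pow not_le)
  next
    fix y i assume y: "y \<in> range init" "i \<le> k (fst (snd y))"
    then obtain W where W: "y = init W" "i \<le> k W" by (auto simp: init_def)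
    have f: "fst (snd y) = W" by (simp add: W init_def)
    have bool: "sz (2 ^ i \<le> W) \<le> 2" unfolding enc_simps by (rule vsize_of_bool)
    \<comment> \<open>The power in the final state exceeds \<open>W\<close>, but for
      \<open>i > 0\<close> it is at most \<open>2 * W\<close>, since its half passed the
      test.\<close>
    have power: "sz (2 ^ i :: int) \<le> 2 + 2 * sz W"
    proof (cases i)
      case 0
      then show ?thesis by (simp add: floorlog_def)
    next
      case (Suc j)
      then have "2 ^ j \<le> W" using W(2) small by simp
      then have "vsize (Atom (2 ^ i)) \<le> vsize (Atom (W + W))" unfolding Suc by (intro vsize_Atom_mono) auto
      then show ?thesis using vsize_Atom_add[of W W] unfolding enc_simps by linarith
    qed
    have list: "sz (rev (map (\<lambda>i. 2 ^ i :: int) [0..<i])) \<le> 1 + sz W * (1 + sz W)"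
    proof (rule sz_list_le)
      show "length (rev (map (\<lambda>i. 2 ^ i :: int) [0..<i])) \<le> sz W" using W(2) k(2)[of W] by simp
      fix x :: int assume "x \<in> set (rev (map (\<lambda>i. 2 ^ i) [0..<i]))"
      then obtain j where "x = 2 ^ j" "j < k W" using W(2) by auto
      then show "sz x \<le> sz W" unfolding enc_simps using small[of j W] by (intro vsize_Atom_mono) auto
    qed
    show "sz ((h ^^ i) y) \<le> 20 + 3 * sz (fst (snd y)) + sz (fst (snd y)) * (1 + sz (fst (snd y)))"
      unfolding f unfolding W(1) pow enc_simps(4) vsize.simps(2) using bool power list by linarith
  qed
  from pt_comp[OF this, of UNIV init]
  have "poly_time_on UNIV (\<lambda>W. (h ^^ k (fst (snd (init W)))) (init W))"
    unfolding init_def by (simp add: pt_intros)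
  from pt_snd[OF pt_snd[OF pt_snd[OF this]]]
  show "poly_time_on UNIV powers"
    by (rule poly_time_on_cong) (simp only: pow, simp add: powers_def k_def init_def)
qed

subsection \<open>The complete algorithm\<close>

type_synonym network_input = "nat list \<times> nat list \<times> (nat \<times> int) list \<times> (nat \<times> nat) list"

lemma powers_pos: "d \<in> set (powers W) \<Longrightarrow> 0 < d"
  by (auto simp: powers_def)

lemma pt_max_flow:
  fixes D :: "network_input set"
  assumes D: "\<And>P Q b ks. (P, Q, b, ks) \<in> D \<Longrightarrow> network P Q ks b"
  shows "poly_time_on D (\<lambda>y. max_flow (fst y) (fst (snd y)) (fst (snd (snd y))) (snd (snd (snd y))))"
  unfolding max_flow_def
proof (rule pt_fold[where M = "\<lambda>y. 1 + sz (snd (snd (snd y))) * (1 + (sz (snd (snd (snd y))) + sz (fst (snd (snd y))) + 2))"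
      and Inv = "\<lambda>y F. is_flow (fst y) (fst (snd y)) (fst (snd (snd y))) (snd (snd (snd y))) F"])
  fix y :: network_input and F d
  assume y: "y \<in> D"
  show "is_flow (fst y) (fst (snd y)) (fst (snd (snd y))) (snd (snd (snd y))) (map (\<lambda>e. (e, 0)) (snd (snd (snd y))))"
    by (rule is_flow_zero, rule D) (use y in simp)
  assume F: "is_flow (fst y) (fst (snd y)) (fst (snd (snd y))) (snd (snd (snd y))) F"
  show "sz F \<le> 1 + sz (snd (snd (snd y))) * (1 + (sz (snd (snd (snd y))) + sz (fst (snd (snd y))) + 2))"
    by (rule sz_is_flow[OF F])
  assume "d \<in> set (powers (1 + sum_list (map (lookup 0 (fst (snd (snd y)))) (fst y))))"
  then show "is_flow (fst y) (fst (snd y)) (fst (snd (snd y))) (snd (snd (snd y)))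
      (phase (fst y) (fst (snd y)) (fst (snd (snd y))) d F)"
    using is_flow_preserved(2)[OF F] powers_pos by blast
next
  let ?S = "{z :: network_input \<times> int \<times> flow. fst z \<in> D \<and>
     fst (snd z) \<in> set (powers (1 + sum_list (map (lookup 0 (fst (snd (snd (fst z))))) (fst (fst z))))) \<and>
     is_flow (fst (fst z)) (fst (snd (fst z))) (fst (snd (snd (fst z)))) (snd (snd (snd (fst z)))) (snd (snd z))}"
  let ?t = "\<lambda>z :: network_input \<times> int \<times> flow. (fst (fst z), fst (snd (fst z)), fst (snd (snd (fst z))), fst (snd z), snd (snd z))"
  have t: "poly_time_on ?S ?t" by (intro pt_intros)
  have "poly_time_on (?t ` ?S) (\<lambda>y. phase (fst y) (fst (snd y)) (fst (snd (snd y))) (fst (snd (snd (snd y))))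
    (snd (snd (snd (snd y)))))"
    by (rule pt_phase) (auto dest: powers_pos)
  from pt_comp[OF this t]
  show "poly_time_on ?S (\<lambda>z. phase (fst (fst z)) (fst (snd (fst z))) (fst (snd (snd (fst z)))) (fst (snd z)) (snd (snd z)))"
    by simp
qed (intro pbdd_intros pbdd_sz_pt pt_intros)+

lemma pt_bip_indep:
  fixes D :: "network_input set"
  assumes D: "\<And>P Q b ks. (P, Q, b, ks) \<in> D \<Longrightarrow> network P Q ks b"
  shows "poly_time_on D (\<lambda>y. bip_indep (fst y) (fst (snd y)) (fst (snd (snd y))) (snd (snd (snd y))))"
proof -
  let ?F = "\<lambda>y :: network_input. max_flow (fst y) (fst (snd y)) (fst (snd (snd y))) (snd (snd (snd y)))"
  let ?t = "\<lambda>y :: network_input. (fst y, fst (snd y), fst (snd (snd y)), 1 :: int, ?F y)"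
  have t: "poly_time_on D ?t" by (intro pt_intros pt_max_flow D)
  have flow: "is_flow P Q b ks (max_flow P Q b ks)" if "(P, Q, b, ks) \<in> D" for P Q b ks
  proof -
    interpret network P Q ks b by (rule D[OF that])
    obtain \<psi> where "max_flow P Q b ks = fl \<psi>" "feasible \<psi>" by (rule max_flow_correct)
    then show ?thesis unfolding is_flow_def using D[OF that] by blast
  qed
  have "poly_time_on (?t ` D) (\<lambda>y. reach (fst y) (fst (snd y)) (fst (snd (snd y))) (fst (snd (snd (snd y))))
    (snd (snd (snd (snd y)))))"
    by (rule pt_reach) (use flow in fastforce)
  from pt_comp[OF this t]
  have R: "poly_time_on D (\<lambda>y. reach (fst y) (fst (snd y)) (fst (snd (snd y))) 1 (?F y))" by simp
  have "poly_time_on UNIV (\<lambda>z :: network_input \<times> nat list.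
      filter (\<lambda>u. u \<in> set (snd z)) (fst (fst z)) @ filter (\<lambda>v. v \<notin> set (snd z)) (fst (snd (fst z))))"
    by (intro pt_intros)
  from pt_comp[OF this, of D "\<lambda>y. (y, map fst (reach (fst y) (fst (snd y)) (fst (snd (snd y))) 1 (?F y)))"]
  show ?thesis unfolding bip_indep_def by (simp add: pt_intros R)
qed

lemma pt_product [pt_intros]:
  assumes "poly_time_on D f" "poly_time_on D g"
  shows "poly_time_on D (\<lambda>x. List.product (f x) (g x))"
proof (rule pt_binary[where h = List.product, OF _ assms])
  have "poly_time_on UNIV (\<lambda>z. concat (map (\<lambda>x. map (\<lambda>y. (x, y)) (snd z)) (fst z)))"
    by (intro pt_intros)
  then show "poly_time_on UNIV (\<lambda>z. List.product (fst z) (snd z))"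
    unfolding product_concat_map .
qed

lemma pt_solve_part:
  fixes D :: "((nat \<times> nat) list \<times> (nat \<times> int) list \<times> colouring \<times> nat list) set"
  assumes D: "\<And>es b C H. (es, b, C, H) \<in> D \<Longrightarrow> distinct H \<and> (\<forall>v. 0 \<le> lookup 0 b v)"
  shows "poly_time_on D (\<lambda>y. solve_part (fst y) (fst (snd y)) (fst (snd (snd y))) (snd (snd (snd y))))"
proof -
  let ?P = "\<lambda>y :: (nat \<times> nat) list \<times> (nat \<times> int) list \<times> colouring \<times> nat list. filter (\<lambda>v. \<not> col_of (fst (snd (snd y))) v) (snd (snd (snd y)))"
  let ?Q = "\<lambda>y :: (nat \<times> nat) list \<times> (nat \<times> int) list \<times> colouring \<times> nat list. filter (\<lambda>v. col_of (fst (snd (snd y))) v) (snd (snd (snd y)))"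
  let ?t = "\<lambda>y. (?P y, ?Q y, fst (snd y), filter (\<lambda>e. adj (fst y) (fst e) (snd e)) (List.product (?P y) (?Q y)))"
  have t: "poly_time_on D ?t" by (intro pt_intros)
  have "poly_time_on (?t ` D) (\<lambda>y. bip_indep (fst y) (fst (snd y)) (fst (snd (snd y))) (snd (snd (snd y))))"
  proof (rule pt_bip_indep)
    fix P Q b ks assume "(P, Q, b, ks) \<in> ?t ` D"
    then obtain es C H where "(es, b, C, H) \<in> D" "P = filter (\<lambda>v. \<not> col_of C v) H" "Q = filter (\<lambda>v. col_of C v) H"
      "ks = filter (\<lambda>e. adj es (fst e) (snd e)) (List.product P Q)" by fastforce
    then show "network P Q ks b" using filter_colour_network[of H b C es] D[of es b C H] by blast
  qed
  from pt_comp[OF this t] show ?thesis by (simp add: solve_part_def)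
qed

lemma pt_remaining [pt_intros]:
  "poly_time_on D f \<Longrightarrow> poly_time_on D g \<Longrightarrow> poly_time_on D k \<Longrightarrow> poly_time_on D (\<lambda>x. remaining (f x) (g x) (k x))"
  by (rule pt_ternary[where h = remaining]) (unfold remaining_def, intro pt_intros)

type_synonym candidate_input = "(nat \<times> nat) list \<times> (nat \<times> int) list \<times> nat list \<times> nat list"

lemma pt_candidate:
  fixes D :: "candidate_input set"
  assumes D: "\<And>es b B X. (es, b, B, X) \<in> D \<Longrightarrow> distinct B \<and> (\<forall>v. 0 \<le> lookup 0 b v)"
  shows "poly_time_on D (\<lambda>y. candidate (fst y) (fst (snd y)) (fst (snd (snd y))) (snd (snd (snd y))))"
proof -
  let ?t = "\<lambda>y :: candidate_input. (fst y, fst (snd y), two_colouring (fst y) (fst (snd (snd y))),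
    remaining (fst y) (fst (snd (snd y))) (snd (snd (snd y))))"
  have t: "poly_time_on D ?t" by (intro pt_intros)
  have "poly_time_on (?t ` D) (\<lambda>y. solve_part (fst y) (fst (snd y)) (fst (snd (snd y))) (snd (snd (snd y))))"
    by (rule pt_solve_part) (use D in \<open>fastforce simp: remaining_def\<close>)
  from pt_comp[OF this t]
  have S: "poly_time_on D (\<lambda>y. solve_part (fst y) (fst (snd y)) (two_colouring (fst y) (fst (snd (snd y))))
    (remaining (fst y) (fst (snd (snd y))) (snd (snd (snd y)))))" by simp
  have "poly_time_on UNIV (\<lambda>z :: candidate_input \<times> nat list.
      if list_all (\<lambda>u. list_all (\<lambda>v. \<not> adj (fst (fst z)) u v) (snd (snd (snd (fst z))))) (snd (snd (snd (fst z))))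
      then filter (\<lambda>v. v \<in> set (snd (snd (snd (fst z)))) \<or> v \<in> set (snd z)) (map fst (fst (snd (fst z)))) else [])"
    by (intro pt_intros)
  from pt_comp[OF this pt_Pair[OF pt_id S]] show ?thesis by (simp add: candidate_def cong: if_cong)
qed

lemma pt_weight [pt_intros]:
  "poly_time_on D f \<Longrightarrow> poly_time_on D g \<Longrightarrow> poly_time_on D (\<lambda>x. weight (f x) (g x))"
  by (rule pt_binary[where h = weight]) (unfold weight_def, intro pt_intros)

lemma pt_best_candidate:
  fixes D :: "((nat \<times> nat) list \<times> (nat \<times> int) list \<times> nat list \<times> nat list list) set"
  assumes D: "\<And>es b B Xs. (es, b, B, Xs) \<in> D \<Longrightarrow> distinct B \<and> (\<forall>v. 0 \<le> lookup 0 b v)"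
  shows "poly_time_on D (\<lambda>y. best_candidate (fst y) (fst (snd y)) (fst (snd (snd y))) (snd (snd (snd y))))"
  unfolding best_candidate_def
proof (rule pt_fold[where M = "\<lambda>y. sz (map fst (fst (snd y)))"
      and Inv = "\<lambda>y I. \<exists>P. I = filter P (map fst (fst (snd y)))"])
  fix y :: "(nat \<times> nat) list \<times> (nat \<times> int) list \<times> nat list \<times> nat list list" and I X
  show nil: "\<exists>P. [] = filter P (map fst (fst (snd y)))"
    by (intro exI[of _ "\<lambda>_. False"]) (simp add: filter_empty_conv[symmetric])
  assume I: "\<exists>P. I = filter P (map fst (fst (snd y)))"
  show "sz I \<le> sz (map fst (fst (snd y)))" using I sz_filter by blast
  have "\<exists>P. candidate (fst y) (fst (snd y)) (fst (snd (snd y))) X = filter P (map fst (fst (snd y)))"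
    unfolding candidate_def using nil by (cases "list_all (\<lambda>u. list_all (\<lambda>v. \<not> adj (fst y) u v) X) X") auto
  then show "\<exists>P. (if weight (fst (snd y)) I < weight (fst (snd y)) (candidate (fst y) (fst (snd y)) (fst (snd (snd y))) X)
      then candidate (fst y) (fst (snd y)) (fst (snd (snd y))) X else I) = filter P (map fst (fst (snd y)))"
    using I by auto
next
  let ?S = "{z. fst z \<in> D \<and> fst (snd z) \<in> set (snd (snd (snd (fst z)))) \<and>
    (\<exists>P. snd (snd z) = filter P (map fst (fst (snd (fst z)))))}"
  let ?t = "\<lambda>z. (fst (fst z), fst (snd (fst z)), fst (snd (snd (fst z))), fst (snd z))"
  have t: "poly_time_on ?S ?t" by (intro pt_intros)
  have "poly_time_on (?t ` ?S) (\<lambda>y. candidate (fst y) (fst (snd y)) (fst (snd (snd y))) (snd (snd (snd y))))"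
    by (rule pt_candidate) (use D in fastforce)
  from pt_comp[OF this t]
  have c: "poly_time_on ?S (\<lambda>z. candidate (fst (fst z)) (fst (snd (fst z))) (fst (snd (snd (fst z)))) (fst (snd z)))"
    by simp
  show "poly_time_on ?S (\<lambda>z. if weight (fst (snd (fst z))) (snd (snd z)) <
        weight (fst (snd (fst z))) (candidate (fst (fst z)) (fst (snd (fst z))) (fst (snd (snd (fst z)))) (fst (snd z)))
      then candidate (fst (fst z)) (fst (snd (fst z))) (fst (snd (snd (fst z)))) (fst (snd z)) else snd (snd z))"
    by (intro pt_if pt_less_int pt_weight c pt_fst pt_snd pt_id poly_time_on_subset[OF c]) auto
qed (intro pbdd_intros pbdd_sz_pt pt_intros)+

lemma pt_scaled_weights [pt_intros]:
  "poly_time_on D f \<Longrightarrow> poly_time_on D (\<lambda>x. scaled_weights (f x))"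
  by (rule pt_unary[where h = scaled_weights]) (unfold scaled_weights_def, intro pt_intros)

lemma lookup_scaled_weights: "0 \<le> lookup 0 (scaled_weights ws) v"
  using lookup_in[of 0 "scaled_weights ws" v] by (auto simp: scaled_weights_def less_imp_le)

text \<open>Distinct vertex names make the colour classes free of duplicates, and the filter in
  \<open>scaled_weights\<close> makes all capacities nonnegative; so the inputs of the flow
  computation are networks and its size bounds apply.\<close>

lemma pt_mwis: "poly_time_on {x. distinct (map fst (fst x))} (mwis p)" (is "poly_time_on ?D _")
proof -
  let ?b = "\<lambda>x :: (nat \<times> int \<times> int) list \<times> (nat \<times> nat) list. scaled_weights (fst x)"
  let ?t = "\<lambda>x. (snd x, ?b x, bipartite_part (2 * p + 1) (snd x) (map fst (?b x)), lists_upto p (map fst (?b x)))"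
  have t: "poly_time_on ?D ?t" by (intro pt_intros)
  have "poly_time_on (?t ` ?D) (\<lambda>y. best_candidate (fst y) (fst (snd y)) (fst (snd (snd y))) (snd (snd (snd y))))"
  proof (rule pt_best_candidate)
    fix es b B Xs assume "(es, b, B, Xs) \<in> ?t ` ?D"
    then obtain ws where *: "distinct (map fst ws)" "b = scaled_weights ws" "B = bipartite_part (2 * p + 1) es (map fst b)"
      by fastforce
    have "distinct (map fst b)"
      unfolding *(2) scaled_weights_def using *(1) by (auto simp: distinct_map comp_def inj_on_def)
    then show "distinct B \<and> (\<forall>v. 0 \<le> lookup 0 b v)"
      using bipartite_part_correct(1)[of es "map fst b" "2 * p + 1"] lookup_scaled_weights *(2,3)
      by (auto simp: sublist_bip_def)
  qed
  from pt_comp[OF this t] show ?thesis unfolding mwis_def by simp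
qed

text \<open>In the initial state all variables but 0 are zero, so it meets the scratch condition of
  \<open>runs\<close> for every \<open>N\<close>.\<close>

lemma poly_time_on_computes:
  assumes "poly_time_on D f"
  obtains c p where "\<And>x. x \<in> D \<Longrightarrow> \<exists>t. computes c (enc x) t (enc (f x)) \<and> t \<le> poly p (sz x)"
proof -
  from assms obtain c N g where c: "pbdd D g" "\<And>x. x \<in> D \<Longrightarrow> runs c N (enc x) (g x) (enc (f x))"
    unfolding poly_time_on_def by blast
  then obtain p where p: "\<And>x. x \<in> D \<Longrightarrow> g x \<le> poly p (sz x)" unfolding pbdd_def by blast
  have "\<exists>t. computes c (enc x) t (enc (f x)) \<and> t \<le> poly p (sz x)" if x: "x \<in> D" for x
  proof -
    let ?s = "(\<lambda>_. Atom 0)(0 := enc x)"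
    have "?s 0 = enc x \<and> (\<forall>i. 0 < i \<and> i < N \<longrightarrow> ?s i = Atom 0)" by simp
    then obtain t where "t \<le> g x" "exec c ?s t (?s(0 := enc (f x)))"
      using c(2)[OF x] unfolding runs_def by blast
    then show ?thesis unfolding computes_def using p[OF x] by (intro exI[of _ t]) fastforce
  qed
  then show thesis using that by blast
qed

theorem theorem5p30:
  fixes \<G> :: "ugraph set"
  assumes "graph_class \<G>" and "clique_bounded oct \<G>"
  shows "\<exists>c. poly_time_MWIS_algorithm c \<G>"
proof -
  obtain f :: "nat \<Rightarrow> nat" where f: "mono f"
    "\<And>G H. G \<in> \<G> \<Longrightarrow> induced_subgraph H G \<Longrightarrow> oct H \<le> f (clique_number H)"
    using assms(2) unfolding clique_bounded_def by blast
  \<comment> \<open>Program and polynomial are fixed before any graph is considered; they depend on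
    the class only through the constant \<open>f 3\<close>. From here on \<open>p\<close> is the
    polynomial.\<close>
  obtain c p where c: "\<And>x. distinct (map fst (fst x)) \<Longrightarrow>
      \<exists>t. computes c (enc x) t (enc (mwis (f 3) x)) \<and> t \<le> poly p (sz x)"
    using poly_time_on_computes[OF pt_mwis[of "f 3"]] by (metis mem_Collect_eq)
  have "poly_time_MWIS_algorithm c \<G>"
    unfolding poly_time_MWIS_algorithm_def
  proof (intro exI[of _ p] ballI allI impI)
    fix G w x assume G: "G \<in> \<G>" and "encodes_weighted_graph G w x"
    then obtain vs es where vs: "distinct vs" "set vs = verts G"
      and es: "set (map (\<lambda>(u, v). {u, v}) es) = edges G"
      and x: "x = Node (val_of_list (map (\<lambda>v. Node (val_of_nat v) (val_of_rat (w v))) vs))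
              (val_of_list (map (\<lambda>(u, v). Node (val_of_nat u) (val_of_nat v)) es))"
      unfolding encodes_weighted_graph_def by blast
    let ?x = "(map (\<lambda>v. (v, quotient_of (w v))) vs, es)"
    \<comment> \<open>The prescribed encoding of instances coincides with the generic one of the two
      lists, so the input reaches \<open>mwis\<close> without conversion.\<close>
    have "val_of_rat q = enc (quotient_of q)" for q
      by (simp add: val_of_rat_def split: prod.split)
    then have x: "x = enc ?x"
    proof -
      have a: "map (\<lambda>v. Node (val_of_nat v) (val_of_rat (w v))) vs = map enc (map (\<lambda>v. (v, quotient_of (w v))) vs)"
        by (simp add: val_of_nat_def \<open>\<And>q. val_of_rat q = _\<close>)
      have b: "map (\<lambda>(u, v). Node (val_of_nat u) (val_of_nat v)) es = map enc es"
        by (auto simp: val_of_nat_def)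
      show ?thesis unfolding x enc_simps(4) enc_list_def a b ..
    qed
    have "bounded_oct_graph G es (f 3)"
    proof
      show "simple_graph G" using assms(1) G by (auto simp: graph_class_def)
      \<comment> \<open>Monotonicity of \<open>f\<close> turns the bound 3 on the clique number into
        the bound \<open>f 3\<close>.\<close>
      show "oct H \<le> f 3" if "induced_subgraph H G" "clique_number H \<le> 3" for H
        using f(2)[OF G that(1)] monoD[OF f(1) that(2)] by linarith
    qed (rule es)
    then interpret bounded_oct_graph G es "f 3" .
    let ?I = "mwis (f 3) ?x"
    have I: "distinct ?I" "max_weight_indep_set G w (set ?I)"
      by (rule mwis_correct[OF vs])+
    obtain t where t: "computes c (enc ?x) t (enc ?I)" "t \<le> poly p (sz ?x)"
      using c[of ?x] vs(1) by (auto simp: comp_def)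
    have "encodes_vertex_set (set ?I) (enc ?I)"
      unfolding encodes_vertex_set_def using I(1)
      by (intro exI[of _ ?I]) (simp add: enc_list_def val_of_nat_def cong: map_cong)
    then show "\<exists>t y I. computes c x t y \<and> t \<le> poly p (vsize x) \<and>
        encodes_vertex_set I y \<and> max_weight_indep_set G w I"
      unfolding x using t I(2) by blast
  qed
  then show ?thesis by blast
qed

end
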